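(* Let $N\ge2$, $M\ge1$, $k\ge0$ be integers and $f:[0,1]\to\mathbb R$ concave. For every density matrix $\rho$ on $\mathcal H_M$ and every unit vector $u\in\mathbb C^N$, $$\mathrm{Tr}_{\mathcal H_{M+k}} f\big(\widehat{\mathcal T}^k(\rho)\big)\;\ge\;\mathrm{Tr}_{\mathcal H_{M+k}} f\big(\widehat{\mathcal T}^k(|\otimes^M u\rangle\langle \otimes^M u|)\big).$$ Moreover, if $M\ge2$, $k>0$ and $f$ is strictly concave, equality holds if and only if $\rho=|\otimes^M w\rangle\langle\otimes^M w|$ for some unit vector $w\in\mathbb C^N$.
   Context: For $n\ge 0$, $\mathcal H_n=P_n(\mathbb C^N)^{\otimes n}$ is the totally symmetric subspace, $P_n$ the orthogonal projection with $P_n\, u_1\otimes\cdots\otimes u_n=\frac1{n!}\sum_{\sigma\in S_n}u_{\sigma(1)}\otimes\cdots\otimes u_{\sigma(n)}$. An operator $\Gamma$ on $\mathcal H_M$ is extended to $(\mathbb C^N)^{\otimes M}$ by $\Gamma=P_M\Gamma P_M$. For $k\ge0$ define the operator on $\mathcal H_{M+k}$ $$\mathcal T^k(\Gamma)=\frac{(M+k)!}{M!}\,P_{M+k}\big(I_{\mathbb C^N}^{\otimes k}\otimes\Gamma\big)P_{M+k},$$ which satisfies $\mathrm{Tr}\,\mathcal T^k(\Gamma)=\frac{(M+k+N-1)!}{(M+N-1)!}\mathrm{Tr}\,\Gamma$, and the trace-preserving normalization $\widehat{\mathcal T}^k=\frac{(M+N-1)!}{(M+k+N-1)!}\mathcal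 T^k$ (the universal $M$-to-$M+k$ cloning channel). $\otimes^M u=u\otimes\cdots\otimes u$. A density matrix is a positive semidefinite operator of trace one. *)

theory Defs
  imports "HOL-Analysis.Analysis" "HOL-Combinatorics.Permutations"
begin

text \<open>Concrete model of (C^N)^{tensor n}: basis vectors are indexed by words of length n
  over the alphabet {0..<N}. Vectors are functions on words, operators are kernels
  (matrices) indexed by pairs of words. Only values on words matter.\<close>

definition words :: "nat \<Rightarrow> nat \<Rightarrow> nat list set" where
  "words N n = {xs. length xs = n \<and> (\<forall>x\<in>set xs. x < N)}"

type_synonym vec = "nat list \<Rightarrow> complex"
type_synonym op = "nat list \<Rightarrow> nat list \<Rightarrow> complex"

definition inner_w :: "nat \<Rightarrow> nat \<Rightarrow> vec \<Rightarrow> vec \<Rightarrow> complex" where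
  "inner_w N n a b = (\<Sum>xs\<in>words N n. cnj (a xs) * b xs)"

definition app_op :: "nat \<Rightarrow> nat \<Rightarrow> op \<Rightarrow> vec \<Rightarrow> vec" where
  "app_op N n A v = (\<lambda>xs. \<Sum>ys\<in>words N n. A xs ys * v ys)"

definition mult_op :: "nat \<Rightarrow> nat \<Rightarrow> op \<Rightarrow> op \<Rightarrow> op" where
  "mult_op N n A B = (\<lambda>xs zs. \<Sum>ys\<in>words N n. A xs ys * B ys zs)"

definition trace_op :: "nat \<Rightarrow> nat \<Rightarrow> op \<Rightarrow> complex" where
  "trace_op N n A = (\<Sum>xs\<in>words N n. A xs xs)"

text \<open>Symmetrizer P_n: P_n (u_1 x...x u_n) = 1/n! sum_sigma u_{sigma 1} x ... x u_{sigma n}.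
  Its matrix entry at (xs, ys) is 1/n! times the number of sigma with xs_i = ys_{sigma i}.\<close>
definition sym_proj :: "nat \<Rightarrow> nat \<Rightarrow> op" where
  "sym_proj N n = (\<lambda>xs ys. of_nat (card {\<sigma>. \<sigma> permutes {..<n} \<and> (\<forall>i<n. xs ! i = ys ! (\<sigma> i))})
                          / of_nat (fact n))"

definition sym_space :: "nat \<Rightarrow> nat \<Rightarrow> vec set" where
  "sym_space N n = {v. (\<forall>xs. xs \<notin> words N n \<longrightarrow> v xs = 0) \<and>
                       (\<forall>xs\<in>words N n. app_op N n (sym_proj N n) v xs = v xs)}"

definition id_tensor :: "nat \<Rightarrow> op \<Rightarrow> op" where
  "id_tensor k G = (\<lambda>xs ys. (if take k xs = take k ys then 1 else 0) * G (drop k xs) (drop k ys))"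

definition clone_T :: "nat \<Rightarrow> nat \<Rightarrow> nat \<Rightarrow> op \<Rightarrow> op" where
  "clone_T N M k G = (\<lambda>xs ys. (of_nat (fact (M+k)) / of_nat (fact M)) *
      mult_op N (M+k) (mult_op N (M+k) (sym_proj N (M+k)) (id_tensor k G)) (sym_proj N (M+k)) xs ys)"

definition clone_hat :: "nat \<Rightarrow> nat \<Rightarrow> nat \<Rightarrow> op \<Rightarrow> op" where
  "clone_hat N M k G = (\<lambda>xs ys. (of_nat (fact (M+N-1)) / of_nat (fact (M+k+N-1))) * clone_T N M k G xs ys)"

definition tensor_pow :: "nat \<Rightarrow> (nat \<Rightarrow> complex) \<Rightarrow> vec" where
  "tensor_pow M u = (\<lambda>xs. \<Prod>i<M. u (xs ! i))"

definition proj_op :: "vec \<Rightarrow> op" where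
  "proj_op v = (\<lambda>xs ys. v xs * cnj (v ys))"

definition unit_vec :: "nat \<Rightarrow> (nat \<Rightarrow> complex) \<Rightarrow> bool" where
  "unit_vec N u \<longleftrightarrow> (\<Sum>i<N. (cmod (u i))\<^sup>2) = 1"

text \<open>Density matrix on H_M (extended to the full tensor space by Gamma = P Gamma P).\<close>
definition density_op :: "nat \<Rightarrow> nat \<Rightarrow> op \<Rightarrow> bool" where
  "density_op N M \<rho> \<longleftrightarrow>
     (\<forall>xs\<in>words N M. \<forall>ys\<in>words N M.
        mult_op N M (mult_op N M (sym_proj N M) \<rho>) (sym_proj N M) xs ys = \<rho> xs ys) \<and>
     (\<forall>v. inner_w N M v (app_op N M \<rho> v) \<in> \<real> \<and> Re (inner_w N M v (app_op N M \<rho> v)) \<ge> 0) \<and>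
     trace_op N M \<rho> = 1"

definition eig_decomp :: "nat \<Rightarrow> nat \<Rightarrow> op \<Rightarrow> vec list \<Rightarrow> complex list \<Rightarrow> bool" where
  "eig_decomp N n A vs ls \<longleftrightarrow> length vs = length ls \<and>
     (\<forall>j<length vs. vs ! j \<in> sym_space N n) \<and>
     (\<forall>i<length vs. \<forall>j<length vs. inner_w N n (vs ! i) (vs ! j) = (if i = j then 1 else 0)) \<and>
     (\<forall>v\<in>sym_space N n. \<forall>xs. v xs = (\<Sum>j<length vs. inner_w N n (vs ! j) v * (vs ! j) xs)) \<and>
     (\<forall>j<length vs. \<forall>xs\<in>words N n. app_op N n A (vs ! j) xs = ls ! j * (vs ! j) xs)"

definition trace_fun :: "nat \<Rightarrow> nat \<Rightarrow> (real \<Rightarrow> real) \<Rightarrow> op \<Rightarrow> real" where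
  "trace_fun N n f A = (THE s. \<exists>vs ls. eig_decomp N n A vs ls \<and> s = (\<Sum>j<length ls. f (Re (ls ! j))))"

definition strictly_concave_on :: "real set \<Rightarrow> (real \<Rightarrow> real) \<Rightarrow> bool" where
  "strictly_concave_on S f \<longleftrightarrow> (\<forall>x\<in>S. \<forall>y\<in>S. x \<noteq> y \<longrightarrow>
      (\<forall>t. 0 < t \<and> t < 1 \<longrightarrow> f ((1 - t) * x + t * y) > (1 - t) * f x + t * f y))"

end

(* The spectrum of the output of the cloner is majorized by that of a coherent input; concavity then
   gives the inequality (Karamata). By linearity only a pure input \<phi> matters. There the output is
   A A^* for the map A w = P(w \<otimes> \<phi>) on the k-particle space, with the same nonzero spectrum as A^* A.
   Expanding the permutations in P by the number l of letters exchanged between w and \<phi> writes A^* A as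
   a positive combination of outputs of cloners with k - l added particles applied to the l-particle
   reduced states of \<phi>. By induction on k each of these is majorized by its coherent counterpart, and
   the coherent ones have a common ordered eigenbasis, so their bounds add up (Vandermonde).
   In the case of equality the largest eigenvalues agree, which forces I \<otimes> \<rho> to fix a symmetric vector;
   then \<rho> is pure and the vector is a product, hence coherent. *)
theory Submission
  imports Defs
begin

section \<open>Words and symmetric vectors\<close>

text \<open>Majorization is carried in Ky Fan form: the expectation values of any m orthonormal
  vectors sum to at most the first m coherent eigenvalues. Such bounds are linear in the state and
  add up. The obstacle is that the bounds for different l come from different cloners; they can be
  added only because the coherent eigenvalues, \<open>coh_eval M k r\<close> up to
  \<open>clone_const\<close>, all decrease in the same parameter r, the number of particles outside
  the mode u, and \<open>level N j\<close>, the r of the j-th basis vector, depends on neither M nor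
  k. The identity C(k,l) \<open>coh_eval l (k - l) r\<close> = C(k-r,l) then feeds Vandermonde.
  Karamata needs equal totals over the whole space, zero eigenvalues included, so the induction is
  also run with = in place of <=, on orthonormal bases. Operators act through their quadratic forms
  on symmetric vectors, which keeps the values of a kernel outside the words out of the argument. In
  the equality case the largest coherent eigenvalue is \<open>clone_const\<close> itself, so
  attaining it means that I tensor rho has expectation 1 in a unit vector.\<close>

lemma words_0 [simp]: "words N 0 = {[]}"
  by (auto simp: words_def)

lemma words_Cons_iff [simp]: "x # xs \<in> words N (Suc n) \<longleftrightarrow> x < N \<and> xs \<in> words N n"
  by (auto simp: words_def)

lemma length_words: "xs \<in> words N n \<Longrightarrow> length xs = n"
  by (simp add: words_def)

lemma words_Suc: "words N (Suc n) = (\<lambda>(x, xs). x # xs) ` ({..<N} \<times> words N n)"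
  by (auto simp: words_def image_iff length_Suc_conv)

lemma finite_words [simp]: "finite (words N n)"
  by (induction n) (simp_all add: words_Suc)

lemma sum_words_Suc:
  "(\<Sum>xs\<in>words N (Suc n). f xs) = (\<Sum>x<N. \<Sum>xs\<in>words N n. f (x # xs))"
proof -
  have "inj_on (\<lambda>(x, xs). x # xs) ({..<N} \<times> words N n)"
    by (auto simp: inj_on_def)
  then show ?thesis
    by (simp add: words_Suc sum.reindex sum.cartesian_product case_prod_unfold)
qed

lemma sum_words_append:
  "(\<Sum>xs\<in>words N (m + n). f xs) = (\<Sum>a\<in>words N m. \<Sum>b\<in>words N n. f (a @ b))"
  by (induction m arbitrary: f) (simp_all add: sum_words_Suc)

lemma append_in_words: "a \<in> words N m \<Longrightarrow> b \<in> words N n \<Longrightarrow> a @ b \<in> words N (m + n)"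
  by (auto simp: words_def)

lemma words_mset_cong: "mset xs = mset ys \<Longrightarrow> xs \<in> words N n \<longleftrightarrow> ys \<in> words N n"
  using mset_eq_length[of xs ys] mset_eq_setD[of xs ys] by (simp add: words_def)

lemma permute_list_in_words:
  "\<sigma> permutes {..<n} \<Longrightarrow> xs \<in> words N n \<Longrightarrow> permute_list \<sigma> xs \<in> words N n"
  using words_mset_cong[OF mset_permute_list, of \<sigma> xs N n] by (simp add: length_words)

lemma permute_list_inv:
  assumes "\<sigma> permutes {..<n}" "length xs = n"
  shows "permute_list (inv \<sigma>) (permute_list \<sigma> xs) = xs"
proof -
  have "permute_list (\<sigma> \<circ> inv \<sigma>) xs = permute_list (inv \<sigma>) (permute_list \<sigma> xs)"
    using assms by (intro permute_list_compose) (auto intro: permutes_inv)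
  then show ?thesis
    using assms by (simp add: permutes_inv_o)
qed

lemma sym_proj_eq:
  assumes "length xs = n" "length ys = n"
  shows "sym_proj N n xs ys =
    of_nat (card {\<sigma>. \<sigma> permutes {..<n} \<and> permute_list \<sigma> ys = xs}) / of_nat (fact n)"
proof -
  have "(\<forall>i<n. xs ! i = ys ! \<sigma> i) \<longleftrightarrow> permute_list \<sigma> ys = xs" for \<sigma>
    using assms unfolding permute_list_def
    by (auto simp: list_eq_iff_nth_eq)
  then show ?thesis
    by (simp add: sym_proj_def)
qed

lemma sym_proj_commute:
  assumes "length xs = n" "length ys = n"
  shows "sym_proj N n xs ys = sym_proj N n ys xs"
proof -
  have "bij_betw inv {\<sigma>. \<sigma> permutes {..<n} \<and> permute_list \<sigma> ys = xs}
          {\<sigma>. \<sigma> permutes {..<n} \<and> permute_list \<sigma> xs = ys}"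
  proof (rule bij_betw_byWitness[where f' = inv])
    show "inv ` {\<sigma>. \<sigma> permutes {..<n} \<and> permute_list \<sigma> ys = xs}
        \<subseteq> {\<sigma>. \<sigma> permutes {..<n} \<and> permute_list \<sigma> xs = ys}"
      using assms permute_list_inv by (auto intro: permutes_inv)
    show "inv ` {\<sigma>. \<sigma> permutes {..<n} \<and> permute_list \<sigma> xs = ys}
        \<subseteq> {\<sigma>. \<sigma> permutes {..<n} \<and> permute_list \<sigma> ys = xs}"
      using assms permute_list_inv by (auto intro: permutes_inv)
  qed (auto simp: permutes_inv_inv)
  then show ?thesis
    using assms by (simp add: sym_proj_eq bij_betw_same_card)
qed

lemma cnj_sym_proj [simp]: "cnj (sym_proj N n xs ys) = sym_proj N n xs ys"
  by (simp add: sym_proj_def)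

lemma app_sym_proj:
  assumes xs: "xs \<in> words N n"
  shows "app_op N n (sym_proj N n) v xs =
    (\<Sum>\<sigma> | \<sigma> permutes {..<n}. v (permute_list \<sigma> xs)) / of_nat (fact n)"
proof -
  let ?S = "{\<sigma>. \<sigma> permutes {..<n}}"
  have fin: "finite ?S"
    by (simp add: finite_permutations)
  have "(\<Sum>ys\<in>words N n. of_nat (card {\<sigma>. \<sigma> permutes {..<n} \<and> permute_list \<sigma> xs = ys}) * v ys)
      = (\<Sum>ys\<in>words N n. \<Sum>\<sigma>\<in>?S. if permute_list \<sigma> xs = ys then v ys else 0)"
    by (intro sum.cong refl)
      (simp add: sum.If_cases[OF fin] Int_def Collect_conj_eq[symmetric])
  also have "\<dots> = (\<Sum>\<sigma>\<in>?S. \<Sum>ys\<in>words N n. if permute_list \<sigma> xs = ys then v ys else 0)"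
    by (rule sum.swap)
  also have "\<dots> = (\<Sum>\<sigma>\<in>?S. v (permute_list \<sigma> xs))"
    by (intro sum.cong refl) (simp add: permute_list_in_words[OF _ xs])
  finally have *: "(\<Sum>ys\<in>words N n. of_nat (card {\<sigma>. \<sigma> permutes {..<n} \<and> permute_list \<sigma> xs = ys}) * v ys)
      = (\<Sum>\<sigma>\<in>?S. v (permute_list \<sigma> xs))" .
  have "app_op N n (sym_proj N n) v xs =
     (\<Sum>ys\<in>words N n. of_nat (card {\<sigma>. \<sigma> permutes {..<n} \<and> permute_list \<sigma> xs = ys}) * v ys)
       / of_nat (fact n)"
    unfolding app_op_def sum_divide_distrib
  proof (intro sum.cong refl)
    fix ys assume "ys \<in> words N n"
    then have l: "length ys = n" "length xs = n"
      using xs by (auto simp: length_words)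
    show "sym_proj N n xs ys * v ys = of_nat (card {\<sigma>. \<sigma> permutes {..<n} \<and> permute_list \<sigma> xs = ys}) * v ys
      / of_nat (fact n)"
      unfolding sym_proj_commute[OF l(2,1)] sym_proj_eq[OF l] by simp
  qed
  then show ?thesis
    by (simp only: *)
qed

lemma app_sym_proj_mset:
  assumes xs: "xs \<in> words N n" and "mset ys = mset xs"
  shows "app_op N n (sym_proj N n) v ys = app_op N n (sym_proj N n) v xs"
proof -
  obtain \<tau> where \<tau>: "\<tau> permutes {..<n}" "permute_list \<tau> xs = ys"
    using mset_eq_permutation[OF assms(2)] length_words[OF xs] by auto
  have ys: "ys \<in> words N n"
    using assms words_mset_cong by blast
  have "(\<Sum>\<sigma> | \<sigma> permutes {..<n}. v (permute_list \<sigma> ys))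
      = (\<Sum>\<sigma> | \<sigma> permutes {..<n}. v (permute_list (\<tau> \<circ> \<sigma>) xs))"
    using \<tau> length_words[OF xs] by (intro sum.cong refl) (simp add: permute_list_compose)
  also have "\<dots> = (\<Sum>\<sigma> | \<sigma> permutes {..<n}. v (permute_list \<sigma> xs))"
    by (rule setum_permutations_compose_left[OF \<tau>(1), symmetric])
  finally show ?thesis
    using xs ys by (simp add: app_sym_proj)
qed

text \<open>The projector averages over rearrangements of the letters, so its fixed vectors are the
  functions of the multiset of letters. This is the working form of symmetry from here on:
  rearranging a word becomes an \<open>mset\<close> equality.\<close>

lemma sym_space_iff:
  "v \<in> sym_space N n \<longleftrightarrow> (\<forall>xs. xs \<notin> words N n \<longrightarrow> v xs = 0) \<and>
     (\<forall>xs ys. mset xs = mset ys \<longrightarrow> v xs = v ys)" (is "?L \<longleftrightarrow> ?R")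
proof
  assume L: ?L
  show ?R
  proof (intro conjI allI impI)
    show "v xs = 0" if "xs \<notin> words N n" for xs
      using L that by (simp add: sym_space_def)
    show "v xs = v ys" if "mset xs = mset ys" for xs ys
    proof (cases "ys \<in> words N n")
      case True
      moreover from this that have "xs \<in> words N n"
        using words_mset_cong by blast
      ultimately show ?thesis
        using L app_sym_proj_mset[OF True that, of v] by (simp add: sym_space_def)
    next
      case False
      then have "xs \<notin> words N n"
        using that words_mset_cong by blast
      with False show ?thesis
        using L by (simp add: sym_space_def)
    qed
  qed
next
  assume R: ?R
  have "app_op N n (sym_proj N n) v xs = v xs" if xs: "xs \<in> words N n" for xs
  proof -
    have "(\<Sum>\<sigma> | \<sigma> permutes {..<n}. v (permute_list \<sigma> xs)) = (\<Sum>\<sigma> | \<sigma> permutes {..<n}. v xs)"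
    proof (intro sum.cong refl)
      fix \<sigma> assume "\<sigma> \<in> {\<sigma>. \<sigma> permutes {..<n}}"
      then have "mset (permute_list \<sigma> xs) = mset xs"
        using length_words[OF xs] by (intro mset_permute_list) simp
      with R show "v (permute_list \<sigma> xs) = v xs"
        by blast
    qed
    then show ?thesis
      using xs by (simp add: app_sym_proj card_permutations[OF refl])
  qed
  with R show ?L
    unfolding sym_space_def by blast
qed

lemma sym_space_mset: "v \<in> sym_space N n \<Longrightarrow> mset xs = mset ys \<Longrightarrow> v xs = v ys"
  unfolding sym_space_iff by blast

lemma sym_space_zero: "v \<in> sym_space N n \<Longrightarrow> xs \<notin> words N n \<Longrightarrow> v xs = 0"
  unfolding sym_space_iff by blast

lemma app_sym_proj_id:
  "v \<in> sym_space N n \<Longrightarrow> xs \<in> words N n \<Longrightarrow> app_op N n (sym_proj N n) v xs = v xs"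
  by (simp add: sym_space_def)

section \<open>Orthonormal families in the symmetric space\<close>

definition sqnorm_w :: "nat \<Rightarrow> nat \<Rightarrow> vec \<Rightarrow> real" where
  "sqnorm_w N n v = (\<Sum>xs\<in>words N n. (cmod (v xs))\<^sup>2)"

lemma inner_w_self: "inner_w N n v v = of_real (sqnorm_w N n v)"
  unfolding inner_w_def sqnorm_w_def of_real_sum complex_norm_square by (simp add: mult.commute)

lemma sqnorm_w_nonneg [simp]: "sqnorm_w N n v \<ge> 0"
  by (simp add: sqnorm_w_def sum_nonneg)

lemma sqnorm_w_eq_0_iff: "sqnorm_w N n v = 0 \<longleftrightarrow> (\<forall>xs\<in>words N n. v xs = 0)"
  by (simp add: sqnorm_w_def sum_nonneg_eq_0_iff)

lemma sqnorm_w_scale: "sqnorm_w N n (\<lambda>xs. c * v xs) = (cmod c)\<^sup>2 * sqnorm_w N n v"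
  by (simp add: sqnorm_w_def norm_mult power_mult_distrib sum_distrib_left)

lemma cnj_inner_w: "cnj (inner_w N n a b) = inner_w N n b a"
  by (simp add: inner_w_def mult.commute)

lemma cmod_inner_w_commute: "cmod (inner_w N n a b) = cmod (inner_w N n b a)"
  by (metis cnj_inner_w complex_mod_cnj)

lemma inner_w_cong:
  "(\<And>xs. xs \<in> words N n \<Longrightarrow> a xs = a' xs) \<Longrightarrow> (\<And>xs. xs \<in> words N n \<Longrightarrow> b xs = b' xs) \<Longrightarrow>
    inner_w N n a b = inner_w N n a' b'"
  by (simp add: inner_w_def)

lemma inner_w_add_right:
  "inner_w N n a (\<lambda>xs. b xs + d xs) = inner_w N n a b + inner_w N n a d"
  by (simp add: inner_w_def algebra_simps sum.distrib)

lemma inner_w_diff_right: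
  "inner_w N n a (\<lambda>xs. b xs - d xs) = inner_w N n a b - inner_w N n a d"
  by (simp add: inner_w_def algebra_simps sum_subtractf)

lemma inner_w_scale_right: "inner_w N n a (\<lambda>xs. c * b xs) = c * inner_w N n a b"
  by (simp add: inner_w_def algebra_simps sum_distrib_left)

lemma inner_w_sum_right:
  "inner_w N n a (\<lambda>xs. \<Sum>i\<in>I. c i * b i xs) = (\<Sum>i\<in>I. c i * inner_w N n a (b i))"
  unfolding inner_w_def sum_distrib_left
  by (subst sum.swap) (simp add: mult.assoc mult.left_commute)

lemma inner_w_add_left:
  "inner_w N n (\<lambda>xs. b xs + d xs) a = inner_w N n b a + inner_w N n d a"
  by (simp add: inner_w_def algebra_simps sum.distrib)

lemma inner_w_diff_left:
  "inner_w N n (\<lambda>xs. b xs - d xs) a = inner_w N n b a - inner_w N n d a"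
  by (simp add: inner_w_def algebra_simps sum_subtractf)

lemma inner_w_scale_left: "inner_w N n (\<lambda>xs. c * b xs) a = cnj c * inner_w N n b a"
  by (simp add: inner_w_def algebra_simps sum_distrib_left)

lemma inner_w_sum_left:
  "inner_w N n (\<lambda>xs. \<Sum>i\<in>I. c i * b i xs) a = (\<Sum>i\<in>I. cnj (c i) * inner_w N n (b i) a)"
  unfolding inner_w_def cnj_sum sum_distrib_right sum_distrib_left
  by (subst sum.swap) (simp add: mult.assoc)

lemma inner_w_zero_left: "(\<And>xs. xs \<in> words N n \<Longrightarrow> a xs = 0) \<Longrightarrow> inner_w N n a b = 0"
  by (simp add: inner_w_def)

lemma inner_w_zero_right: "(\<And>xs. xs \<in> words N n \<Longrightarrow> b xs = 0) \<Longrightarrow> inner_w N n a b = 0"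
  by (simp add: inner_w_def)

lemma inner_w_indicator:
  "xs \<in> words N n \<Longrightarrow> inner_w N n v (\<lambda>ys. if ys = xs then 1 else 0) = cnj (v xs)"
  by (simp add: inner_w_def sum.delta if_distrib cong: if_cong)

lemma sym_space_add:
  "v \<in> sym_space N n \<Longrightarrow> w \<in> sym_space N n \<Longrightarrow> (\<lambda>xs. v xs + w xs) \<in> sym_space N n"
  unfolding sym_space_iff by (metis add_0_right)

lemma sym_space_diff:
  "v \<in> sym_space N n \<Longrightarrow> w \<in> sym_space N n \<Longrightarrow> (\<lambda>xs. v xs - w xs) \<in> sym_space N n"
  unfolding sym_space_iff by (metis diff_0_right)

lemma sym_space_scale: "v \<in> sym_space N n \<Longrightarrow> (\<lambda>xs. c * v xs) \<in> sym_space N n"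
  unfolding sym_space_iff by (metis mult_zero_right)

lemma sym_space_sum:
  assumes "\<And>i. i \<in> I \<Longrightarrow> v i \<in> sym_space N n"
  shows "(\<lambda>xs. \<Sum>i\<in>I. c i * v i xs) \<in> sym_space N n"
  unfolding sym_space_iff
proof (intro conjI allI impI)
  show "(\<Sum>i\<in>I. c i * v i xs) = 0" if "xs \<notin> words N n" for xs
    using sym_space_zero[OF assms that] by (intro sum.neutral) simp
  show "(\<Sum>i\<in>I. c i * v i xs) = (\<Sum>i\<in>I. c i * v i ys)" if "mset xs = mset ys" for xs ys
    using sym_space_mset[OF assms that] by (intro sum.cong) auto
qed

lemma sym_space_eqI:
  assumes v: "v \<in> sym_space N n" and w: "w \<in> sym_space N n"
    and eq: "\<And>x. x \<in> sym_space N n \<Longrightarrow> inner_w N n x v = inner_w N n x w"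
  shows "v = w"
proof -
  let ?d = "\<lambda>xs. v xs - w xs"
  have d: "?d \<in> sym_space N n"
    by (rule sym_space_diff[OF v w])
  then have "inner_w N n ?d ?d = 0"
    using eq[OF d] by (simp add: inner_w_diff_right)
  then have "\<forall>xs\<in>words N n. ?d xs = 0"
    by (simp add: inner_w_self sqnorm_w_eq_0_iff)
  then show ?thesis
    using sym_space_zero[OF d] by (metis eq_iff_diff_eq_0 ext)
qed

text \<open>Indexing by an initial segment of the naturals makes truncation a mere change of m; the
  partial sums in majorization rely on this.\<close>

definition onf :: "nat \<Rightarrow> nat \<Rightarrow> nat \<Rightarrow> (nat \<Rightarrow> vec) \<Rightarrow> bool" where
  "onf N n m v \<longleftrightarrow> (\<forall>i<m. v i \<in> sym_space N n) \<and>
     (\<forall>i<m. \<forall>j<m. inner_w N n (v i) (v j) = (if i = j then 1 else 0))"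

definition onb :: "nat \<Rightarrow> nat \<Rightarrow> nat \<Rightarrow> (nat \<Rightarrow> vec) \<Rightarrow> bool" where
  "onb N n m v \<longleftrightarrow> onf N n m v \<and>
     (\<forall>x\<in>sym_space N n. \<forall>xs. x xs = (\<Sum>j<m. inner_w N n (v j) x * v j xs))"

lemma onf_sym: "onf N n m v \<Longrightarrow> i < m \<Longrightarrow> v i \<in> sym_space N n"
  by (simp add: onf_def)

lemma onf_inner:
  "onf N n m v \<Longrightarrow> i < m \<Longrightarrow> j < m \<Longrightarrow> inner_w N n (v i) (v j) = (if i = j then 1 else 0)"
  by (simp add: onf_def)

lemma onf_sqnorm: "onf N n m v \<Longrightarrow> i < m \<Longrightarrow> sqnorm_w N n (v i) = 1"
  using onf_inner[of N n m v i i] by (simp add: inner_w_self)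

lemma onf_mono: "onf N n m v \<Longrightarrow> m' \<le> m \<Longrightarrow> onf N n m' v"
  by (simp add: onf_def)

lemma onb_onf: "onb N n m v \<Longrightarrow> onf N n m v"
  by (simp add: onb_def)

lemma onb_expand:
  "onb N n m v \<Longrightarrow> x \<in> sym_space N n \<Longrightarrow> x xs = (\<Sum>j<m. inner_w N n (v j) x * v j xs)"
  by (simp add: onb_def)

definition resid :: "nat \<Rightarrow> nat \<Rightarrow> nat \<Rightarrow> (nat \<Rightarrow> vec) \<Rightarrow> vec \<Rightarrow> vec" where
  "resid N n m v x = (\<lambda>xs. x xs - (\<Sum>j<m. inner_w N n (v j) x * v j xs))"

lemma resid_sym: "onf N n m v \<Longrightarrow> x \<in> sym_space N n \<Longrightarrow> resid N n m v x \<in> sym_space N n"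
  unfolding resid_def by (intro sym_space_diff sym_space_sum) (auto simp: onf_sym)

lemma inner_resid:
  assumes "onf N n m v" "i < m"
  shows "inner_w N n (v i) (resid N n m v x) = 0"
proof -
  have "(\<Sum>j<m. inner_w N n (v j) x * inner_w N n (v i) (v j))
      = (\<Sum>j<m. if i = j then inner_w N n (v i) x else 0)"
    using assms by (intro sum.cong refl) (simp add: onf_inner)
  then show ?thesis
    using assms(2) by (simp add: resid_def inner_w_diff_right inner_w_sum_right)
qed

lemma inner_resid_self:
  assumes "onf N n m v"
  shows "inner_w N n x (resid N n m v x) = of_real (sqnorm_w N n (resid N n m v x))"
proof -
  let ?r = "resid N n m v x"
  have z: "inner_w N n (v j) ?r = 0" if "j < m" for j
    using inner_resid[OF assms that] .
  have "inner_w N n ?r ?r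
      = inner_w N n x ?r - (\<Sum>j<m. cnj (inner_w N n (v j) x) * inner_w N n (v j) ?r)"
    by (subst (1) resid_def) (simp only: inner_w_diff_left inner_w_sum_left)
  also have "(\<Sum>j<m. cnj (inner_w N n (v j) x) * inner_w N n (v j) ?r) = 0"
    by (rule sum.neutral) (simp add: z)
  finally show ?thesis
    by (simp add: inner_w_self)
qed

lemma sqnorm_resid:
  assumes "onf N n m v"
  shows "sqnorm_w N n (resid N n m v x) = sqnorm_w N n x - (\<Sum>j<m. (cmod (inner_w N n (v j) x))\<^sup>2)"
proof -
  have "of_real (sqnorm_w N n (resid N n m v x)) = inner_w N n x (resid N n m v x)"
    by (simp add: inner_resid_self[OF assms])
  also have "\<dots> = inner_w N n x x - (\<Sum>j<m. inner_w N n (v j) x * inner_w N n x (v j))"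
    by (simp add: resid_def inner_w_diff_right inner_w_sum_right)
  also have "(\<Sum>j<m. inner_w N n (v j) x * inner_w N n x (v j))
      = (\<Sum>j<m. of_real ((cmod (inner_w N n (v j) x))\<^sup>2))"
    by (intro sum.cong refl) (simp only: complex_norm_square cnj_inner_w)
  finally have "complex_of_real (sqnorm_w N n (resid N n m v x))
      = of_real (sqnorm_w N n x - (\<Sum>j<m. (cmod (inner_w N n (v j) x))\<^sup>2))"
    by (simp add: inner_w_self)
  then show ?thesis
    using of_real_eq_iff by blast
qed

lemma bessel: "onf N n m v \<Longrightarrow> (\<Sum>j<m. (cmod (inner_w N n (v j) x))\<^sup>2) \<le> sqnorm_w N n x"
  using sqnorm_resid[of N n m v x] sqnorm_w_nonneg[of N n "resid N n m v x"] by linarith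

lemma parseval_expand:
  assumes "onf N n m v" and "\<And>xs. xs \<in> words N n \<Longrightarrow> x xs = (\<Sum>j<m. inner_w N n (v j) x * v j xs)"
  shows "(\<Sum>j<m. (cmod (inner_w N n (v j) x))\<^sup>2) = sqnorm_w N n x"
proof -
  have "\<forall>xs\<in>words N n. resid N n m v x xs = 0"
    using assms(2) by (simp add: resid_def)
  then have "sqnorm_w N n (resid N n m v x) = 0"
    by (simp add: sqnorm_w_eq_0_iff)
  then show ?thesis
    using sqnorm_resid[OF assms(1), of x] by linarith
qed

lemma parseval:
  "onb N n m v \<Longrightarrow> x \<in> sym_space N n \<Longrightarrow> (\<Sum>j<m. (cmod (inner_w N n (v j) x))\<^sup>2) = sqnorm_w N n x"
  by (intro parseval_expand onb_onf onb_expand)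

text \<open>Double counting of the squared entries: by Bessel against the indicator of a word, each
  word carries at most 1. The bound makes the extension procedure below terminate.\<close>

lemma onf_card_words:
  assumes "onf N n m v"
  shows "m \<le> card (words N n)"
proof -
  have "real m = (\<Sum>j<m. sqnorm_w N n (v j))"
    using assms by (simp add: onf_sqnorm)
  also have "\<dots> = (\<Sum>xs\<in>words N n. \<Sum>j<m. (cmod (v j xs))\<^sup>2)"
    unfolding sqnorm_w_def by (rule sum.swap)
  also have "\<dots> \<le> (\<Sum>xs\<in>words N n. 1)"
  proof (rule sum_mono)
    fix xs assume xs: "xs \<in> words N n"
    let ?e = "\<lambda>ys. if ys = xs then 1 else (0::complex)"
    have "(\<Sum>j<m. (cmod (v j xs))\<^sup>2) = (\<Sum>j<m. (cmod (inner_w N n (v j) ?e))\<^sup>2)"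
      by (simp add: inner_w_indicator[OF xs])
    also have "\<dots> \<le> sqnorm_w N n ?e"
      by (rule bessel[OF assms])
    also have "\<dots> = 1"
      using xs by (simp add: sqnorm_w_def if_distrib[of cmod] if_distrib[of "\<lambda>x. x\<^sup>2"] sum.delta cong: if_cong)
    finally show "(\<Sum>j<m. (cmod (v j xs))\<^sup>2) \<le> 1" .
  qed
  finally show ?thesis
    by simp
qed

section \<open>Gram-Schmidt, completion to a basis, and dimension\<close>

lemma onf_Suc:
  assumes v: "onf N n m v" and y: "y \<in> sym_space N n" "sqnorm_w N n y = 1"
    and orth: "\<And>i. i < m \<Longrightarrow> inner_w N n (v i) y = 0"
  shows "onf N n (Suc m) (v(m := y))"
proof -
  have orth': "inner_w N n y (v i) = 0" if "i < m" for i
    using orth[OF that] cnj_inner_w[of N n "v i" y] by simp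
  show ?thesis
    using v y orth orth' by (auto simp: onf_def less_Suc_eq inner_w_self)
qed

lemma sqnorm_w_normalize:
  assumes "sqnorm_w N n x \<noteq> 0"
  shows "sqnorm_w N n (\<lambda>xs. of_real (1 / sqrt (sqnorm_w N n x)) * x xs) = 1"
proof -
  have "(cmod (of_real (1 / sqrt (sqnorm_w N n x))))\<^sup>2 = 1 / sqnorm_w N n x"
    by (simp add: power_divide norm_divide)
  then show ?thesis
    using assms by (simp only: sqnorm_w_scale) simp
qed

text \<open>Linear independence is not assumed: a vector with vanishing residual is skipped, so m
  can drop below p. It is applied to contracted vectors, where such dependence is typical.\<close>

lemma gram_schmidt:
  assumes "\<And>j. j < p \<Longrightarrow> x j \<in> sym_space N n"
  shows "\<exists>m\<le>p. \<exists>w. onf N n m w \<and>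
    (\<forall>j<p. \<forall>xs. x j xs = (\<Sum>i<m. inner_w N n (w i) (x j) * w i xs))"
  using assms
proof (induction p)
  case 0
  then show ?case
    by (auto simp: onf_def)
next
  case (Suc p)
  then obtain m w where m: "m \<le> p" and w: "onf N n m w"
    and ex: "\<And>j xs. j < p \<Longrightarrow> x j xs = (\<Sum>i<m. inner_w N n (w i) (x j) * w i xs)"
    by (metis less_Suc_eq)
  have xp: "x p \<in> sym_space N n"
    using Suc.prems by simp
  let ?r = "resid N n m w (x p)"
  have r: "?r \<in> sym_space N n"
    by (rule resid_sym[OF w xp])
  show ?case
  proof (cases "sqnorm_w N n ?r = 0")
    case True
    then have "?r xs = 0" for xs
      using sym_space_zero[OF r] by (cases "xs \<in> words N n") (auto simp: sqnorm_w_eq_0_iff)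
    then have "x p xs = (\<Sum>i<m. inner_w N n (w i) (x p) * w i xs)" for xs
      by (simp add: resid_def)
    then show ?thesis
      using m w ex by (intro exI[of _ m] conjI exI[of _ w]) (auto simp: less_Suc_eq)
  next
    case False
    let ?s = "complex_of_real (sqrt (sqnorm_w N n ?r))"
    let ?y = "\<lambda>xs. of_real (1 / sqrt (sqnorm_w N n ?r)) * ?r xs"
    let ?w = "w(m := ?y)"
    have w': "onf N n (Suc m) ?w"
      using w sym_space_scale[OF r] sqnorm_w_normalize[OF False]
      by (intro onf_Suc) (auto simp only: inner_w_scale_right inner_resid[OF w] mult_zero_right)
    have orth: "inner_w N n ?r (w i) = 0" if "i < m" for i
      using inner_resid[OF w that, of "x p"] cnj_inner_w[of N n "w i" ?r] by simp
    have "x j xs = (\<Sum>i<Suc m. inner_w N n (?w i) (x j) * ?w i xs)" if "j < p" for j xs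
    proof -
      have "x j = (\<lambda>xs. \<Sum>i<m. inner_w N n (w i) (x j) * w i xs)"
        using ex[OF that] by blast
      then have "inner_w N n ?r (x j) = inner_w N n ?r (\<lambda>xs. \<Sum>i<m. inner_w N n (w i) (x j) * w i xs)"
        by simp
      also have "\<dots> = 0"
        by (simp add: inner_w_sum_right orth)
      finally have "inner_w N n ?y (x j) = 0"
        by (simp only: inner_w_scale_left mult_zero_right)
      then show ?thesis
        using ex[OF that, of xs] by simp
    qed
    moreover have "x p xs = (\<Sum>i<Suc m. inner_w N n (?w i) (x p) * ?w i xs)" for xs
    proof -
      have "inner_w N n ?r (x p) = ?s * ?s"
        using inner_resid_self[OF w, of "x p"] cnj_inner_w[of N n "x p" ?r]
        by (simp flip: of_real_mult)
      moreover have "?s \<noteq> 0"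
        using False by simp
      ultimately have "inner_w N n ?y (x p) * ?y xs = ?r xs"
        by (simp only: inner_w_scale_left) (simp add: field_simps)
      then show ?thesis
        by (simp add: resid_def)
    qed
    ultimately have "\<forall>j<Suc p. \<forall>xs. x j xs = (\<Sum>i<Suc m. inner_w N n (?w i) (x j) * ?w i xs)"
      by (auto simp only: less_Suc_eq)
    moreover have "Suc m \<le> Suc p"
      using m by simp
    ultimately show ?thesis
      using w' by blast
  qed
qed

lemma onf_maximal_onb:
  assumes v: "onf N n m v"
    and max: "\<And>x. x \<in> sym_space N n \<Longrightarrow> (\<And>i. i < m \<Longrightarrow> inner_w N n (v i) x = 0) \<Longrightarrow> sqnorm_w N n x = 0"
  shows "onb N n m v"
  unfolding onb_def
proof (intro conjI v ballI allI)
  fix x xs assume x: "x \<in> sym_space N n"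
  have r: "resid N n m v x \<in> sym_space N n"
    by (rule resid_sym[OF v x])
  then have "sqnorm_w N n (resid N n m v x) = 0"
    by (rule max) (rule inner_resid[OF v])
  then have "resid N n m v x xs = 0"
    using sym_space_zero[OF r] by (cases "xs \<in> words N n") (auto simp: sqnorm_w_eq_0_iff)
  then show "x xs = (\<Sum>j<m. inner_w N n (v j) x * v j xs)"
    by (simp add: resid_def)
qed

text \<open>Vectors are adjoined one at a time under an invariant Q; the number of words bounds the
  length. A trivial Q gives completion of orthonormal families, and Q = "is an eigenvector" gives
  the spectral theorem.\<close>

lemma extend_to_onb:
  assumes v: "onf N n m v" and Qv: "\<And>i. i < m \<Longrightarrow> Q (v i)"
    and step: "\<And>m v x. onf N n m v \<Longrightarrow> (\<And>i. i < m \<Longrightarrow> Q (v i)) \<Longrightarrow> x \<in> sym_space N n \<Longrightarrow>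
      (\<And>i. i < m \<Longrightarrow> inner_w N n (v i) x = 0) \<Longrightarrow> sqnorm_w N n x \<noteq> 0 \<Longrightarrow>
      \<exists>y. y \<in> sym_space N n \<and> sqnorm_w N n y = 1 \<and> (\<forall>i<m. inner_w N n (v i) y = 0) \<and> Q y"
  shows "\<exists>m' v'. m \<le> m' \<and> onb N n m' v' \<and> (\<forall>i<m. v' i = v i) \<and> (\<forall>i<m'. Q (v' i))"
  using v Qv
proof (induction "card (words N n) - m" arbitrary: m v rule: less_induct)
  case less
  show ?case
  proof (cases "onb N n m v")
    case True
    with less.prems show ?thesis
      by blast
  next
    case False
    then obtain x where "x \<in> sym_space N n" "\<And>i. i < m \<Longrightarrow> inner_w N n (v i) x = 0"
      "sqnorm_w N n x \<noteq> 0"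
      using onf_maximal_onb[OF less.prems(1)] by blast
    then obtain y where y: "y \<in> sym_space N n" "sqnorm_w N n y = 1"
      "\<And>i. i < m \<Longrightarrow> inner_w N n (v i) y = 0" "Q y"
      using step[OF less.prems] by blast
    let ?v = "v(m := y)"
    have S: "onf N n (Suc m) ?v"
      by (rule onf_Suc[OF less.prems(1) y(1-3)])
    then have "card (words N n) - Suc m < card (words N n) - m"
      using onf_card_words by fastforce
    moreover have "\<And>i. i < Suc m \<Longrightarrow> Q (?v i)"
      using less.prems(2) y(4) by (auto simp: less_Suc_eq)
    ultimately obtain m' v' where "Suc m \<le> m'" "onb N n m' v'" "\<forall>i<Suc m. v' i = ?v i" "\<forall>i<m'. Q (v' i)"
      using less.hyps[OF _ S] by blast
    then show ?thesis
      by (metis Suc_leD fun_upd_other less_Suc_eq nat_neq_iff)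
  qed
qed

lemma onf_extend:
  assumes "onf N n m v"
  shows "\<exists>m' v'. m \<le> m' \<and> onb N n m' v' \<and> (\<forall>i<m. v' i = v i)"
proof -
  have "\<exists>m' v'. m \<le> m' \<and> onb N n m' v' \<and> (\<forall>i<m. v' i = v i) \<and> (\<forall>i<m'. True)"
  proof (rule extend_to_onb[OF assms])
    fix m v x
    assume "onf N n m v" and x: "x \<in> sym_space N n" "sqnorm_w N n x \<noteq> 0"
      "\<And>i. i < m \<Longrightarrow> inner_w N n (v i) x = 0"
    then show "\<exists>y. y \<in> sym_space N n \<and> sqnorm_w N n y = 1 \<and> (\<forall>i<m. inner_w N n (v i) y = 0) \<and> True"
      by (intro exI[of _ "\<lambda>xs. of_real (1 / sqrt (sqnorm_w N n x)) * x xs"] conjI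
          sym_space_scale sqnorm_w_normalize) (auto simp only: inner_w_scale_right mult_zero_right)
  qed auto
  then show ?thesis
    by blast
qed

lemma onb_exists: "\<exists>m v. onb N n m v"
  using onf_extend[of N n 0] by (auto simp: onf_def)

text \<open>Sum the squared overlaps of the two families: Parseval in the basis gives p, Bessel for
  the family gives at most m. Applied both ways, all bases have the same size, so
  \<open>symdim\<close> is well defined.\<close>

lemma onf_le_onb:
  assumes "onf N n p x" "onb N n m v"
  shows "p \<le> m"
proof -
  have "real p = (\<Sum>i<p. sqnorm_w N n (x i))"
    using assms by (simp add: onf_sqnorm)
  also have "\<dots> = (\<Sum>i<p. \<Sum>j<m. (cmod (inner_w N n (v j) (x i)))\<^sup>2)"
    using assms by (intro sum.cong refl) (simp add: parseval onf_sym)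
  also have "\<dots> = (\<Sum>j<m. \<Sum>i<p. (cmod (inner_w N n (x i) (v j)))\<^sup>2)"
    by (subst sum.swap) (simp add: cmod_inner_w_commute)
  also have "\<dots> \<le> (\<Sum>j<m. sqnorm_w N n (v j))"
    by (intro sum_mono bessel assms)
  also have "\<dots> = real m"
    using onb_onf[OF assms(2)] by (simp add: onf_sqnorm)
  finally show ?thesis
    by simp
qed

definition symdim :: "nat \<Rightarrow> nat \<Rightarrow> nat" where
  "symdim N n = (THE m. \<exists>v. onb N n m v)"

lemma onb_symdim: "onb N n m v \<Longrightarrow> m = symdim N n"
  unfolding symdim_def by (rule the_equality[symmetric]) (auto intro: onf_le_onb onb_onf antisym)

lemma onf_le_symdim: "onf N n p x \<Longrightarrow> p \<le> symdim N n"
  using onb_exists[of N n] onf_le_onb onb_symdim by metis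

section \<open>Spectral theorem and trace functions\<close>

lemma app_op_lin:
  "app_op N n K (\<lambda>xs. b xs + c * d xs) = (\<lambda>xs. app_op N n K b xs + c * app_op N n K d xs)"
  by (simp add: app_op_def sum.distrib sum_distrib_left algebra_simps)

lemma app_op_scale: "app_op N n K (\<lambda>xs. c * d xs) = (\<lambda>xs. c * app_op N n K d xs)"
  by (simp add: app_op_def sum_distrib_left algebra_simps)

text \<open>Tested on symmetric vectors only, because the kernel need not map the symmetric space
  into itself.\<close>

definition sym_hermitian :: "nat \<Rightarrow> nat \<Rightarrow> op \<Rightarrow> bool" where
  "sym_hermitian N n K \<longleftrightarrow> (\<forall>v\<in>sym_space N n. \<forall>w\<in>sym_space N n.
     inner_w N n w (app_op N n K v) = cnj (inner_w N n v (app_op N n K w)))"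

text \<open>For symmetric v this is the eigenvalue equation of the compression of K to the symmetric
  space. \<open>trace_fun_eq\<close> turns it into a pointwise equation when K preserves the
  space.\<close>

definition weak_eigen :: "nat \<Rightarrow> nat \<Rightarrow> op \<Rightarrow> vec \<Rightarrow> real \<Rightarrow> bool" where
  "weak_eigen N n K v l \<longleftrightarrow>
     (\<forall>w\<in>sym_space N n. inner_w N n w (app_op N n K v) = of_real l * inner_w N n w v)"

text \<open>In the product topology on functions of all lists, the unit sphere sits in a product of
  discs (on words) and of single points (elsewhere), compact by Tychonoff, and it is cut out there
  by closed conditions.\<close>

lemma compact_sphere:
  "compact {y \<in> sym_space N n. (\<forall>i<m. inner_w N n (v i) y = 0) \<and> sqnorm_w N n y = 1}"
proof -
  let ?B = "Pi\<^sub>E UNIV (\<lambda>xs. if xs \<in> words N n then cball (0::complex) 1 else {0})"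
  let ?C = "{y. (\<forall>xs. xs \<notin> words N n \<longrightarrow> y xs = (0::complex)) \<and>
    (\<forall>xs ys. mset xs = mset ys \<longrightarrow> y xs = y ys) \<and>
    (\<forall>i. i < m \<longrightarrow> inner_w N n (v i) y = 0) \<and> sqnorm_w N n y = 1}"
  have "compact ?B"
    using compactin_PiE[of "\<lambda>i::nat list. euclidean::complex topology" UNIV
        "\<lambda>xs. if xs \<in> words N n then cball 0 1 else {0}"]
    by (simp add: euclidean_product_topology)
  moreover have "closed ?C"
    unfolding inner_w_def sqnorm_w_def
    by (intro closed_Collect_conj closed_Collect_all closed_Collect_imp closed_Collect_eq
        open_Collect_const continuous_intros continuous_on_product_coordinates)
  ultimately have "compact (?B \<inter> ?C)"
    by (rule compact_Int_closed)
  moreover have "{y \<in> sym_space N n. (\<forall>i<m. inner_w N n (v i) y = 0) \<and> sqnorm_w N n y = 1} = ?B \<inter> ?C"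
  proof -
    have "y xs \<in> (if xs \<in> words N n then cball 0 1 else {0})"
      if "\<forall>xs. xs \<notin> words N n \<longrightarrow> y xs = 0" "sqnorm_w N n y = 1" for y :: vec and xs
    proof (cases "xs \<in> words N n")
      case True
      then have "(cmod (y xs))\<^sup>2 \<le> sqnorm_w N n y"
        unfolding sqnorm_w_def by (intro member_le_sum) auto
      then have "cmod (y xs) \<le> 1"
        using that(2) abs_le_square_iff[of "cmod (y xs)" 1] by simp
      with True show ?thesis
        by (simp add: dist_norm)
    qed (use that in auto)
    then show ?thesis
      unfolding sym_space_iff PiE_UNIV_domain Pi_iff by (intro set_eqI) blast
  qed
  ultimately show ?thesis
    by simp
qed

text \<open>A maximiser \<open>y\<close> of the Rayleigh quotient makes \<open>\<lambda> - K\<close> a positive form on the orthogonal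
  complement which vanishes at \<open>y\<close>, so \<open>y\<close> lies in its kernel.\<close>
lemma rayleigh_weak_eigen:
  assumes K: "sym_hermitian N n K" and v: "onf N n m v"
    and ev: "\<And>i. i < m \<Longrightarrow> \<exists>l. weak_eigen N n K (v i) l"
    and x: "x \<in> sym_space N n" "\<And>i. i < m \<Longrightarrow> inner_w N n (v i) x = 0" "sqnorm_w N n x \<noteq> 0"
  shows "\<exists>y. y \<in> sym_space N n \<and> sqnorm_w N n y = 1 \<and> (\<forall>i<m. inner_w N n (v i) y = 0) \<and>
    (\<exists>l. weak_eigen N n K y l)"
proof -
  let ?W = "{y \<in> sym_space N n. \<forall>i<m. inner_w N n (v i) y = 0}"
  let ?S = "{y \<in> sym_space N n. (\<forall>i<m. inner_w N n (v i) y = 0) \<and> sqnorm_w N n y = 1}"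
  let ?k = "\<lambda>a b. inner_w N n a (app_op N n K b)"
  have W_scale: "(\<lambda>xs. c * y xs) \<in> ?W" if "y \<in> ?W" for y c
    using that sym_space_scale[of y N n c] by (auto simp only: inner_w_scale_right mem_Collect_eq mult_zero_right)
  have W_lin: "(\<lambda>xs. y xs + c * w xs) \<in> ?W" if "y \<in> ?W" "w \<in> ?W" for y w c
    using that W_scale[of w c] sym_space_add[of y N n "\<lambda>xs. c * w xs"]
    by (auto simp only: inner_w_scale_right inner_w_add_right mem_Collect_eq mult_zero_right add_0_right)
  have "(\<lambda>xs. of_real (1 / sqrt (sqnorm_w N n x)) * x xs) \<in> ?S"
    using W_scale[of x "of_real (1 / sqrt (sqnorm_w N n x))"] x sqnorm_w_normalize[OF x(3)] by blast
  then have ne: "?S \<noteq> {}"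
    by blast
  have cont: "continuous_on ?S (\<lambda>y. Re (?k y y))"
    unfolding inner_w_def app_op_def
    by (intro continuous_intros continuous_on_subset[OF continuous_on_product_coordinates subset_UNIV])
  obtain y where y: "y \<in> ?S" and "\<forall>z\<in>?S. Re (?k z z) \<le> Re (?k y y)"
    using continuous_attains_sup[OF compact_sphere ne cont] by (elim bexE)
  then have max: "Re (?k z z) \<le> Re (?k y y)" if "z \<in> ?S" for z
    using that by (elim bspec)
  define l where "l = Re (?k y y)"
  have le: "Re (?k w w) \<le> l * sqnorm_w N n w" if w: "w \<in> ?W" for w
  proof (cases "sqnorm_w N n w = 0")
    case True
    then have "?k w w = 0"
      by (intro inner_w_zero_left) (simp add: sqnorm_w_eq_0_iff)
    with True show ?thesis
      by simp
  next
    case False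
    let ?c = "1 / sqrt (sqnorm_w N n w)"
    have "(\<lambda>xs. of_real ?c * w xs) \<in> ?S"
      using W_scale[OF w] sqnorm_w_normalize[OF False] by blast
    from max[OF this] have "Re (?k (\<lambda>xs. of_real ?c * w xs) (\<lambda>xs. of_real ?c * w xs)) \<le> l"
      by (simp add: l_def)
    moreover have "?k (\<lambda>xs. of_real ?c * w xs) (\<lambda>xs. of_real ?c * w xs) = of_real (?c * ?c) * ?k w w"
      by (simp only: app_op_scale inner_w_scale_left inner_w_scale_right complex_cnj_complex_of_real
          of_real_mult mult.assoc)
    ultimately have "?c * ?c * Re (?k w w) \<le> l"
      by (simp only: Re_complex_of_real Im_complex_of_real times_complex.sel mult_zero_left diff_0_right)
    moreover have "?c * ?c = 1 / sqnorm_w N n w"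
      by simp
    ultimately show ?thesis
      using False sqnorm_w_nonneg[of N n w] by (simp add: field_simps)
  qed
  let ?q = "\<lambda>a b. of_real l * inner_w N n a b - ?k a b"
  have W: "?q w y = 0" if w: "w \<in> ?W" for w
  proof (rule ccontr)
    assume nz: "?q w y \<noteq> 0"
    define z where "z = ?q w y"
    define Q where "Q = l * sqnorm_w N n w - Re (?k w w)"
    have Q: "Q \<ge> 0"
      using le[OF w] by (simp add: Q_def)
    \<comment> \<open>Moving y by -s z w changes the form l - K by -2s|z|^2 + s^2|z|^2 Q, which is
      negative as soon as s Q < 2. The summand 1 keeps s finite when Q = 0.\<close>
    define s where "s = 1 / (Q + 1)"
    have s: "s > 0" "s * Q < 1"
      using Q by (simp_all add: s_def)
    let ?c = "- (of_real s * z)"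
    let ?a = "\<lambda>xs. y xs + ?c * w xs"
    have yH: "y \<in> sym_space N n" and wH: "w \<in> sym_space N n" and yW: "y \<in> ?W"
      using y w by auto
    have qyw: "?q y w = cnj z"
      using K yH wH by (simp add: z_def sym_hermitian_def cnj_inner_w)
    have qyy: "Re (?q y y) = 0"
      using y by (simp add: l_def inner_w_self)
    have "?q ?a ?a = ?q y y + ?c * ?q y w + cnj ?c * ?q w y + ?c * cnj ?c * ?q w w"
      by (simp only: app_op_lin inner_w_add_left inner_w_add_right inner_w_scale_left
          inner_w_scale_right) (simp add: algebra_simps)
    also have "\<dots> = ?q y y - of_real (2 * s) * (z * cnj z) + of_real (s\<^sup>2) * (z * cnj z) * ?q w w"
      unfolding qyw z_def[symmetric] by (simp add: algebra_simps power2_eq_square)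
    finally have "Re (?q ?a ?a) = - 2 * s * (cmod z)\<^sup>2 + s\<^sup>2 * (cmod z)\<^sup>2 * Q"
      using qyy unfolding complex_norm_square[symmetric] of_real_mult[symmetric]
      by (simp add: Q_def inner_w_self)
    moreover have "Re (?q ?a ?a) \<ge> 0"
      using le[OF W_lin[OF yW w], of ?c] by (simp add: inner_w_self)
    ultimately have "s * (cmod z)\<^sup>2 * (s * Q - 2) \<ge> 0"
      by (simp add: algebra_simps power2_eq_square)
    moreover have "s * (cmod z)\<^sup>2 > 0"
      using nz s by (simp add: z_def)
    ultimately show False
      using s by (simp add: zero_le_mult_iff)
  qed
  \<comment> \<open>So far only w orthogonal to the earlier eigenvectors is covered. The remaining
    component of w lies in their span and pairs to zero with both y and K y.\<close>
  have "?k w y = of_real l * inner_w N n w y" if w: "w \<in> sym_space N n" for w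
  proof -
    let ?r = "resid N n m v w"
    let ?p = "\<lambda>xs. \<Sum>j<m. inner_w N n (v j) w * v j xs"
    have r: "?r \<in> ?W"
      using resid_sym[OF v w] inner_resid[OF v] by blast
    have yH: "y \<in> sym_space N n"
      using y by simp
    have kv: "?k (v j) y = 0" "inner_w N n (v j) y = 0" if j: "j < m" for j
    proof -
      obtain lj where "weak_eigen N n K (v j) lj"
        using ev[OF j] by blast
      then have "?k y (v j) = of_real lj * inner_w N n y (v j)"
        using yH by (simp add: weak_eigen_def)
      also have "inner_w N n y (v j) = cnj (inner_w N n (v j) y)"
        by (simp add: cnj_inner_w)
      also have "inner_w N n (v j) y = 0"
        using y j by simp
      finally have "?k y (v j) = 0"
        by simp
      then show "?k (v j) y = 0"
        using K yH onf_sym[OF v j] unfolding sym_hermitian_def by (metis complex_cnj_zero)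
      show "inner_w N n (v j) y = 0"
        using y j by simp
    qed
    have dec: "inner_w N n w b = inner_w N n ?p b + inner_w N n ?r b" for b
      unfolding inner_w_add_left[symmetric] by (simp add: resid_def)
    have p0: "inner_w N n ?p (app_op N n K y) = 0" "inner_w N n ?p y = 0"
      by (simp_all add: inner_w_sum_left kv)
    show ?thesis
      using W[OF r] by (simp add: dec p0)
  qed
  then have "weak_eigen N n K y l"
    by (simp add: weak_eigen_def)
  with y show ?thesis
    by blast
qed

lemma spectral_onb:
  assumes "sym_hermitian N n K"
  shows "\<exists>m v a. onb N n m v \<and> (\<forall>j<m. weak_eigen N n K (v j) (a j))"
proof -
  have "\<exists>m' v'. 0 \<le> m' \<and> onb N n m' v' \<and> (\<forall>i<0. v' i = (\<lambda>_. 0)) \<and> (\<forall>i<m'. \<exists>l. weak_eigen N n K (v' i) l)"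
    by (rule extend_to_onb)
      (auto simp: onf_def[of N n 0] intro: rayleigh_weak_eigen[OF assms])
  then obtain m v where v: "onb N n m v" "\<forall>i<m. \<exists>l. weak_eigen N n K (v i) l"
    by blast
  from v(2) obtain a where "\<forall>i<m. weak_eigen N n K (v i) (a i)"
    by metis
  with v(1) show ?thesis
    by blast
qed

text \<open>\<open>trace_fun\<close> is a definite description, so a decomposition must exist and
  its value must be unique. For uniqueness, eigenvectors of two decompositions overlap only at equal
  eigenvalues, and by Parseval in both bases the squared overlaps form a doubly stochastic matrix,
  which transports one sum of f into the other.\<close>

lemma trace_fun_eq:
  assumes A: "sym_hermitian N n A"
    and inv: "\<And>v. v \<in> sym_space N n \<Longrightarrow>
      (\<lambda>xs. if xs \<in> words N n then app_op N n A v xs else 0) \<in> sym_space N n"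
    and v: "onb N n m v" and a: "\<And>j. j < m \<Longrightarrow> weak_eigen N n A (v j) (a j)"
  shows "trace_fun N n f A = (\<Sum>j<m. f (a j))"
  unfolding trace_fun_def
proof (rule the_equality)
  let ?vs = "map v [0..<m]" and ?ls = "map (\<lambda>j. complex_of_real (a j)) [0..<m]"
  have on: "onf N n m v"
    by (rule onb_onf[OF v])
  have "app_op N n A (v j) xs = of_real (a j) * v j xs" if j: "j < m" and xs: "xs \<in> words N n" for j xs
  proof -
    let ?y = "\<lambda>xs. if xs \<in> words N n then app_op N n A (v j) xs else 0"
    have "?y = (\<lambda>xs. of_real (a j) * v j xs)"
    proof (rule sym_space_eqI)
      show "?y \<in> sym_space N n" "(\<lambda>xs. of_real (a j) * v j xs) \<in> sym_space N n"
        using onf_sym[OF on j] by (auto intro: inv sym_space_scale)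
      fix x assume "x \<in> sym_space N n"
      then have "inner_w N n x (app_op N n A (v j)) = of_real (a j) * inner_w N n x (v j)"
        using a[OF j] by (simp add: weak_eigen_def)
      then show "inner_w N n x ?y = inner_w N n x (\<lambda>xs. of_real (a j) * v j xs)"
        by (simp add: inner_w_scale_right cong: inner_w_cong)
    qed
    from fun_cong[OF this, of xs] xs show ?thesis
      by simp
  qed
  then have "eig_decomp N n A ?vs ?ls"
    using v on unfolding eig_decomp_def onb_def onf_def by simp
  moreover have "(\<Sum>j<m. f (a j)) = (\<Sum>j<length ?ls. f (Re (?ls ! j)))"
    by simp
  ultimately show "\<exists>vs ls. eig_decomp N n A vs ls \<and> (\<Sum>j<m. f (a j)) = (\<Sum>j<length ls. f (Re (ls ! j)))"
    by blast
next
  fix s assume "\<exists>vs ls. eig_decomp N n A vs ls \<and> s = (\<Sum>j<length ls. f (Re (ls ! j)))"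
  then obtain vs ls where e: "eig_decomp N n A vs ls" and s: "s = (\<Sum>j<length ls. f (Re (ls ! j)))"
    by blast
  define p where "p = length ls"
  have len: "length vs = p"
    using e by (simp add: eig_decomp_def p_def)
  have w: "onb N n p (\<lambda>j. vs ! j)"
    using e unfolding eig_decomp_def onb_def onf_def len by blast
  have wv: "ls ! j = of_real (a i)" if "i < m" "j < p" "inner_w N n (v i) (vs ! j) \<noteq> 0" for i j
  proof -
    have sym: "v i \<in> sym_space N n" "vs ! j \<in> sym_space N n"
      using onf_sym[OF onb_onf[OF v]] onf_sym[OF onb_onf[OF w]] that by auto
    have "inner_w N n (v i) (app_op N n A (vs ! j)) = inner_w N n (v i) (\<lambda>xs. ls ! j * (vs ! j) xs)"
      using e len that by (intro inner_w_cong) (auto simp: eig_decomp_def)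
    then have "ls ! j * inner_w N n (v i) (vs ! j) = inner_w N n (v i) (app_op N n A (vs ! j))"
      by (simp add: inner_w_scale_right)
    also have "\<dots> = cnj (inner_w N n (vs ! j) (app_op N n A (v i)))"
      using A sym unfolding sym_hermitian_def by blast
    also have "\<dots> = of_real (a i) * inner_w N n (v i) (vs ! j)"
      using a[OF that(1)] sym by (simp add: weak_eigen_def cnj_inner_w)
    finally show ?thesis
      using that(3) by simp
  qed
  have "s = (\<Sum>j<p. f (Re (ls ! j)) * (\<Sum>i<m. (cmod (inner_w N n (v i) (vs ! j)))\<^sup>2))"
    unfolding s p_def[symmetric]
    using onb_onf[OF w]
    by (intro sum.cong refl) (simp add: parseval[OF v] onf_sym[OF onb_onf[OF w]] onf_sqnorm[OF onb_onf[OF w]])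
  also have "\<dots> = (\<Sum>j<p. \<Sum>i<m. f (a i) * (cmod (inner_w N n (v i) (vs ! j)))\<^sup>2)"
    unfolding sum_distrib_left
  proof (intro sum.cong refl)
    fix j i assume "j \<in> {..<p}" "i \<in> {..<m}"
    then show "f (Re (ls ! j)) * (cmod (inner_w N n (v i) (vs ! j)))\<^sup>2
        = f (a i) * (cmod (inner_w N n (v i) (vs ! j)))\<^sup>2"
      using wv[of i j] by (cases "inner_w N n (v i) (vs ! j) = 0") auto
  qed
  also have "\<dots> = (\<Sum>i<m. f (a i) * (\<Sum>j<p. (cmod (inner_w N n (vs ! j) (v i)))\<^sup>2))"
    unfolding sum_distrib_left by (subst sum.swap) (simp add: cmod_inner_w_commute)
  also have "\<dots> = (\<Sum>i<m. f (a i))"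
    by (intro sum.cong refl) (simp add: parseval[OF w] onf_sym[OF onb_onf[OF v]] onf_sqnorm[OF onb_onf[OF v]])
  finally show "s = (\<Sum>j<m. f (a j))" .
qed

section \<open>Concavity and majorization\<close>

lemma concave_chord:
  fixes f :: "real \<Rightarrow> real"
  assumes "concave_on S f" "p \<in> S" "q \<in> S" "p \<le> t" "t \<le> q"
  shows "(q - t) * f p + (t - p) * f q \<le> (q - p) * f t"
proof (cases "p = q")
  case False
  define s where "s = (t - p) / (q - p)"
  have pq: "q - p > 0" and s: "0 \<le> s" "s \<le> 1"
    using assms False by (auto simp: s_def)
  have sq: "s * (q - p) = t - p"
    using pq by (simp add: s_def)
  have t: "(1 - s) * p + s * q = t"
    using sq by (simp add: algebra_simps)
  have "(1 - s) * f p + s * f q \<le> f t"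
    using concave_onD[OF assms(1) s assms(2,3)] t by simp
  then have "(q - p) * ((1 - s) * f p + s * f q) \<le> (q - p) * f t"
    using pq by simp
  moreover have "(q - p) * (1 - s) = q - t" "(q - p) * s = t - p"
    using sq by (simp_all add: algebra_simps)
  ultimately show ?thesis
    by (simp add: distrib_left flip: mult.assoc)
qed (use assms in auto)

lemma strictly_concave_chord:
  fixes f :: "real \<Rightarrow> real"
  assumes "strictly_concave_on S f" "p \<in> S" "q \<in> S" "p < t" "t < q"
  shows "(q - t) * f p + (t - p) * f q < (q - p) * f t"
proof -
  define s where "s = (t - p) / (q - p)"
  have pq: "q - p > 0" and s: "0 < s" "s < 1"
    using assms by (auto simp: s_def)
  have sq: "s * (q - p) = t - p"
    using pq by (simp add: s_def)
  have t: "(1 - s) * p + s * q = t"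
    using sq by (simp add: algebra_simps)
  have "(1 - s) * f p + s * f q < f ((1 - s) * p + s * q)"
    using assms pq s unfolding strictly_concave_on_def by auto
  then have "(q - p) * ((1 - s) * f p + s * f q) < (q - p) * f t"
    using pq t by simp
  moreover have "(q - p) * (1 - s) = q - t" "(q - p) * s = t - p"
    using sq by (simp_all add: algebra_simps)
  ultimately show ?thesis
    by (simp add: distrib_left flip: mult.assoc)
qed

definition slope :: "(real \<Rightarrow> real) \<Rightarrow> real \<Rightarrow> real \<Rightarrow> real" where
  "slope f x y = (f x - f y) / (x - y)"

lemma slope_commute: "slope f x y = slope f y x"
  unfolding slope_def by (metis minus_diff_eq minus_divide_divide)

lemma slope_mult: "x \<noteq> y \<Longrightarrow> f x - f y = slope f x y * (x - y)"
  by (simp add: slope_def)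

lemma slope_antimono_left:
  assumes "concave_on S f" "p \<in> S" "p' \<in> S" "q \<in> S" "p \<le> p'" "p' < q"
  shows "slope f p' q \<le> slope f p q"
proof -
  have "slope f q p' \<le> slope f q p"
    using concave_chord[OF assms(1,2,4,5)] assms(5,6)
    by (simp add: slope_def divide_simps) (simp add: algebra_simps)
  then show ?thesis
    by (simp add: slope_commute)
qed

lemma slope_antimono_right:
  assumes "concave_on S f" "p \<in> S" "q' \<in> S" "q \<in> S" "q' \<le> q" "p < q'"
  shows "slope f p q \<le> slope f p q'"
proof -
  have "slope f q p \<le> slope f q' p"
    using concave_chord[OF assms(1,2,4) less_imp_le[OF assms(6)] assms(5)] assms(5,6)
    by (simp add: slope_def divide_simps) (simp add: algebra_simps)
  then show ?thesis
    by (simp add: slope_commute)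
qed

lemma slope_strict_antimono_left:
  assumes "strictly_concave_on S f" "p \<in> S" "p' \<in> S" "q \<in> S" "p < p'" "p' < q"
  shows "slope f p' q < slope f p q"
proof -
  have "slope f q p' < slope f q p"
    using strictly_concave_chord[OF assms(1,2,4,5,6)] assms(5,6)
    by (simp add: slope_def divide_simps) (simp add: algebra_simps)
  then show ?thesis
    by (simp add: slope_commute)
qed

lemma slope_strict_antimono_right:
  assumes "strictly_concave_on S f" "p \<in> S" "q' \<in> S" "q \<in> S" "q' < q" "p < q'"
  shows "slope f p q < slope f p q'"
proof -
  have "slope f q p < slope f q' p"
    using strictly_concave_chord[OF assms(1,2,4,6,5)] assms(5,6)
    by (simp add: slope_def divide_simps) (simp add: algebra_simps)
  then show ?thesis
    by (simp add: slope_commute)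
qed

lemma slope_min_max: "slope f x y = slope f (min x y) (max x y)"
  by (simp add: min_def max_def slope_commute)

text \<open>The slope is symmetric in its arguments, so each pair may be put in increasing order;
  then one end point is moved at a time. The pairs may be ordered differently, as happens where a -
  b changes sign.\<close>

lemma slope_antimono:
  assumes f: "concave_on S f"
    and S: "x \<in> S" "y \<in> S" "x' \<in> S" "y' \<in> S"
    and ne: "x \<noteq> y" "x' \<noteq> y'" and le: "x' \<le> x" "y' \<le> y"
  shows "slope f x y \<le> slope f x' y'"
proof -
  let ?p = "min x y" and ?q = "max x y" and ?p' = "min x' y'" and ?q' = "max x' y'"
  have in_S: "?p \<in> S" "?q \<in> S" "?p' \<in> S" "?q' \<in> S"
    using S by (auto simp: min_def max_def)
  have o: "?p < ?q" "?p' < ?q'" "?p' \<le> ?p" "?q' \<le> ?q"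
    using ne le by auto
  have "slope f ?p ?q \<le> slope f ?p' ?q"
    using in_S o by (intro slope_antimono_left[OF f]) auto
  also have "\<dots> \<le> slope f ?p' ?q'"
    using in_S o by (intro slope_antimono_right[OF f]) auto
  finally show ?thesis
    by (simp flip: slope_min_max)
qed

text \<open>The intervals [y, x] and [x', y'] do not overlap, so some end point really moves. This
  is the configuration of two indices between which a - b changes sign.\<close>

lemma slope_strict_antimono:
  assumes f: "strictly_concave_on S f" "concave_on S f"
    and S: "x \<in> S" "y \<in> S" "x' \<in> S" "y' \<in> S"
    and lt: "y < x" "x' < y'" and le: "x \<le> x'" "y \<le> y'"
  shows "slope f x' y' < slope f x y"
proof -
  have "slope f x' y' \<le> slope f y y'"
    using S lt le slope_strict_antimono_left[OF f(1), of y x' y'] by force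
  also have "slope f y y' < slope f y x"
    using S lt le by (intro slope_strict_antimono_right[OF f(1)]) auto
  finally show ?thesis
    by (simp add: slope_commute)
qed

text \<open>The induction runs over an upper bound \<open>\<gamma>\<close> for the slopes seen so far; these increase with
  the index because both sequences decrease. Terms with \<open>a j = b j\<close> have no slope and are skipped,
  so no regularity of \<open>f\<close> at the end points is needed.\<close>
lemma karamata_slope:
  fixes a b :: "nat \<Rightarrow> real"
  assumes f: "concave_on S f"
    and S: "\<And>j. j < m \<Longrightarrow> a j \<in> S \<and> b j \<in> S"
    and anti: "\<And>i j. i \<le> j \<Longrightarrow> j < m \<Longrightarrow> a j \<le> a i \<and> b j \<le> b i"
    and maj: "\<And>p. p \<le> m \<Longrightarrow> (\<Sum>j<p. a j) \<le> (\<Sum>j<p. b j)"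
    and \<gamma>: "\<And>j. j < m \<Longrightarrow> a j \<noteq> b j \<Longrightarrow> slope f (a j) (b j) \<le> \<gamma>"
  shows "\<gamma> * ((\<Sum>j<m. a j) - (\<Sum>j<m. b j)) \<le> (\<Sum>j<m. f (a j) - f (b j))"
  using S anti maj \<gamma>
proof (induction m arbitrary: \<gamma>)
  case (Suc m)
  note IH = Suc.IH[OF Suc.prems(1) Suc.prems(2) Suc.prems(3)]
  show ?case
  proof (cases "a m = b m")
    case True
    then show ?thesis
      using IH[of \<gamma>] Suc.prems(4) by simp
  next
    case False
    let ?c = "slope f (a m) (b m)"
    have "?c * ((\<Sum>j<m. a j) - (\<Sum>j<m. b j)) \<le> (\<Sum>j<m. f (a j) - f (b j))"
      using Suc.prems(1,2) False by (intro IH slope_antimono[OF f]) auto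
    moreover have "f (a m) - f (b m) = ?c * (a m - b m)"
      by (rule slope_mult[OF False])
    ultimately have "?c * ((\<Sum>j<Suc m. a j) - (\<Sum>j<Suc m. b j)) \<le> (\<Sum>j<Suc m. f (a j) - f (b j))"
      by (simp add: algebra_simps)
    moreover have "\<gamma> * ((\<Sum>j<Suc m. a j) - (\<Sum>j<Suc m. b j)) \<le> ?c * ((\<Sum>j<Suc m. a j) - (\<Sum>j<Suc m. b j))"
      using Suc.prems(3)[of "Suc m"] Suc.prems(4)[OF _ False] by (intro mult_right_mono_neg) auto
    ultimately show ?thesis
      by linarith
  qed
qed simp

lemma karamata:
  fixes a b :: "nat \<Rightarrow> real"
  assumes f: "concave_on S f"
    and S: "\<And>j. j < m \<Longrightarrow> a j \<in> S \<and> b j \<in> S"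
    and anti: "\<And>i j. i \<le> j \<Longrightarrow> j < m \<Longrightarrow> a j \<le> a i \<and> b j \<le> b i"
    and maj: "\<And>p. p \<le> m \<Longrightarrow> (\<Sum>j<p. a j) \<le> (\<Sum>j<p. b j)"
    and eq: "(\<Sum>j<m. a j) = (\<Sum>j<m. b j)"
  shows "(\<Sum>j<m. f (b j)) \<le> (\<Sum>j<m. f (a j))"
proof -
  \<comment> \<open>Any common upper bound of the slopes would serve: the equal totals cancel
    it.\<close>
  have "Max ((\<lambda>j. slope f (a j) (b j)) ` {..<m}) * ((\<Sum>j<m. a j) - (\<Sum>j<m. b j))
      \<le> (\<Sum>j<m. f (a j) - f (b j))"
    by (rule karamata_slope[OF f S anti maj]) (auto intro: Max_ge)
  then show ?thesis
    by (simp add: eq sum_subtractf)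
qed

text \<open>Peel off the last index m. If a m < b m, the bound \<open>\<gamma>'\<close> is strict
  there. If b m < a m, the deficit of the shorter sums is still strict, and every earlier index with
  a j < b j has a strictly smaller slope than m, so the induction hypothesis applies with the slope
  at m as the new bound.\<close>

lemma karamata_slope_strict:
  fixes a b :: "nat \<Rightarrow> real"
  assumes f: "concave_on S f" "strictly_concave_on S f"
    and S: "\<And>j. j < m \<Longrightarrow> a j \<in> S \<and> b j \<in> S"
    and anti: "\<And>i j. i \<le> j \<Longrightarrow> j < m \<Longrightarrow> a j \<le> a i \<and> b j \<le> b i"
    and maj: "\<And>p. p \<le> m \<Longrightarrow> (\<Sum>j<p. a j) \<le> (\<Sum>j<p. b j)"
    and \<gamma>: "\<And>j. j < m \<Longrightarrow> a j \<noteq> b j \<Longrightarrow> slope f (a j) (b j) \<le> \<gamma>"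
    and \<gamma>': "\<And>j. j < m \<Longrightarrow> a j < b j \<Longrightarrow> slope f (a j) (b j) < \<gamma>"
    and lt: "(\<Sum>j<m. a j) < (\<Sum>j<m. b j)"
  shows "\<gamma> * ((\<Sum>j<m. a j) - (\<Sum>j<m. b j)) < (\<Sum>j<m. f (a j) - f (b j))"
  using S anti maj \<gamma> \<gamma>' lt
proof (induction m arbitrary: \<gamma>)
  case (Suc m)
  note IH = Suc.IH[OF Suc.prems(1) Suc.prems(2) Suc.prems(3)]
  let ?c = "slope f (a m) (b m)"
  let ?d = "(\<Sum>j<Suc m. a j) - (\<Sum>j<Suc m. b j)"
  have d: "?d < 0"
    using Suc.prems(6) by simp
  consider "a m = b m" | "a m < b m" | "b m < a m"
    by linarith
  then show ?case
  proof cases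
    case 1
    then show ?thesis
      using IH[of \<gamma>] Suc.prems(4-6) by simp
  next
    case 2
    have "?c * ((\<Sum>j<m. a j) - (\<Sum>j<m. b j)) \<le> (\<Sum>j<m. f (a j) - f (b j))"
      using Suc.prems(1-3) 2 by (intro karamata_slope[OF f(1)] slope_antimono[OF f(1)]) auto
    moreover have "f (a m) - f (b m) = ?c * (a m - b m)"
      using 2 by (intro slope_mult) simp
    ultimately have "?c * ?d \<le> (\<Sum>j<Suc m. f (a j) - f (b j))"
      by (simp add: algebra_simps)
    moreover have "\<gamma> * ?d < ?c * ?d"
      using d Suc.prems(5)[OF _ 2] by (intro mult_strict_right_mono_neg) auto
    ultimately show ?thesis
      by linarith
  next
    case 3
    have "?c * ((\<Sum>j<m. a j) - (\<Sum>j<m. b j)) < (\<Sum>j<m. f (a j) - f (b j))"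
      using Suc.prems(1,2) 3 d
      by (intro IH slope_antimono[OF f(1)] slope_strict_antimono[OF f(2,1)]) auto
    moreover have "f (a m) - f (b m) = ?c * (a m - b m)"
      using 3 by (intro slope_mult) simp
    ultimately have "?c * ?d < (\<Sum>j<Suc m. f (a j) - f (b j))"
      by (simp add: algebra_simps)
    moreover have "\<gamma> * ?d \<le> ?c * ?d"
      using d Suc.prems(4)[of m] 3 by (intro mult_right_mono_neg) auto
    ultimately show ?thesis
      by linarith
  qed
qed simp

text \<open>If the last entries differed, equal totals and majorization would force b m < a m after
  a strict deficit, and the strict slope estimate would contradict equality of the f-sums. So they
  agree, and the shorter sequences again have equal totals.\<close>

lemma karamata_strict:
  fixes a b :: "nat \<Rightarrow> real"
  assumes f: "concave_on S f" "strictly_concave_on S f"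
    and S: "\<And>j. j < m \<Longrightarrow> a j \<in> S \<and> b j \<in> S"
    and anti: "\<And>i j. i \<le> j \<Longrightarrow> j < m \<Longrightarrow> a j \<le> a i \<and> b j \<le> b i"
    and maj: "\<And>p. p \<le> m \<Longrightarrow> (\<Sum>j<p. a j) \<le> (\<Sum>j<p. b j)"
    and eq: "(\<Sum>j<m. a j) = (\<Sum>j<m. b j)"
    and eqf: "(\<Sum>j<m. f (a j)) = (\<Sum>j<m. f (b j))"
    and j: "j < m"
  shows "a j = b j"
  using S anti maj eq eqf j
proof (induction m)
  case (Suc m)
  have "a m = b m"
  proof (rule ccontr)
    assume ne: "a m \<noteq> b m"
    have "(\<Sum>j<m. a j) \<le> (\<Sum>j<m. b j)"
      using Suc.prems(3)[of m] by simp
    with ne Suc.prems(4) have gt: "b m < a m" and lt: "(\<Sum>j<m. a j) < (\<Sum>j<m. b j)"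
      by auto
    let ?c = "slope f (a m) (b m)"
    have "?c * ((\<Sum>j<m. a j) - (\<Sum>j<m. b j)) < (\<Sum>j<m. f (a j) - f (b j))"
      using Suc.prems(1-3) gt lt
      by (intro karamata_slope_strict[OF f] slope_antimono[OF f(1)] slope_strict_antimono[OF f(2,1)]) auto
    moreover have "f (a m) - f (b m) = ?c * (a m - b m)"
      by (rule slope_mult[OF ne])
    ultimately have "?c * ((\<Sum>j<Suc m. a j) - (\<Sum>j<Suc m. b j)) < (\<Sum>j<Suc m. f (a j) - f (b j))"
      by (simp add: algebra_simps)
    then show False
      unfolding Suc.prems(4) by (simp only: sum_subtractf Suc.prems(5)) simp
  qed
  moreover have "a j = b j" if "j < m"
    using Suc.prems that calculation by (intro Suc.IH) auto
  ultimately show ?case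
    using Suc.prems(6) less_Suc_eq by metis
qed simp

section \<open>Symmetric products and contractions\<close>

text \<open>Sum of G over all splittings of a word into two complementary subwords, each keeping its
  order (the unshuffle coproduct). On symmetric vectors this replaces sums over permutations: a
  permutation matters only through the set of positions that it assigns to each factor.\<close>

fun shuf :: "(nat list \<Rightarrow> nat list \<Rightarrow> complex) \<Rightarrow> nat list \<Rightarrow> complex" where
  "shuf G [] = G [] []"
| "shuf G (x # xs) = shuf (\<lambda>p. G (x # p)) xs + shuf (\<lambda>p q. G p (x # q)) xs"

lemma shuf_cong:
  "(\<And>p q. mset p + mset q = mset xs \<Longrightarrow> G p q = G' p q) \<Longrightarrow> shuf G xs = shuf G' xs"
proof (induction xs arbitrary: G G')
  case (Cons x xs)
  have "shuf (\<lambda>p. G (x # p)) xs = shuf (\<lambda>p. G' (x # p)) xs"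
    "shuf (\<lambda>p q. G p (x # q)) xs = shuf (\<lambda>p q. G' p (x # q)) xs"
    by (rule Cons.IH, rule Cons.prems, simp)+
  then show ?case
    by simp
qed simp

lemma shuf_add: "shuf (\<lambda>p q. G p q + G' p q) xs = shuf G xs + shuf G' xs"
  by (induction xs arbitrary: G G') (simp_all add: algebra_simps)

lemma shuf_scale: "shuf (\<lambda>p q. c * G p q) xs = c * shuf G xs"
  by (induction xs arbitrary: G) (simp_all add: algebra_simps)

lemma shuf_zero [simp]: "shuf (\<lambda>p q. 0) xs = 0"
  by (induction xs) simp_all

lemma shuf_sum: "shuf (\<lambda>p q. \<Sum>i\<in>I. G i p q) xs = (\<Sum>i\<in>I. shuf (G i) xs)"
  by (induction xs arbitrary: G) (simp_all add: sum.distrib)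

lemma cnj_shuf: "cnj (shuf G xs) = shuf (\<lambda>p q. cnj (G p q)) xs"
  by (induction xs arbitrary: G) simp_all

lemma shuf_append:
  "shuf G (ys @ zs) = shuf (\<lambda>p q. shuf (\<lambda>p' q'. G (p @ p') (q @ q')) zs) ys"
  by (induction ys arbitrary: G) simp_all

lemma shuf_move:
  assumes G: "\<And>p p' q q'. mset p = mset p' \<Longrightarrow> mset q = mset q' \<Longrightarrow> G p q = G p' q'"
  shows "shuf G (ys @ x # zs) = shuf G (x # ys @ zs)"
proof -
  have "G (p @ x # p') (q @ q') = G (x # p @ p') (q @ q')"
    "G (p @ p') (q @ x # q') = G (p @ p') (x # q @ q')" for p p' q q'
    by (rule G; simp)+
  then show ?thesis
    by (simp add: shuf_append shuf_add)
qed

lemma shuf_mset: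
  assumes "\<And>p p' q q'. mset p = mset p' \<Longrightarrow> mset q = mset q' \<Longrightarrow> G p q = G p' q'"
    and "mset xs = mset ys"
  shows "shuf G xs = shuf G ys"
  using assms
proof (induction xs arbitrary: G ys)
  case (Cons x xs)
  note G = Cons.prems(1)
  have "x \<in> set ys"
    using Cons.prems(2) by (metis list.set_intros(1) mset_eq_setD)
  then obtain ys1 ys2 where ys: "ys = ys1 @ x # ys2"
    by (meson split_list)
  then have m: "mset xs = mset (ys1 @ ys2)"
    using Cons.prems(2) by simp
  have "shuf (\<lambda>p. G (x # p)) xs = shuf (\<lambda>p. G (x # p)) (ys1 @ ys2)"
    "shuf (\<lambda>p q. G p (x # q)) xs = shuf (\<lambda>p q. G p (x # q)) (ys1 @ ys2)"
    by (rule Cons.IH, rule G, simp, simp, rule m)+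
  then have "shuf G (x # xs) = shuf G (x # ys1 @ ys2)"
    by simp
  moreover have "shuf G ys = shuf G (x # ys1 @ ys2)"
    unfolding ys by (rule shuf_move) (rule G)
  ultimately show ?case
    by simp
next
  case Nil
  from Nil.prems(2) have "ys = []"
    by simp
  then show ?case
    by simp
qed

lemma sum_binomial_Suc:
  fixes X :: "nat \<Rightarrow> complex"
  shows "(\<Sum>l\<le>Suc n. of_nat (Suc n choose l) * X l) = (\<Sum>l\<le>n. of_nat (n choose l) * (X l + X (Suc l)))"
proof -
  have "(\<Sum>l\<le>Suc n. of_nat (Suc n choose l) * X l)
      = X 0 + (\<Sum>l\<le>n. of_nat (n choose Suc l) * X (Suc l)) + (\<Sum>l\<le>n. of_nat (n choose l) * X (Suc l))"
    by (simp add: sum.atMost_Suc_shift algebra_simps sum.distrib del: sum.atMost_Suc)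
  also have "X 0 + (\<Sum>l\<le>n. of_nat (n choose Suc l) * X (Suc l)) = (\<Sum>l\<le>Suc n. of_nat (n choose l) * X l)"
    by (simp add: sum.atMost_Suc_shift del: sum.atMost_Suc)
  also have "\<dots> = (\<Sum>l\<le>n. of_nat (n choose l) * X l)"
    by simp
  finally show ?thesis
    by (simp add: algebra_simps sum.distrib)
qed

text \<open>Each of the C(n,l) position sets for the second subword contributes the same
  unrestricted double sum; the induction adds one letter, which is Pascal's rule.\<close>

lemma sum_words_shuf:
  "(\<Sum>xs\<in>words N n. shuf G xs) =
    (\<Sum>l\<le>n. of_nat (n choose l) * (\<Sum>p\<in>words N (n - l). \<Sum>q\<in>words N l. G p q))"
proof (induction n arbitrary: G)
  case (Suc n)
  let ?T = "\<lambda>l. \<Sum>p\<in>words N (Suc n - l). \<Sum>q\<in>words N l. G p q"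
  have "(\<Sum>xs\<in>words N (Suc n). shuf G xs)
    = (\<Sum>x<N. \<Sum>l\<le>n. of_nat (n choose l) * (\<Sum>p\<in>words N (n - l). \<Sum>q\<in>words N l. G (x # p) q + G p (x # q)))"
    by (simp add: sum_words_Suc sum.distrib Suc.IH algebra_simps)
  also have "\<dots> = (\<Sum>l\<le>n. of_nat (n choose l) * (\<Sum>x<N. \<Sum>p\<in>words N (n - l). \<Sum>q\<in>words N l. G (x # p) q + G p (x # q)))"
    by (subst sum.swap) (simp add: sum_distrib_left)
  also have "\<dots> = (\<Sum>l\<le>n. of_nat (n choose l) * (?T l + ?T (Suc l)))"
  proof (intro sum.cong refl arg_cong2[where f = "(*)"])
    fix l assume "l \<in> {..n}"
    then have "Suc n - l = Suc (n - l)"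
      by auto
    moreover have "(\<Sum>x<N. \<Sum>p\<in>words N (n - l). \<Sum>q\<in>words N l. G p (x # q)) = ?T (Suc l)"
      by (subst sum.swap) (simp add: sum_words_Suc)
    ultimately show "(\<Sum>x<N. \<Sum>p\<in>words N (n - l). \<Sum>q\<in>words N l. G (x # p) q + G p (x # q)) = ?T l + ?T (Suc l)"
      by (simp add: sum.distrib sum_words_Suc)
  qed
  finally show ?case
    by (simp only: sum_binomial_Suc)
qed simp

lemma sum_words_shuf':
  "(\<Sum>xs\<in>words N n. shuf G xs) =
    (\<Sum>l\<le>n. of_nat (n choose l) * (\<Sum>p\<in>words N l. \<Sum>q\<in>words N (n - l). G p q))"
  unfolding sum_words_shuf
  by (rule sum.reindex_bij_witness[of _ "\<lambda>l. n - l" "\<lambda>l. n - l"]) (auto simp: binomial_symmetric[symmetric])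

text \<open>For symmetric w and \<open>\<phi>\<close> on k and M letters this is C(k+M,M) times P(w
  tensor \<open>\<phi>\<close>), that is, the map A of the overview without its denominator.\<close>

definition sym_prod :: "vec \<Rightarrow> vec \<Rightarrow> vec" where
  "sym_prod w \<phi> = shuf (\<lambda>p q. w p * \<phi> q)"

text \<open>Partial inner product with \<open>\<phi>\<close> on the last M letters. On symmetric
  vectors it is the adjoint A^* of the overview, and its squared norms are the expectation values of
  the output for a pure input, up to \<open>clone_const\<close>.\<close>

definition contr :: "nat \<Rightarrow> nat \<Rightarrow> vec \<Rightarrow> vec \<Rightarrow> vec" where
  "contr N M \<phi> v = (\<lambda>a. \<Sum>b\<in>words N M. cnj (\<phi> b) * v (a @ b))"

lemma sym_prod_scale_left: "sym_prod (\<lambda>xs. c * w xs) \<phi> = (\<lambda>xs. c * sym_prod w \<phi> xs)"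
  by (simp add: sym_prod_def shuf_scale mult.assoc fun_eq_iff)

lemma sym_prod_sym:
  assumes w: "w \<in> sym_space N k" and \<phi>: "\<phi> \<in> sym_space N M"
  shows "sym_prod w \<phi> \<in> sym_space N (k + M)"
  unfolding sym_space_iff
proof (intro conjI allI impI)
  fix xs assume xs: "xs \<notin> words N (k + M)"
  have "w p * \<phi> q = 0" if "mset p + mset q = mset xs" for p q
  proof (rule ccontr)
    assume "w p * \<phi> q \<noteq> 0"
    then have "p @ q \<in> words N (k + M)"
      using sym_space_zero[OF w, of p] sym_space_zero[OF \<phi>, of q] by (auto intro: append_in_words)
    then show False
      using that xs words_mset_cong[of "p @ q" xs] by simp
  qed
  then have "sym_prod w \<phi> xs = shuf (\<lambda>p q. 0) xs"
    unfolding sym_prod_def by (rule shuf_cong)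
  then show "sym_prod w \<phi> xs = 0"
    by simp
next
  fix xs ys :: "nat list" assume "mset xs = mset ys"
  then show "sym_prod w \<phi> xs = sym_prod w \<phi> ys"
    unfolding sym_prod_def
    by (intro shuf_mset arg_cong2[where f = "(*)"] sym_space_mset[OF w] sym_space_mset[OF \<phi>])
qed

lemma sym_space_append_right:
  assumes v: "v \<in> sym_space N (k + M)" and b: "b \<in> words N M"
  shows "(\<lambda>a. v (a @ b)) \<in> sym_space N k"
  unfolding sym_space_iff
proof (intro conjI allI impI)
  fix a assume "a \<notin> words N k"
  then have "a @ b \<notin> words N (k + M)"
    using b by (auto simp: words_def)
  then show "v (a @ b) = 0"
    by (rule sym_space_zero[OF v])
qed (intro sym_space_mset[OF v], simp)

lemma sym_space_append_left:
  assumes v: "v \<in> sym_space N (k + M)" and a: "a \<in> words N k"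
  shows "(\<lambda>b. v (a @ b)) \<in> sym_space N M"
  unfolding sym_space_iff
proof (intro conjI allI impI)
  fix b assume "b \<notin> words N M"
  then have "a @ b \<notin> words N (k + M)"
    using a by (auto simp: words_def)
  then show "v (a @ b) = 0"
    by (rule sym_space_zero[OF v])
qed (intro sym_space_mset[OF v], simp)

lemma contr_sym:
  "v \<in> sym_space N (k + M) \<Longrightarrow> contr N M \<phi> v \<in> sym_space N k"
  unfolding contr_def by (intro sym_space_sum sym_space_append_right)

text \<open>Symmetry of v makes all splittings with |q| = M contribute alike, and the support of
  \<open>\<phi>\<close> removes the others.\<close>

lemma inner_sym_prod:
  assumes w: "w \<in> sym_space N k" and \<phi>: "\<phi> \<in> sym_space N M" and v: "v \<in> sym_space N (k + M)"
  shows "inner_w N (k + M) (sym_prod w \<phi>) v = of_nat ((k + M) choose M) * inner_w N k w (contr N M \<phi> v)"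
proof -
  let ?G = "\<lambda>p q. cnj (w p) * (cnj (\<phi> q) * v (p @ q))"
  have "cnj (sym_prod w \<phi> xs) * v xs = shuf ?G xs" for xs
  proof -
    have "cnj (sym_prod w \<phi> xs) * v xs = shuf (\<lambda>p q. v xs * cnj (w p * \<phi> q)) xs"
      by (simp only: sym_prod_def cnj_shuf shuf_scale mult.commute)
    also have "\<dots> = shuf ?G xs"
    proof (rule shuf_cong)
      fix p q assume "mset p + mset q = mset xs"
      then have "v xs = v (p @ q)"
        by (intro sym_space_mset[OF v]) simp
      then show "v xs * cnj (w p * \<phi> q) = ?G p q"
        by simp
    qed
    finally show ?thesis .
  qed
  then have "inner_w N (k + M) (sym_prod w \<phi>) v
    = (\<Sum>l\<le>k + M. of_nat ((k + M) choose l) * (\<Sum>p\<in>words N (k + M - l). \<Sum>q\<in>words N l. ?G p q))"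
    by (simp add: inner_w_def sum_words_shuf)
  also have "\<dots> = (\<Sum>l\<le>k + M. if l = M then of_nat ((k + M) choose l) * (\<Sum>p\<in>words N k. \<Sum>q\<in>words N M. ?G p q) else 0)"
  proof (rule sum.cong[OF refl])
    fix l assume "l \<in> {..k + M}"
    have "(\<Sum>p\<in>words N (k + M - l). \<Sum>q\<in>words N l. ?G p q) = 0" if "l \<noteq> M"
    proof (intro sum.neutral ballI)
      fix p q assume "q \<in> words N l"
      then have "q \<notin> words N M"
        using that by (auto simp: words_def)
      then show "?G p q = 0"
        by (simp add: sym_space_zero[OF \<phi>])
    qed
    then show "of_nat ((k + M) choose l) * (\<Sum>p\<in>words N (k + M - l). \<Sum>q\<in>words N l. ?G p q)
      = (if l = M then of_nat ((k + M) choose l) * (\<Sum>p\<in>words N k. \<Sum>q\<in>words N M. ?G p q) else 0)"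
      by simp
  qed
  also have "\<dots> = of_nat ((k + M) choose M) * (\<Sum>p\<in>words N k. \<Sum>q\<in>words N M. ?G p q)"
    by simp
  also have "(\<Sum>p\<in>words N k. \<Sum>q\<in>words N M. ?G p q) = inner_w N k w (contr N M \<phi> v)"
    by (simp add: inner_w_def contr_def sum_distrib_left)
  finally show ?thesis .
qed

text \<open>For fixed kept letters p of w and c of \<open>\<phi>\<close>, the sums over the
  exchanged letters q and p' separate into a number and its conjugate.\<close>

lemma sum_contr_square:
  "(\<Sum>p\<in>words N m. \<Sum>q\<in>words N i. \<Sum>p'\<in>words N i. \<Sum>q'\<in>words N n.
      cnj (w (p @ q)) * cnj (\<phi> (p' @ q')) * (w (p @ p') * \<phi> (q @ q')))
   = (\<Sum>c\<in>words N n. of_real (sqnorm_w N m (contr N i (\<lambda>b. \<phi> (b @ c)) w)))"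
proof -
  have "(\<Sum>c\<in>words N n. of_real (sqnorm_w N m (contr N i (\<lambda>b. \<phi> (b @ c)) w)))
    = (\<Sum>c\<in>words N n. \<Sum>p\<in>words N m.
        (\<Sum>p'\<in>words N i. cnj (\<phi> (p' @ c)) * w (p @ p')) * (\<Sum>q\<in>words N i. \<phi> (q @ c) * cnj (w (p @ q))))"
    by (simp only: sqnorm_w_def of_real_sum complex_norm_square contr_def cnj_sum complex_cnj_mult complex_cnj_cnj)
  also have "\<dots> = (\<Sum>c\<in>words N n. \<Sum>p\<in>words N m. \<Sum>q\<in>words N i. \<Sum>p'\<in>words N i.
      cnj (w (p @ q)) * cnj (\<phi> (p' @ c)) * (w (p @ p') * \<phi> (q @ c)))"
    unfolding sum_distrib_left sum_distrib_right by (simp add: mult_ac)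
  also have "\<dots> = (\<Sum>p\<in>words N m. \<Sum>q\<in>words N i. \<Sum>p'\<in>words N i. \<Sum>c\<in>words N n.
      cnj (w (p @ q)) * cnj (\<phi> (p' @ c)) * (w (p @ p') * \<phi> (q @ c)))"
    by (subst sum.swap, rule sum.cong[OF refl], subst sum.swap, rule sum.cong[OF refl], rule sum.swap)
  finally show ?thesis
    by simp
qed

text \<open>The anti-normally ordered product of the creation operators of \<open>w\<close> in the state \<open>\<phi>\<close>, rewritten
  as a sum of normally ordered terms, i.e. of reduced density matrices of \<open>\<phi>\<close>.\<close>
lemma sqnorm_sym_prod:
  assumes w: "w \<in> sym_space N k" and \<phi>: "\<phi> \<in> sym_space N M"
  shows "sqnorm_w N (k + M) (sym_prod w \<phi>) = real ((k + M) choose M) *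
    (\<Sum>i\<le>k. real (k choose i) * real (M choose i) *
      (\<Sum>c\<in>words N (M - i). sqnorm_w N (k - i) (contr N i (\<lambda>b. \<phi> (b @ c)) w)))"
proof -
  let ?H = "\<lambda>p q p' q'. cnj (w (p @ q)) * cnj (\<phi> (p' @ q')) * (w (p @ p') * \<phi> (q @ q'))"
  let ?S = "\<lambda>i. \<Sum>c\<in>words N (M - i). sqnorm_w N (k - i) (contr N i (\<lambda>b. \<phi> (b @ c)) w)"
  \<comment> \<open>A splitting of a @ b splits a into p, q and b into p', q': the letters q pass
    from w to \<open>\<phi>\<close> and the letters p' pass back. The support of w then forces p'
    and q to have equal length, which selects j = i below.\<close>
  have *: "cnj (w a) * (cnj (\<phi> b) * sym_prod w \<phi> (a @ b)) = shuf (\<lambda>p q. shuf (?H p q) b) a" for a b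
  proof -
    have "cnj (w a) * (cnj (\<phi> b) * sym_prod w \<phi> (a @ b))
      = shuf (\<lambda>p q. shuf (\<lambda>p' q'. cnj (w a) * cnj (\<phi> b) * (w (p @ p') * \<phi> (q @ q'))) b) a"
      by (simp only: sym_prod_def shuf_append shuf_scale mult.assoc)
    also have "\<dots> = shuf (\<lambda>p q. shuf (?H p q) b) a"
    proof (intro shuf_cong)
      fix p q p' q' assume "mset p + mset q = mset a" "mset p' + mset q' = mset b"
      then have "w a = w (p @ q)" "\<phi> b = \<phi> (p' @ q')"
        by (auto intro: sym_space_mset[OF w] sym_space_mset[OF \<phi>])
      then show "cnj (w a) * cnj (\<phi> b) * (w (p @ p') * \<phi> (q @ q')) = ?H p q p' q'"
        by simp
    qed
    finally show ?thesis .
  qed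
  have "inner_w N k w (contr N M \<phi> (sym_prod w \<phi>)) = (\<Sum>a\<in>words N k. \<Sum>b\<in>words N M. shuf (\<lambda>p q. shuf (?H p q) b) a)"
    by (simp add: inner_w_def contr_def sum_distrib_left *)
  also have "\<dots> = (\<Sum>a\<in>words N k. shuf (\<lambda>p q. \<Sum>b\<in>words N M. shuf (?H p q) b) a)"
    by (simp add: shuf_sum)
  also have "\<dots> = (\<Sum>i\<le>k. of_nat (k choose i) * (\<Sum>p\<in>words N (k - i). \<Sum>q\<in>words N i.
      \<Sum>j\<le>M. of_nat (M choose j) * (\<Sum>p'\<in>words N j. \<Sum>q'\<in>words N (M - j). ?H p q p' q')))"
    by (simp only: sum_words_shuf[where n = k] sum_words_shuf'[where n = M])
  also have "\<dots> = (\<Sum>i\<le>k. of_nat (k choose i) * of_nat (M choose i) * of_real (?S i))"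
  proof (rule sum.cong[OF refl])
    fix i assume i: "i \<in> {..k}"
    have "(\<Sum>j\<le>M. of_nat (M choose j) * (\<Sum>p'\<in>words N j. \<Sum>q'\<in>words N (M - j). ?H p q p' q'))
      = of_nat (M choose i) * (\<Sum>p'\<in>words N i. \<Sum>q'\<in>words N (M - i). ?H p q p' q')"
      if p: "p \<in> words N (k - i)" for p q
    proof -
      have "(\<Sum>p'\<in>words N j. \<Sum>q'\<in>words N (M - j). ?H p q p' q') = 0" if "j \<noteq> i" for j
      proof (intro sum.neutral ballI)
        fix p' q' assume "p' \<in> words N j"
        then have "p @ p' \<notin> words N k"
          using that p i by (auto simp: words_def)
        then show "?H p q p' q' = 0"
          by (simp add: sym_space_zero[OF w])
      qed
      then have "(\<Sum>j\<le>M. of_nat (M choose j) * (\<Sum>p'\<in>words N j. \<Sum>q'\<in>words N (M - j). ?H p q p' q'))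
        = (\<Sum>j\<le>M. if j = i then of_nat (M choose i) * (\<Sum>p'\<in>words N i. \<Sum>q'\<in>words N (M - i). ?H p q p' q') else 0)"
        by (intro sum.cong refl) simp
      then show ?thesis
        by simp
    qed
    then have "(\<Sum>p\<in>words N (k - i). \<Sum>q\<in>words N i. \<Sum>j\<le>M. of_nat (M choose j) * (\<Sum>p'\<in>words N j. \<Sum>q'\<in>words N (M - j). ?H p q p' q'))
      = of_nat (M choose i) * of_real (?S i)"
      by (simp add: sum_contr_square flip: sum_distrib_left)
    then show "of_nat (k choose i) * (\<Sum>p\<in>words N (k - i). \<Sum>q\<in>words N i. \<Sum>j\<le>M. of_nat (M choose j) * (\<Sum>p'\<in>words N j. \<Sum>q'\<in>words N (M - j). ?H p q p' q'))
      = of_nat (k choose i) * of_nat (M choose i) * complex_of_real (?S i)"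
      by (simp only: mult.assoc)
  qed
  finally have "complex_of_real (sqnorm_w N (k + M) (sym_prod w \<phi>)) = of_real (real ((k + M) choose M) *
    (\<Sum>i\<le>k. real (k choose i) * real (M choose i) * ?S i))"
    using inner_sym_prod[OF w \<phi> sym_prod_sym[OF w \<phi>]] by (simp add: inner_w_self)
  then show ?thesis
    using of_real_eq_iff by blast
qed

section \<open>Coherent states\<close>

definition letter_vec :: "nat \<Rightarrow> (nat \<Rightarrow> complex) \<Rightarrow> vec" where
  "letter_vec N u = (\<lambda>q. if q \<in> words N 1 then u (hd q) else 0)"

text \<open>Annihilator and creator of the mode u without the usual square roots: the commutation
  relation \<open>ann_cre\<close> is still canonical, and adjointness holds up to the particle
  number, see \<open>inner_cre\<close>.\<close>

definition ann :: "nat \<Rightarrow> (nat \<Rightarrow> complex) \<Rightarrow> vec \<Rightarrow> vec" where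
  "ann N u v = (\<lambda>a. \<Sum>x<N. cnj (u x) * v (x # a))"

definition cre :: "nat \<Rightarrow> (nat \<Rightarrow> complex) \<Rightarrow> vec \<Rightarrow> vec" where
  "cre N u v = sym_prod v (letter_vec N u)"

lemma letter_vec_sym: "letter_vec N u \<in> sym_space N 1"
  unfolding sym_space_iff
proof (intro conjI allI impI)
  fix xs ys :: "nat list" assume eq: "mset xs = mset ys"
  show "letter_vec N u xs = letter_vec N u ys"
  proof (cases "xs \<in> words N 1")
    case True
    then obtain x where "xs = [x]"
      by (auto simp: words_def length_Suc_conv)
    with eq show ?thesis
      by simp
  next
    case False
    then have "ys \<notin> words N 1"
      using eq words_mset_cong by blast
    with False show ?thesis
      by (simp add: letter_vec_def)
  qed
qed (simp add: letter_vec_def)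

lemma cre_sym: "v \<in> sym_space N n \<Longrightarrow> cre N u v \<in> sym_space N (Suc n)"
  using sym_prod_sym[OF _ letter_vec_sym, of v N n u] by (simp add: cre_def)

lemma cre_scale: "cre N u (\<lambda>xs. c * v xs) = (\<lambda>xs. c * cre N u v xs)"
  by (simp add: cre_def sym_prod_scale_left)

lemma cre_zero: "cre N u (\<lambda>_. 0) = (\<lambda>_. 0)"
  using cre_scale[of N u 0 "\<lambda>_. 0"] by simp

lemma ann_scale: "ann N u (\<lambda>xs. c * v xs) = (\<lambda>xs. c * ann N u v xs)"
  by (simp add: ann_def sum_distrib_left mult.left_commute)

lemma ann_eq_contr:
  assumes "v \<in> sym_space N (Suc n)"
  shows "ann N u v = contr N 1 (letter_vec N u) v"
proof
  fix a
  have "v (x # a) = v (a @ [x])" for x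
    by (rule sym_space_mset[OF assms]) simp
  then have "ann N u v a = (\<Sum>x<N. cnj (letter_vec N u [x]) * v (a @ [x]))"
    by (auto simp: ann_def letter_vec_def words_def intro!: sum.cong)
  then show "ann N u v a = contr N 1 (letter_vec N u) v a"
    by (simp add: contr_def sum_words_Suc)
qed

lemma ann_sym: "v \<in> sym_space N (Suc n) \<Longrightarrow> ann N u v \<in> sym_space N n"
  by (simp add: ann_eq_contr contr_sym)

lemma ann_0: "v \<in> sym_space N 0 \<Longrightarrow> ann N u v = (\<lambda>_. 0)"
  by (simp add: ann_def sym_space_zero)

lemma inner_cre:
  assumes "w \<in> sym_space N n" "v \<in> sym_space N (Suc n)"
  shows "inner_w N (Suc n) (cre N u w) v = of_nat (Suc n) * inner_w N n w (ann N u v)"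
  using inner_sym_prod[OF assms(1) letter_vec_sym, of v u] assms(2)
  by (simp add: cre_def ann_eq_contr[OF assms(2)])

section \<open>Commutation relation and the basis of the number operator\<close>

lemma shuf_empty: "shuf (\<lambda>p q. w p * (if q = [] then c else 0)) xs = c * w xs"
  by (induction xs arbitrary: w) simp_all

text \<open>The letter x removed by \<open>ann\<close> either belongs to w, which gives the creator
  after the annihilator, or is the one that \<open>cre\<close> inserted, which gives the squared
  norm of u times w.\<close>

lemma ann_cre:
  assumes w: "w \<in> sym_space N n" and u: "unit_vec N u"
  shows "ann N u (cre N u w) = (\<lambda>xs. w xs + cre N u (ann N u w) xs)"
proof
  fix a
  let ?e = "letter_vec N u"
  have e: "?e (x # q) = (if q = [] then u x else 0)" if "x < N" for x q
    using that by (auto simp: letter_vec_def words_def)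
  have "ann N u (cre N u w) a
    = (\<Sum>x<N. cnj (u x) * shuf (\<lambda>p q. w (x # p) * ?e q) a) + (\<Sum>x<N. cnj (u x) * (u x * w a))"
    by (simp add: ann_def cre_def sym_prod_def e shuf_empty distrib_left sum.distrib)
  also have "(\<Sum>x<N. cnj (u x) * shuf (\<lambda>p q. w (x # p) * ?e q) a) = cre N u (ann N u w) a"
    by (simp add: cre_def sym_prod_def ann_def sum_distrib_right shuf_sum shuf_scale mult.assoc)
  also have "(\<Sum>x<N. cnj (u x) * (u x * w a)) = of_real (\<Sum>x<N. (cmod (u x))\<^sup>2) * w a"
    unfolding of_real_sum complex_norm_square sum_distrib_right by (simp add: mult_ac)
  also have "\<dots> = w a"
    using u by (simp only: unit_vec_def of_real_1 mult_1)
  finally show "ann N u (cre N u w) a = w a + cre N u (ann N u w) a"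
    by simp
qed

text \<open>The number of particles outside the mode u in the j-th vector of the ordered number
  basis. On n >= r particles, the vectors with at most r particles outside u span a space of
  dimension \<open>symdim N r\<close>, whatever n is, so no particle number occurs as an
  argument.\<close>

definition level :: "nat \<Rightarrow> nat \<Rightarrow> nat" where
  "level N j = (LEAST r. j < symdim N r)"

definition number_eigen :: "nat \<Rightarrow> nat \<Rightarrow> (nat \<Rightarrow> complex) \<Rightarrow> vec \<Rightarrow> nat \<Rightarrow> bool" where
  "number_eigen N n u v r \<longleftrightarrow> v \<in> sym_space N n \<and>
     cre N u (ann N u v) = (\<lambda>xs. (of_nat n - of_nat r) * v xs)"

lemma number_eigen_cre:
  assumes "number_eigen N n u v r" "unit_vec N u"
  shows "number_eigen N (Suc n) u (cre N u v) r"
proof -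
  have v: "v \<in> sym_space N n"
    using assms by (simp add: number_eigen_def)
  have "ann N u (cre N u v) = (\<lambda>xs. (of_nat (Suc n) - of_nat r) * v xs)"
    using assms(1) unfolding ann_cre[OF v assms(2)] number_eigen_def by (simp add: algebra_simps)
  then show ?thesis
    using cre_sym[OF v] by (simp add: number_eigen_def cre_scale)
qed

lemma number_eigen_scale:
  "number_eigen N n u v r \<Longrightarrow> number_eigen N n u (\<lambda>xs. c * v xs) r"
  by (simp add: number_eigen_def ann_scale cre_scale sym_space_scale mult.left_commute)

lemma number_eigen_ann:
  assumes "number_eigen N (Suc n) u v r" "unit_vec N u"
  shows "number_eigen N n u (ann N u v) r"
proof -
  have v: "v \<in> sym_space N (Suc n)"
    using assms by (simp add: number_eigen_def)
  have "ann N u (cre N u (ann N u v)) = (\<lambda>xs. (of_nat (Suc n) - of_nat r) * ann N u v xs)"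
    using assms(1) by (simp add: number_eigen_def ann_scale)
  then have "(\<lambda>xs. ann N u v xs + cre N u (ann N u (ann N u v)) xs)
      = (\<lambda>xs. (of_nat (Suc n) - of_nat r) * ann N u v xs)"
    unfolding ann_cre[OF ann_sym[OF v] assms(2)] .
  then have "cre N u (ann N u (ann N u v)) xs = (of_nat n - of_nat r) * ann N u v xs" for xs
    by (auto dest!: fun_cong[of _ _ xs] simp: algebra_simps)
  then show ?thesis
    using ann_sym[OF v] by (auto simp: number_eigen_def)
qed

lemma inner_ann_number_eigen:
  assumes "number_eigen N (Suc n) u v r" "w \<in> sym_space N (Suc n)"
  shows "of_nat (Suc n) * inner_w N n (ann N u w) (ann N u v) = (of_nat (Suc n) - of_nat r) * inner_w N (Suc n) w v"
proof -
  have v: "v \<in> sym_space N (Suc n)" and c: "cre N u (ann N u v) = (\<lambda>xs. (of_nat (Suc n) - of_nat r) * v xs)"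
    using assms by (auto simp: number_eigen_def)
  have "inner_w N (Suc n) (cre N u (ann N u v)) w = of_nat (Suc n) * inner_w N n (ann N u v) (ann N u w)"
    by (rule inner_cre[OF ann_sym[OF v] assms(2)])
  then have "cnj (of_nat (Suc n) * inner_w N n (ann N u v) (ann N u w))
    = cnj (inner_w N (Suc n) (\<lambda>xs. (of_nat (Suc n) - of_nat r) * v xs) w)"
    unfolding c by simp
  then show ?thesis
    by (simp add: inner_w_scale_left cnj_inner_w)
qed

text \<open>Induction on the particle number. \<open>cre N u\<close> carries the basis for n
  particles to an orthogonal family for n + 1 with the same levels. Vectors completing it are
  orthogonal to the range of \<open>cre\<close>, hence killed by \<open>ann\<close>: all their
  particles lie outside u. Their indices start at \<open>symdim N n\<close>, where
  \<open>level\<close> takes the value n + 1; monotonicity of \<open>symdim\<close> is carried along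
  to evaluate that minimum.\<close>

lemma number_onb:
  assumes u: "unit_vec N u"
  shows "\<exists>e. onb N n (symdim N n) e \<and>
    (\<forall>j<symdim N n. level N j \<le> n \<and> number_eigen N n u (e j) (level N j)) \<and>
    (\<forall>r\<le>n. symdim N r \<le> symdim N n)"
proof (induction n)
  case 0
  obtain m e where e: "onb N 0 m e"
    using onb_exists by blast
  note m = onb_symdim[OF e]
  have "level N j = 0" if "j < symdim N 0" for j
    unfolding level_def using that by (intro Least_eq_0)
  moreover have "e j \<in> sym_space N 0" if "j < symdim N 0" for j
    using onf_sym[OF onb_onf[OF e]] that m by simp
  ultimately show ?case
    using e m by (intro exI[of _ e]) (auto simp: number_eigen_def ann_0 cre_zero)
next
  case (Suc n)
  let ?d = "symdim N n"
  obtain e where e: "onb N n ?d e" and le: "\<And>j. j < ?d \<Longrightarrow> level N j \<le> n"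
    and ev: "\<And>j. j < ?d \<Longrightarrow> number_eigen N n u (e j) (level N j)"
    and mono: "\<And>r. r \<le> n \<Longrightarrow> symdim N r \<le> ?d"
    using Suc.IH by blast
  note on = onb_onf[OF e]
  \<comment> \<open>The squared norm of \<open>cre N u (e j)\<close>: the adjointness factor times
    the eigenvalue of \<open>ann\<close> after \<open>cre\<close>.\<close>
  let ?s = "\<lambda>j. real (Suc n) * (real (Suc n) - real (level N j))"
  let ?g = "\<lambda>j xs. of_real (1 / sqrt (?s j)) * cre N u (e j) xs"
  have s: "?s j > 0" if "j < ?d" for j
    using le[OF that] by simp
  have cre_e: "inner_w N (Suc n) (cre N u (e i)) (cre N u (e j)) = of_real (?s j) * (if i = j then 1 else 0)"
    if "i < ?d" "j < ?d" for i j
  proof -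
    have sy: "e i \<in> sym_space N n" "e j \<in> sym_space N n"
      using onf_sym[OF on] that by auto
    have "inner_w N (Suc n) (cre N u (e i)) (cre N u (e j))
      = of_nat (Suc n) * inner_w N n (e i) (ann N u (cre N u (e j)))"
      by (rule inner_cre[OF sy(1) cre_sym[OF sy(2)]])
    also have "ann N u (cre N u (e j)) = (\<lambda>xs. (of_nat (Suc n) - of_nat (level N j)) * e j xs)"
      using ev[OF that(2)] unfolding ann_cre[OF sy(2) u] number_eigen_def by (simp add: algebra_simps)
    finally show ?thesis
      using onf_inner[OF on that] by (simp add: inner_w_scale_right)
  qed
  have g: "onf N (Suc n) ?d ?g"
    unfolding onf_def
  proof (intro conjI allI impI)
    fix i assume i: "i < ?d"
    show "?g i \<in> sym_space N (Suc n)"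
      by (intro sym_space_scale cre_sym onf_sym[OF on i])
    fix j assume j: "j < ?d"
    have "inner_w N (Suc n) (?g i) (?g j)
      = of_real (1 / sqrt (?s i) * (1 / sqrt (?s j)) * ?s j) * (if i = j then 1 else 0)"
      by (simp only: inner_w_scale_left inner_w_scale_right cre_e[OF i j] complex_cnj_complex_of_real
          of_real_mult mult.assoc)
    also have "\<dots> = (if i = j then 1 else 0)"
    proof (cases "i = j")
      case True
      have "1 / sqrt (?s j) * (1 / sqrt (?s j)) * ?s j = 1"
        using s[OF j] by (simp add: field_simps flip: real_sqrt_mult)
      with True show ?thesis
        by (simp only: if_True of_real_1 mult_1_right simp_thms)
    qed (simp only: if_False mult_zero_right)
    finally show "inner_w N (Suc n) (?g i) (?g j) = (if i = j then 1 else 0)" .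
  qed
  then obtain m v where v: "?d \<le> m" "onb N (Suc n) m v" "\<And>i. i < ?d \<Longrightarrow> v i = ?g i"
    using onf_extend by blast
  have m: "m = symdim N (Suc n)"
    by (rule onb_symdim[OF v(2)])
  have "level N j \<le> Suc n \<and> number_eigen N (Suc n) u (v j) (level N j)" if j: "j < m" for j
  proof (cases "j < ?d")
    case True
    then have "number_eigen N (Suc n) u (?g j) (level N j)"
      by (intro number_eigen_scale number_eigen_cre ev u)
    then show ?thesis
      using le[OF True] v(3)[OF True] by simp
  next
    case False
    have vj: "v j \<in> sym_space N (Suc n)"
      by (rule onf_sym[OF onb_onf[OF v(2)] j])
    have "level N j = Suc n"
      unfolding level_def
    proof (rule Least_equality)
      show "j < symdim N (Suc n)"
        using j m by simp
      show "Suc n \<le> r" if "j < symdim N r" for r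
        using that mono[of r] False by (cases "r \<le> n") auto
    qed
    moreover have "inner_w N n (e i) (ann N u (v j)) = 0" if i: "i < ?d" for i
    proof -
      have "inner_w N (Suc n) (?g i) (v j) = 0"
        using onf_inner[OF onb_onf[OF v(2)], of i j] v(1) v(3)[OF i] i j False by simp
      then have "complex_of_real (1 / sqrt (?s i)) * inner_w N (Suc n) (cre N u (e i)) (v j) = 0"
        by (simp only: inner_w_scale_left complex_cnj_complex_of_real)
      moreover have "complex_of_real (1 / sqrt (?s i)) \<noteq> 0"
        using divide_pos_pos[OF zero_less_one real_sqrt_gt_zero[OF s[OF i]]]
        by (metis less_irrefl of_real_eq_0_iff)
      ultimately have "inner_w N (Suc n) (cre N u (e i)) (v j) = 0"
        by (simp only: mult_eq_0_iff) blast
      then show ?thesis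
        using inner_cre[OF onf_sym[OF on i] vj, of u] by (simp del: of_nat_Suc)
    qed
    then have "ann N u (v j) = (\<lambda>_. 0)"
      using onb_expand[OF e ann_sym[OF vj]] by (intro ext) simp
    ultimately show ?thesis
      using vj by (simp add: number_eigen_def cre_zero)
  qed
  moreover have "symdim N r \<le> m" if "r \<le> Suc n" for r
    using that mono[of r] v(1) m by (cases "r = Suc n") auto
  ultimately show ?case
    using v(2) m by blast
qed

lemma unit_vec_exists: "N \<ge> 1 \<Longrightarrow> \<exists>u. unit_vec N u"
  by (intro exI[of _ "\<lambda>x. if x = 0 then 1 else 0"])
    (simp add: unit_vec_def if_distrib[of cmod] if_distrib[of "\<lambda>x. x\<^sup>2"] sum.delta cong: if_cong)

lemma symdim_mono: "N \<ge> 1 \<Longrightarrow> r \<le> n \<Longrightarrow> symdim N r \<le> symdim N n"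
  using unit_vec_exists number_onb by metis

lemma level_le: "j < symdim N n \<Longrightarrow> level N j \<le> n"
  unfolding level_def by (rule Least_le)

lemma level_gt: "N \<ge> 1 \<Longrightarrow> symdim N n \<le> j \<Longrightarrow> j < symdim N n' \<Longrightarrow> level N j > n"
  unfolding level_def
  by (metis LeastI leD le_less_trans not_le symdim_mono)

lemma level_mono: "i \<le> j \<Longrightarrow> j < symdim N n \<Longrightarrow> level N i \<le> level N j"
  unfolding level_def by (metis (no_types, lifting) LeastI Least_le le_less_trans)

text \<open>The probability that M particles drawn without replacement from M + k all lie in the
  mode u when r of the M + k lie outside it.\<close>

definition coh_eval :: "nat \<Rightarrow> nat \<Rightarrow> nat \<Rightarrow> real" where
  "coh_eval M k r = real ((M + k - r) choose M) / real ((M + k) choose M)"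

lemma contr_tensor_pow_Suc:
  assumes v: "v \<in> sym_space N (k + Suc M)"
  shows "contr N (Suc M) (tensor_pow (Suc M) u) v = contr N M (tensor_pow M u) (ann N u v)"
proof
  fix a
  have tp: "tensor_pow (Suc M) u (x # b) = u x * tensor_pow M u b" for x b
    by (simp add: tensor_pow_def prod.lessThan_Suc_shift del: prod.lessThan_Suc)
  have "v (a @ x # b) = v (x # a @ b)" for x b
    by (rule sym_space_mset[OF v]) simp
  then have "contr N (Suc M) (tensor_pow (Suc M) u) v a
    = (\<Sum>x<N. \<Sum>b\<in>words N M. cnj (tensor_pow M u b) * (cnj (u x) * v (x # a @ b)))"
    by (simp add: contr_def sum_words_Suc tp mult_ac)
  also have "\<dots> = contr N M (tensor_pow M u) (ann N u v) a"
    by (subst sum.swap) (simp add: contr_def ann_def sum_distrib_left)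
  finally show "contr N (Suc M) (tensor_pow (Suc M) u) v a = contr N M (tensor_pow M u) (ann N u v) a" .
qed

text \<open>In the sampling picture, the first of M + 1 draws hits u with probability
  (M+k+1-r)/(M+k+1), and M draws from M + k particles remain. The same ratio appears in
  \<open>inner_ann_number_eigen\<close>.\<close>

lemma coh_eval_Suc:
  assumes "r \<le> M + k"
  shows "real (Suc (M + k)) * coh_eval (Suc M) k r = (real (Suc (M + k)) - real r) * coh_eval M k r"
proof -
  have d: "Suc M + k - r = Suc (M + k - r)" "Suc (M + k) - r = Suc (M + k - r)" "real (Suc (M + k)) - real r = real (Suc (M + k - r))"
    using assms by auto
  have 1: "real (Suc M) * real (Suc (M + k) choose Suc M) = real (Suc (M + k)) * real ((M + k) choose M)"
    using Suc_times_binomial[of M "M + k"] by (metis of_nat_mult)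
  have 2: "real (Suc M) * real (Suc (M + k - r) choose Suc M) = real (Suc (M + k - r)) * real ((M + k - r) choose M)"
    using Suc_times_binomial[of M "M + k - r"] by (metis of_nat_mult)
  have pos: "real ((M + k) choose M) > 0" "real (Suc (M + k) choose Suc M) > 0"
    by (simp_all del: binomial_Suc_Suc)
  have "real (Suc (M + k)) * coh_eval (Suc M) k r
    = real (Suc (M + k)) * (real (Suc M) * real (Suc (M + k - r) choose Suc M)) / (real (Suc M) * real (Suc (M + k) choose Suc M))"
    by (simp add: coh_eval_def d del: binomial_Suc_Suc of_nat_Suc)
  also have "\<dots> = (real (Suc (M + k)) - real r) * coh_eval M k r"
    unfolding 1 2 d using pos by (simp add: coh_eval_def del: binomial_Suc_Suc of_nat_Suc)
  finally show ?thesis .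
qed

text \<open>Contracting with the M-th power of u applies \<open>ann\<close> M times. On n particles
  each application multiplies the form by the fraction (n - r)/n of particles in u and preserves r.
  If r is the full particle number, \<open>ann\<close> kills v and the binomial vanishes as
  well.\<close>

lemma inner_contr_tensor_pow:
  assumes u: "unit_vec N u"
    and "number_eigen N (k + M) u v r" "w \<in> sym_space N (k + M)" "r \<le> k + M"
  shows "inner_w N k (contr N M (tensor_pow M u) w) (contr N M (tensor_pow M u) v)
    = of_real (coh_eval M k r) * inner_w N (k + M) w v"
  using assms(2-4)
proof (induction M arbitrary: v w)
  case 0
  then show ?case
    by (simp add: contr_def tensor_pow_def coh_eval_def)
next
  case (Suc M)
  have v: "v \<in> sym_space N (k + Suc M)"
    using Suc.prems by (simp add: number_eigen_def)
  let ?n = "k + M"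
  have adj: "of_nat (Suc ?n) * inner_w N ?n (ann N u w) (ann N u v)
      = (of_nat (Suc ?n) - of_nat r) * inner_w N (Suc ?n) w v"
    using Suc.prems by (intro inner_ann_number_eigen) auto
  show ?case
  proof (cases "r \<le> ?n")
    case True
    have "inner_w N k (contr N (Suc M) (tensor_pow (Suc M) u) w) (contr N (Suc M) (tensor_pow (Suc M) u) v)
      = of_real (coh_eval M k r) * inner_w N ?n (ann N u w) (ann N u v)"
      unfolding contr_tensor_pow_Suc[OF v] contr_tensor_pow_Suc[OF Suc.prems(2)]
      using Suc.prems True by (intro Suc.IH number_eigen_ann u ann_sym) auto
    then have "of_nat (Suc ?n) * inner_w N k (contr N (Suc M) (tensor_pow (Suc M) u) w) (contr N (Suc M) (tensor_pow (Suc M) u) v)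
      = of_real (coh_eval M k r) * (of_nat (Suc ?n) * inner_w N ?n (ann N u w) (ann N u v))"
      by (simp only: mult.left_commute)
    also have "\<dots> = of_real ((real (Suc ?n) - real r) * coh_eval M k r) * inner_w N (Suc ?n) w v"
      unfolding adj by (simp only: of_real_mult of_real_diff of_real_of_nat_eq mult_ac)
    also have "\<dots> = of_nat (Suc ?n) * (of_real (coh_eval (Suc M) k r) * inner_w N (k + Suc M) w v)"
    proof -
      have "(real (Suc ?n) - real r) * coh_eval M k r = real (Suc ?n) * coh_eval (Suc M) k r"
        using coh_eval_Suc[of r M k] True by (simp only: add.commute)
      then show ?thesis
        by (simp only: of_real_mult of_real_of_nat_eq mult.assoc add_Suc_right)
    qed
    finally show ?thesis
      by (simp only: mult_cancel_left of_nat_eq_0_iff) simp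
  next
    case False
    with Suc.prems have r: "r = Suc ?n"
      by simp
    have "of_nat (Suc ?n) * inner_w N ?n (ann N u v) (ann N u v) = (of_nat (Suc ?n) - of_nat r) * inner_w N (Suc ?n) v v"
      using Suc.prems v by (intro inner_ann_number_eigen) auto
    then have "sqnorm_w N ?n (ann N u v) = 0"
      by (simp add: r inner_w_self del: of_nat_Suc)
    then have "ann N u v b = 0" for b
      using sym_space_zero[of "ann N u v" N ?n b] ann_sym[of v N ?n u] v
      by (cases "b \<in> words N ?n") (auto simp: sqnorm_w_eq_0_iff)
    then show ?thesis
      unfolding contr_tensor_pow_Suc[OF v]
      by (simp add: r contr_def inner_w_zero_right coh_eval_def)
  qed
qed

section \<open>Majorization for pure states\<close>

lemma vandermonde_level:
  assumes "r \<le> k"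
  shows "(\<Sum>l\<le>k. (M choose l) * ((k - r) choose l)) = (M + k - r) choose M"
proof -
  have "(\<Sum>l\<le>k. (M choose l) * ((k - r) choose l)) = (\<Sum>l\<le>k - r. (M choose l) * ((k - r) choose l))"
    by (rule sum.mono_neutral_right) (auto simp: not_le intro: binomial_eq_0)
  also have "\<dots> = (\<Sum>l\<le>k - r. (M choose l) * ((k - r) choose (k - r - l)))"
    by (intro sum.cong refl arg_cong2[where f = "(*)"] binomial_symmetric) simp
  also have "\<dots> = (M + (k - r)) choose (k - r)"
    by (rule vandermonde)
  also have "\<dots> = (M + k - r) choose M"
    using binomial_symmetric[of "k - r" "M + (k - r)"] assms by simp
  finally show ?thesis .
qed

lemma coh_eval_nonneg: "coh_eval M k r \<ge> 0"
  by (simp add: coh_eval_def)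

lemma coh_eval_eq_0: "M \<ge> 1 \<Longrightarrow> k < r \<Longrightarrow> coh_eval M k r = 0"
  by (simp add: coh_eval_def binomial_eq_0)

lemma sum_sqnorm_append:
  assumes "l \<le> M"
  shows "(\<Sum>c\<in>words N (M - l). sqnorm_w N l (\<lambda>b. \<phi> (b @ c))) = sqnorm_w N M \<phi>"
proof -
  have "sqnorm_w N (l + (M - l)) \<phi> = (\<Sum>c\<in>words N (M - l). sqnorm_w N l (\<lambda>b. \<phi> (b @ c)))"
    unfolding sqnorm_w_def sum_words_append by (rule sum.swap)
  then show ?thesis
    using assms by simp
qed

text \<open>Both the majorization inequality (for orthonormal families) and the trace identity (for
  orthonormal bases) follow from the same computation, with \<open>rel\<close> standing for either relation.\<close>
lemma sqnorm_sym_prod_rel: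
  assumes rel: "rel = (\<le>) \<or> rel = (=)"
    and \<phi>: "\<phi> \<in> sym_space N M"
    and w: "onf N k m w"
    and IH: "\<And>l \<psi>. 1 \<le> l \<Longrightarrow> l \<le> k \<Longrightarrow> \<psi> \<in> sym_space N l \<Longrightarrow>
      rel (\<Sum>i<m. sqnorm_w N (k - l) (contr N l \<psi> (w i)))
        (sqnorm_w N l \<psi> * (\<Sum>i<m. coh_eval l (k - l) (level N i)))"
  shows "rel (\<Sum>i<m. sqnorm_w N (k + M) (sym_prod (w i) \<phi>) / (real ((k + M) choose M))\<^sup>2)
    (sqnorm_w N M \<phi> * (\<Sum>i<m. coh_eval M k (level N i)))"
proof -
  let ?C = "real ((k + M) choose M)"
  let ?T = "\<lambda>l. \<Sum>c\<in>words N (M - l). \<Sum>i<m. sqnorm_w N (k - l) (contr N l (\<lambda>b. \<phi> (b @ c)) (w i))"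
  have C: "?C > 0"
    by simp
  have rel_sum_words: "rel (sum f I) (sum g I)" if "\<And>i. i \<in> I \<Longrightarrow> rel (f i) (g i)" for f g :: "nat list \<Rightarrow> real" and I
    using rel that by (auto intro: sum_mono sum.cong)
  have rel_sum: "rel (sum f I) (sum g I)" if "\<And>i. i \<in> I \<Longrightarrow> rel (f i) (g i)" for f g :: "nat \<Rightarrow> real" and I
    using rel that by (auto intro: sum_mono sum.cong)
  have rel_mult: "rel (c * x) (c * y)" if "rel x y" "c \<ge> 0" for c x y :: real
    using rel that by (auto intro: mult_left_mono)
  have rel_refl: "rel x x" for x :: real
    using rel by auto
  have "(\<Sum>i<m. sqnorm_w N (k + M) (sym_prod (w i) \<phi>) / ?C\<^sup>2)
    = (\<Sum>i<m. \<Sum>l\<le>k. 1 / ?C * (real (M choose l) * (real (k choose l) *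
        (\<Sum>c\<in>words N (M - l). sqnorm_w N (k - l) (contr N l (\<lambda>b. \<phi> (b @ c)) (w i))))))"
  proof (rule sum.cong[OF refl])
    fix i assume "i \<in> {..<m}"
    then have "w i \<in> sym_space N k"
      using onf_sym[OF w] by simp
    moreover have "?C * x / ?C\<^sup>2 = 1 / ?C * x" for x
      using C by (simp add: power2_eq_square)
    ultimately show "sqnorm_w N (k + M) (sym_prod (w i) \<phi>) / ?C\<^sup>2
      = (\<Sum>l\<le>k. 1 / ?C * (real (M choose l) * (real (k choose l) *
        (\<Sum>c\<in>words N (M - l). sqnorm_w N (k - l) (contr N l (\<lambda>b. \<phi> (b @ c)) (w i))))))"
      using \<phi> by (simp only: sqnorm_sym_prod sum_distrib_left[symmetric]) (simp only: mult_ac)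
  qed
  also have "\<dots> = (\<Sum>l\<le>k. 1 / ?C * (real (M choose l) * (real (k choose l) * ?T l)))"
    unfolding sum_distrib_left by (subst sum.swap, rule sum.cong[OF refl], subst sum.swap, rule refl)
  finally have lhs: "(\<Sum>i<m. sqnorm_w N (k + M) (sym_prod (w i) \<phi>) / ?C\<^sup>2) = \<dots>" .
  have "coh_eval M k (level N i) = (\<Sum>l\<le>k. 1 / ?C * (real (M choose l) * real ((k - level N i) choose l)))"
    if "i < m" for i
  proof -
    have "level N i \<le> k"
      using that onf_le_symdim[OF w] by (intro level_le) simp
    from vandermonde_level[OF this, of M]
    have "real ((M + k - level N i) choose M) = (\<Sum>l\<le>k. real (M choose l) * real ((k - level N i) choose l))"
      by (metis (mono_tags, lifting) of_nat_mult of_nat_sum sum.cong)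
    then show ?thesis
      by (simp add: coh_eval_def add.commute sum_divide_distrib)
  qed
  then have "sqnorm_w N M \<phi> * (\<Sum>i<m. coh_eval M k (level N i))
    = sqnorm_w N M \<phi> * (\<Sum>i<m. \<Sum>l\<le>k. 1 / ?C * (real (M choose l) * real ((k - level N i) choose l)))"
    by (intro arg_cong2[where f = "(*)"] sum.cong) auto
  also have "\<dots> = (\<Sum>l\<le>k. 1 / ?C * (real (M choose l) * (sqnorm_w N M \<phi> * (\<Sum>i<m. real ((k - level N i) choose l)))))"
    by (subst sum.swap) (simp add: sum_distrib_left mult_ac)
  finally have rhs: "sqnorm_w N M \<phi> * (\<Sum>i<m. coh_eval M k (level N i)) = \<dots>" .
  have main: "rel (real (k choose l) * ?T l) (sqnorm_w N M \<phi> * (\<Sum>i<m. real ((k - level N i) choose l)))"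
    if l: "l \<le> k" "l \<le> M" for l
  proof (cases "l = 0")
    case True
    have "?T 0 = (\<Sum>c\<in>words N M. (cmod (\<phi> c))\<^sup>2 * real m)"
    proof (intro sum.cong)
      fix c
      have "contr N 0 (\<lambda>b. \<phi> (b @ c)) (w i) = (\<lambda>xs. cnj (\<phi> c) * w i xs)" for i
        by (simp add: contr_def)
      then show "(\<Sum>i<m. sqnorm_w N (k - 0) (contr N 0 (\<lambda>b. \<phi> (b @ c)) (w i))) = (cmod (\<phi> c))\<^sup>2 * real m"
        by (simp add: sqnorm_w_scale onf_sqnorm[OF w])
    qed simp
    then show ?thesis
      unfolding True by (simp add: sqnorm_w_def sum_distrib_right rel_refl)
  next
    case False
    \<comment> \<open>The number of ways to choose the exchanged letters of w is exactly the
      denominator of the coherent eigenvalue for the cloner from l to k particles.\<close>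
    have "real (k choose l) * coh_eval l (k - l) r = real ((k - r) choose l)" for r
      using l by (simp add: coh_eval_def)
    then have e: "real (k choose l) * (\<Sum>i<m. coh_eval l (k - l) (level N i)) = (\<Sum>i<m. real ((k - level N i) choose l))"
      by (simp add: sum_distrib_left)
    have "rel (?T l) (\<Sum>c\<in>words N (M - l). sqnorm_w N l (\<lambda>b. \<phi> (b @ c)) * (\<Sum>i<m. coh_eval l (k - l) (level N i)))"
    proof (rule rel_sum_words)
      fix c assume "c \<in> words N (M - l)"
      then have "(\<lambda>b. \<phi> (b @ c)) \<in> sym_space N l"
        using \<phi> l by (intro sym_space_append_right[of \<phi> N l "M - l"]) auto
      then show "rel (\<Sum>i<m. sqnorm_w N (k - l) (contr N l (\<lambda>b. \<phi> (b @ c)) (w i)))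
          (sqnorm_w N l (\<lambda>b. \<phi> (b @ c)) * (\<Sum>i<m. coh_eval l (k - l) (level N i)))"
        using False l by (intro IH) auto
    qed
    then have "rel (?T l) (sqnorm_w N M \<phi> * (\<Sum>i<m. coh_eval l (k - l) (level N i)))"
      by (simp only: sum_sqnorm_append[OF l(2)] sum_distrib_right[symmetric])
    then have "rel (real (k choose l) * ?T l) (real (k choose l) * (sqnorm_w N M \<phi> * (\<Sum>i<m. coh_eval l (k - l) (level N i))))"
      by (rule rel_mult) simp
    then show ?thesis
      by (simp only: mult.left_commute[of "real (k choose l)"] e)
  qed
  show ?thesis
    unfolding lhs rhs
  proof (rule rel_sum)
    fix l assume l: "l \<in> {..k}"
    have "rel (real (M choose l) * (real (k choose l) * ?T l))
       (real (M choose l) * (sqnorm_w N M \<phi> * (\<Sum>i<m. real ((k - level N i) choose l))))"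
    proof (cases "l \<le> M")
      case True
      with l show ?thesis
        by (intro rel_mult[OF main]) auto
    next
      case False
      then show ?thesis
        by (simp add: binomial_eq_0 rel_refl)
    qed
    then show "rel (1 / ?C * (real (M choose l) * (real (k choose l) * ?T l)))
       (1 / ?C * (real (M choose l) * (sqnorm_w N M \<phi> * (\<Sum>i<m. real ((k - level N i) choose l)))))"
      by (rule rel_mult) simp
  qed
qed

text \<open>By adjointness the overlaps are, up to the binomial, the coefficients of
  \<open>sym_prod w \<phi>\<close> in the family v. This is the exchange of A A^* for A^* A.\<close>

lemma sqnorm_contr_bessel:
  assumes \<phi>: "\<phi> \<in> sym_space N M" and v: "onf N (k + M) m v" and w: "w \<in> sym_space N k"
  shows "(\<Sum>j<m. (cmod (inner_w N k w (contr N M \<phi> (v j))))\<^sup>2)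
    \<le> sqnorm_w N (k + M) (sym_prod w \<phi>) / (real ((k + M) choose M))\<^sup>2"
    and "onb N (k + M) m v \<Longrightarrow> (\<Sum>j<m. (cmod (inner_w N k w (contr N M \<phi> (v j))))\<^sup>2)
    = sqnorm_w N (k + M) (sym_prod w \<phi>) / (real ((k + M) choose M))\<^sup>2"
proof -
  let ?C = "real ((k + M) choose M)"
  have C: "?C > 0"
    by simp
  have "(cmod (inner_w N k w (contr N M \<phi> (v j))))\<^sup>2 = (cmod (inner_w N (k + M) (v j) (sym_prod w \<phi>)))\<^sup>2 / ?C\<^sup>2"
    if "j < m" for j
    using C unfolding cmod_inner_w_commute[of N "k + M" "v j"] inner_sym_prod[OF w \<phi> onf_sym[OF v that]]
    by (simp add: norm_mult power_mult_distrib)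
  then have *: "(\<Sum>j<m. (cmod (inner_w N k w (contr N M \<phi> (v j))))\<^sup>2)
    = (\<Sum>j<m. (cmod (inner_w N (k + M) (v j) (sym_prod w \<phi>)))\<^sup>2) / ?C\<^sup>2"
    by (simp add: sum_divide_distrib)
  show "(\<Sum>j<m. (cmod (inner_w N k w (contr N M \<phi> (v j))))\<^sup>2)
    \<le> sqnorm_w N (k + M) (sym_prod w \<phi>) / ?C\<^sup>2"
    unfolding * by (intro divide_right_mono bessel[OF v]) simp
  show "(\<Sum>j<m. (cmod (inner_w N k w (contr N M \<phi> (v j))))\<^sup>2)
    = sqnorm_w N (k + M) (sym_prod w \<phi>) / ?C\<^sup>2" if "onb N (k + M) m v"
    unfolding * using parseval[OF that sym_prod_sym[OF w \<phi>]] by simp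
qed

text \<open>Induction on \<open>k\<close>: the nonzero spectrum of the output for the pure state \<open>\<phi>\<close> is that of
  \<open>w \<mapsto> sqnorm_w (sym_prod w \<phi>)\<close> on \<open>sym_space N k\<close>, which is a positive combination of outputs of
  cloners with fewer added particles, applied to the reduced states of \<open>\<phi>\<close>.\<close>
lemma pure_state_rel:
  assumes N: "N \<ge> 1" and rel: "rel = (\<le>) \<or> rel = (=)"
    and "M \<ge> 1" "\<phi> \<in> sym_space N M" "onf N (k + M) m v" "rel = (=) \<Longrightarrow> onb N (k + M) m v"
  shows "rel (\<Sum>j<m. sqnorm_w N k (contr N M \<phi> (v j)))
    (sqnorm_w N M \<phi> * (\<Sum>j<m. coh_eval M k (level N j)))"
  using assms(3-)
proof (induction k arbitrary: M \<phi> m v rule: less_induct)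
  case (less k)
  note M = less.prems(1) and \<phi> = less.prems(2) and v = less.prems(3)
  let ?C = "real ((k + M) choose M)"
  let ?x = "\<lambda>j. contr N M \<phi> (v j)"
  have x: "?x j \<in> sym_space N k" if "j < m" for j
    using contr_sym[OF onf_sym[OF v that]] .
  have mid: "rel (\<Sum>i<p. sqnorm_w N (k + M) (sym_prod (w i) \<phi>) / ?C\<^sup>2)
    (sqnorm_w N M \<phi> * (\<Sum>i<p. coh_eval M k (level N i)))"
    if w: "onf N k p w" and wb: "rel = (=) \<Longrightarrow> onb N k p w" for p w
    using w wb by (intro sqnorm_sym_prod_rel[OF rel \<phi> w] less.IH) auto
  show ?case
  proof (cases "rel = (=)")
    case False
    then have le: "rel = (\<le>)"
      using rel by blast
    \<comment> \<open>The m contracted vectors are spanned by p <= m orthonormal ones on k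
      particles; the bound for p indices grows to the one for m because coherent eigenvalues are
      nonnegative.\<close>
    obtain p w where p: "p \<le> m" and w: "onf N k p w"
      and ex: "\<And>j xs. j < m \<Longrightarrow> ?x j xs = (\<Sum>i<p. inner_w N k (w i) (?x j) * w i xs)"
      using gram_schmidt[of m ?x N k, OF x] by blast
    have "(\<Sum>j<m. sqnorm_w N k (?x j)) = (\<Sum>j<m. \<Sum>i<p. (cmod (inner_w N k (w i) (?x j)))\<^sup>2)"
      by (intro sum.cong refl parseval_expand[symmetric] w ex) simp
    also have "\<dots> \<le> (\<Sum>i<p. sqnorm_w N (k + M) (sym_prod (w i) \<phi>) / ?C\<^sup>2)"
      by (subst sum.swap, intro sum_mono sqnorm_contr_bessel \<phi> v onf_sym[OF w]) simp
    also have "\<dots> \<le> sqnorm_w N M \<phi> * (\<Sum>i<p. coh_eval M k (level N i))"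
      using mid[OF w] False le by simp
    also have "\<dots> \<le> sqnorm_w N M \<phi> * (\<Sum>i<m. coh_eval M k (level N i))"
      using p by (intro mult_left_mono sum_mono2) (auto simp: coh_eval_nonneg)
    finally show ?thesis
      by (simp add: le)
  next
    case True
    then have vb: "onb N (k + M) m v"
      using less.prems(4) by blast
    obtain p w where wb: "onb N k p w"
      using onb_exists by blast
    note w = onb_onf[OF wb]
    have dims: "p = symdim N k" "m = symdim N (k + M)"
      using onb_symdim wb vb by auto
    have "(\<Sum>j<m. sqnorm_w N k (?x j)) = (\<Sum>j<m. \<Sum>i<p. (cmod (inner_w N k (w i) (?x j)))\<^sup>2)"
      by (intro sum.cong refl parseval[symmetric] wb x) simp
    also have "\<dots> = (\<Sum>i<p. sqnorm_w N (k + M) (sym_prod (w i) \<phi>) / ?C\<^sup>2)"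
      by (subst sum.swap, intro sum.cong refl sqnorm_contr_bessel(2) \<phi> v vb onf_sym[OF w]) simp
    also have "\<dots> = sqnorm_w N M \<phi> * (\<Sum>i<p. coh_eval M k (level N i))"
      using mid[OF w wb] True by simp
    \<comment> \<open>From index \<open>symdim N k\<close> on, the level exceeds k and the coherent
      eigenvalue is zero.\<close>
    also have "(\<Sum>i<p. coh_eval M k (level N i)) = (\<Sum>i<m. coh_eval M k (level N i))"
      using dims symdim_mono[OF N, of k "k + M"] level_gt[OF N, of k] M
      by (intro sum.mono_neutral_left ballI coh_eval_eq_0) auto
    finally show ?thesis
      by (simp add: True)
  qed
qed

lemma pure_state_majorization:
  assumes "N \<ge> 1" "M \<ge> 1" "\<phi> \<in> sym_space N M" "onf N (k + M) m v"
  shows "(\<Sum>j<m. sqnorm_w N k (contr N M \<phi> (v j))) \<le> sqnorm_w N M \<phi> * (\<Sum>j<m. coh_eval M k (level N j))"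
proof -
  \<comment> \<open>This makes the premise asking for a full basis vacuous in the case of
    <=.\<close>
  have "(\<le>) \<noteq> ((=) :: real \<Rightarrow> real \<Rightarrow> bool)"
    by (metis less_imp_le less_irrefl zero_less_one)
  then show ?thesis
    using pure_state_rel[of N "(\<le>)" M \<phi> k m v] assms by blast
qed

lemma pure_state_trace:
  assumes "N \<ge> 1" "M \<ge> 1" "\<phi> \<in> sym_space N M" "onb N (k + M) m v"
  shows "(\<Sum>j<m. sqnorm_w N k (contr N M \<phi> (v j))) = sqnorm_w N M \<phi> * (\<Sum>j<m. coh_eval M k (level N j))"
  using pure_state_rel[of N "(=)" M \<phi> k m v] assms onb_onf[OF assms(4)] by blast

section \<open>The cloning channel\<close>

lemma app_mult_op: "app_op N n (mult_op N n A B) v = app_op N n A (app_op N n B v)"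
proof
  fix xs
  have "app_op N n (mult_op N n A B) v xs = (\<Sum>zs\<in>words N n. \<Sum>ys\<in>words N n. A xs ys * (B ys zs * v zs))"
    by (simp add: app_op_def mult_op_def sum_distrib_right mult.assoc)
  also have "\<dots> = app_op N n A (app_op N n B v) xs"
    unfolding app_op_def sum_distrib_left by (rule sum.swap)
  finally show "app_op N n (mult_op N n A B) v xs = app_op N n A (app_op N n B v) xs" .
qed

lemma app_op_cong:
  "(\<And>ys. ys \<in> words N n \<Longrightarrow> v ys = w ys) \<Longrightarrow> app_op N n A v = app_op N n A w"
  by (simp add: app_op_def)

lemma inner_app_sym_proj:
  assumes "w \<in> sym_space N n"
  shows "inner_w N n w (app_op N n (sym_proj N n) v) = inner_w N n w v"
proof -
  have "inner_w N n w (app_op N n (sym_proj N n) v)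
      = (\<Sum>xs\<in>words N n. \<Sum>ys\<in>words N n. cnj (sym_proj N n ys xs * w xs) * v ys)"
    unfolding inner_w_def app_op_def sum_distrib_left
  proof (intro sum.cong refl)
    fix xs ys assume "xs \<in> words N n" "ys \<in> words N n"
    then have "sym_proj N n xs ys = sym_proj N n ys xs"
      by (intro sym_proj_commute length_words)
    then show "cnj (w xs) * (sym_proj N n xs ys * v ys) = cnj (sym_proj N n ys xs * w xs) * v ys"
      by simp
  qed
  also have "\<dots> = inner_w N n (app_op N n (sym_proj N n) w) v"
    by (subst sum.swap) (simp only: inner_w_def app_op_def cnj_sum sum_distrib_right)
  also have "\<dots> = inner_w N n w v"
    using app_sym_proj_id[OF assms] by (intro inner_w_cong) auto
  finally show ?thesis .
qed

lemma app_id_tensor: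
  assumes a: "a \<in> words N k"
  shows "app_op N (k + M) (id_tensor k \<rho>) v (a @ b) = app_op N M \<rho> (\<lambda>b'. v (a @ b')) b"
proof -
  have "app_op N (k + M) (id_tensor k \<rho>) v (a @ b)
    = (\<Sum>a'\<in>words N k. if a = a' then \<Sum>b'\<in>words N M. \<rho> b b' * v (a' @ b') else 0)"
    unfolding app_op_def sum_words_append using a
    by (intro sum.cong refl) (simp add: id_tensor_def length_words)
  also have "\<dots> = app_op N M \<rho> (\<lambda>b'. v (a @ b')) b"
    using a by (simp add: app_op_def)
  finally show ?thesis .
qed

text \<open>The two normalizing factors of the channel combined. Their product is the ratio of the
  dimensions of the symmetric spaces on M and on M + k letters, and it is the largest eigenvalue of
  a coherent output, since \<open>coh_eval M k 0\<close> is 1.\<close>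

definition clone_const :: "nat \<Rightarrow> nat \<Rightarrow> nat \<Rightarrow> real" where
  "clone_const N M k =
     real (fact (M + N - 1)) / real (fact (M + k + N - 1)) * (real (fact (M + k)) / real (fact M))"

lemma clone_const_pos: "clone_const N M k > 0"
  unfolding clone_const_def by (intro mult_pos_pos divide_pos_pos) simp_all

text \<open>Keeps the spectra inside [0,1], where f is known to be concave.\<close>

lemma clone_const_le_1:
  assumes "N \<ge> 1"
  shows "clone_const N M k \<le> 1"
proof (induction k)
  case 0
  then show ?case
    by (simp add: clone_const_def)
next
  case (Suc k)
  have N: "Suc (M + k) + N - 1 = Suc (M + k + N - 1)"
    using assms by simp
  have "clone_const N M (Suc k) = clone_const N M k * (real (Suc (M + k)) / real (Suc (M + k + N - 1)))"
  proof -
    have "a / (s * b) * (t * c / d) = a / b * (c / d) * (t / s)" for a b c d s t :: real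
      by (simp add: mult_ac)
    then show ?thesis
      unfolding clone_const_def N add_Suc_right fact_Suc of_nat_mult of_nat_id .
  qed
  also have "\<dots> \<le> 1 * 1"
    using assms clone_const_pos[of N M k] by (intro mult_mono Suc) (auto simp: divide_le_eq)
  finally show ?case
    by simp
qed

lemma app_clone_hat:
  assumes "v \<in> sym_space N (k + M)"
  shows "app_op N (k + M) (clone_hat N M k \<rho>) v = (\<lambda>xs. of_real (clone_const N M k) *
    app_op N (k + M) (sym_proj N (k + M)) (app_op N (k + M) (id_tensor k \<rho>) v) xs)"
proof -
  have "clone_hat N M k \<rho> = (\<lambda>xs ys. of_real (clone_const N M k) *
     mult_op N (k + M) (mult_op N (k + M) (sym_proj N (k + M)) (id_tensor k \<rho>)) (sym_proj N (k + M)) xs ys)"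
    by (simp add: clone_hat_def clone_T_def clone_const_def add.commute[of k M] mult.assoc)
  moreover have "app_op N n (\<lambda>xs ys. c * A xs ys) v = (\<lambda>xs. c * app_op N n A v xs)" for n c A
    by (simp add: app_op_def sum_distrib_left mult.assoc)
  moreover have "app_op N (k + M) A (app_op N (k + M) (sym_proj N (k + M)) v) = app_op N (k + M) A v" for A
    using app_sym_proj_id[OF assms] by (intro app_op_cong) auto
  ultimately show ?thesis
    by (simp only: app_mult_op)
qed

lemma clone_hat_sym:
  assumes "v \<in> sym_space N (k + M)"
  shows "(\<lambda>xs. if xs \<in> words N (k + M) then app_op N (k + M) (clone_hat N M k \<rho>) v xs else 0)
    \<in> sym_space N (k + M)"
  unfolding sym_space_iff app_clone_hat[OF assms]
proof (intro conjI allI impI)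
  fix xs ys :: "nat list" assume eq: "mset xs = mset ys"
  show "(if xs \<in> words N (k + M) then of_real (clone_const N M k) *
      app_op N (k + M) (sym_proj N (k + M)) (app_op N (k + M) (id_tensor k \<rho>) v) xs else 0)
    = (if ys \<in> words N (k + M) then of_real (clone_const N M k) *
      app_op N (k + M) (sym_proj N (k + M)) (app_op N (k + M) (id_tensor k \<rho>) v) ys else 0)"
    using words_mset_cong[OF eq, of N "k + M"] app_sym_proj_mset[OF _ eq, of N "k + M"] by simp
qed simp

text \<open>The projectors are absorbed by the symmetric vectors w and v, so only I tensor rho
  remains: one copy of rho for each word a in the k added letters.\<close>

lemma inner_clone_hat:
  assumes w: "w \<in> sym_space N (k + M)" and v: "v \<in> sym_space N (k + M)"
  shows "inner_w N (k + M) w (app_op N (k + M) (clone_hat N M k \<rho>) v) = of_real (clone_const N M k) *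
    (\<Sum>a\<in>words N k. inner_w N M (\<lambda>b. w (a @ b)) (app_op N M \<rho> (\<lambda>b. v (a @ b))))"
proof -
  have "inner_w N (k + M) w (app_op N (k + M) (clone_hat N M k \<rho>) v)
    = of_real (clone_const N M k) * inner_w N (k + M) w (app_op N (k + M) (id_tensor k \<rho>) v)"
    unfolding app_clone_hat[OF v] inner_w_scale_right inner_app_sym_proj[OF w] ..
  also have "inner_w N (k + M) w (app_op N (k + M) (id_tensor k \<rho>) v)
    = (\<Sum>a\<in>words N k. inner_w N M (\<lambda>b. w (a @ b)) (app_op N M \<rho> (\<lambda>b. v (a @ b))))"
    unfolding inner_w_def sum_words_append by (simp add: app_id_tensor)
  finally show ?thesis .
qed

lemma clone_hat_hermitian:
  assumes "sym_hermitian N M \<rho>"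
  shows "sym_hermitian N (k + M) (clone_hat N M k \<rho>)"
  unfolding sym_hermitian_def
proof (intro ballI)
  fix v w assume v: "v \<in> sym_space N (k + M)" and w: "w \<in> sym_space N (k + M)"
  have "inner_w N M (\<lambda>b. w (a @ b)) (app_op N M \<rho> (\<lambda>b. v (a @ b)))
      = cnj (inner_w N M (\<lambda>b. v (a @ b)) (app_op N M \<rho> (\<lambda>b. w (a @ b))))" if "a \<in> words N k" for a
    using assms sym_space_append_left[OF v that] sym_space_append_left[OF w that]
    unfolding sym_hermitian_def by blast
  then show "inner_w N (k + M) w (app_op N (k + M) (clone_hat N M k \<rho>) v)
      = cnj (inner_w N (k + M) v (app_op N (k + M) (clone_hat N M k \<rho>) w))"
    by (simp add: inner_clone_hat v w)
qed

section \<open>Hermiticity and spectral decomposition of the input\<close>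

lemma contr_eq_inner: "contr N M \<phi> v a = inner_w N M \<phi> (\<lambda>b. v (a @ b))"
  by (simp add: contr_def inner_w_def)

text \<open>Polarization: reality of the quadratic form at w + v and at w + i v fixes the imaginary
  and the real part.\<close>

lemma density_hermitian:
  assumes "density_op N M \<rho>"
  shows "sym_hermitian N M \<rho>"
  unfolding sym_hermitian_def
proof (intro ballI)
  fix v w
  let ?q = "\<lambda>a b. inner_w N M a (app_op N M \<rho> b)"
  have real: "Im (?q x x) = 0" for x
    using assms by (auto simp: density_op_def complex_is_Real_iff)
  have ex: "?q (\<lambda>xs. w xs + c * v xs) (\<lambda>xs. w xs + c * v xs)
      = ?q w w + c * ?q w v + cnj c * ?q v w + cnj c * c * ?q v v" for c
    by (simp only: app_op_lin inner_w_add_left inner_w_add_right inner_w_scale_left inner_w_scale_right)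
      (simp add: algebra_simps)
  have "Im (?q w v + ?q v w) = 0"
    using real[of "\<lambda>xs. w xs + 1 * v xs"] real[of w] real[of v] unfolding ex by simp
  moreover have "Re (?q w v) - Re (?q v w) = 0"
    using real[of "\<lambda>xs. w xs + \<i> * v xs"] real[of w] real[of v] unfolding ex by simp
  ultimately show "?q w v = cnj (?q v w)"
    by (simp add: complex_eq_iff)
qed

lemma spectral_form:
  assumes K: "sym_hermitian N n K" and v: "onb N n m v"
    and ev: "\<And>j. j < m \<Longrightarrow> weak_eigen N n K (v j) (q j)"
    and x: "x \<in> sym_space N n" and y: "y \<in> sym_space N n"
  shows "inner_w N n x (app_op N n K y) = (\<Sum>j<m. of_real (q j) * (inner_w N n x (v j) * inner_w N n (v j) y))"
proof -
  have "x = (\<lambda>xs. \<Sum>j<m. inner_w N n (v j) x * v j xs)"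
    using onb_expand[OF v x] by blast
  then have "inner_w N n x (app_op N n K y)
      = inner_w N n (\<lambda>xs. \<Sum>j<m. inner_w N n (v j) x * v j xs) (app_op N n K y)"
    by simp
  also have "\<dots> = (\<Sum>j<m. inner_w N n x (v j) * inner_w N n (v j) (app_op N n K y))"
    by (simp add: inner_w_sum_left cnj_inner_w)
  also have "\<dots> = (\<Sum>j<m. of_real (q j) * (inner_w N n x (v j) * inner_w N n (v j) y))"
  proof (intro sum.cong refl)
    fix j assume "j \<in> {..<m}"
    then have j: "j < m"
      by simp
    have "inner_w N n (v j) (app_op N n K y) = cnj (inner_w N n y (app_op N n K (v j)))"
      using K y onf_sym[OF onb_onf[OF v] j] unfolding sym_hermitian_def by blast
    also have "\<dots> = of_real (q j) * inner_w N n (v j) y"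
      using ev[OF j] y by (simp add: weak_eigen_def cnj_inner_w)
    finally show "inner_w N n x (v j) * inner_w N n (v j) (app_op N n K y)
        = of_real (q j) * (inner_w N n x (v j) * inner_w N n (v j) y)"
      by simp
  qed
  finally show ?thesis .
qed

text \<open>Weak eigenvectors only describe the form of rho on symmetric vectors. The entries are
  recovered from rho = P rho P by evaluating that form at the columns \<open>?c ys\<close> of P,
  which reproduce point values: the inner product of \<open>?c ys\<close> with a symmetric vector is
  its value at ys. The entries in turn give the sum of the weights from the trace.\<close>

lemma density_decomp:
  assumes \<rho>: "density_op N M \<rho>"
  shows "\<exists>p \<phi> q. onb N M p \<phi> \<and> (\<forall>i<p. weak_eigen N M \<rho> (\<phi> i) (q i)) \<and> (\<forall>i<p. q i \<ge> 0) \<and>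
    (\<Sum>i<p. q i) = 1 \<and>
    (\<forall>xs\<in>words N M. \<forall>ys\<in>words N M. \<rho> xs ys = (\<Sum>i<p. of_real (q i) * (\<phi> i xs * cnj (\<phi> i ys))))"
proof -
  note herm = density_hermitian[OF \<rho>]
  obtain p \<phi> q where \<phi>: "onb N M p \<phi>" and ev: "\<And>i. i < p \<Longrightarrow> weak_eigen N M \<rho> (\<phi> i) (q i)"
    using spectral_onb[OF herm] by blast
  note on = onb_onf[OF \<phi>]
  have q: "q i \<ge> 0" if i: "i < p" for i
  proof -
    have "inner_w N M (\<phi> i) (app_op N M \<rho> (\<phi> i)) = of_real (q i)"
      using ev[OF i] onf_sym[OF on i] onf_inner[OF on i i] by (simp add: weak_eigen_def)
    then have "q i = Re (inner_w N M (\<phi> i) (app_op N M \<rho> (\<phi> i)))"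
      by simp
    then show ?thesis
      using \<rho> by (simp add: density_op_def)
  qed
  let ?c = "\<lambda>ys z. if z \<in> words N M then sym_proj N M z ys else 0"
  have col_sym: "?c ys \<in> sym_space N M" if ys: "ys \<in> words N M" for ys
  proof -
    let ?e = "\<lambda>z. if z = ys then 1 else (0::complex)"
    have e: "app_op N M (sym_proj N M) ?e z = sym_proj N M z ys" for z
      using ys by (simp add: app_op_def sum.delta if_distrib cong: if_cong)
    show ?thesis
      unfolding sym_space_iff
    proof (intro conjI allI impI)
      fix z z' :: "nat list" assume eq: "mset z = mset z'"
      show "?c ys z = ?c ys z'"
        using words_mset_cong[OF eq, of N M] app_sym_proj_mset[OF _ eq, of N M ?e] by (simp add: e)
    qed simp
  qed
  have col_inner: "inner_w N M (?c ys) (\<phi> i) = \<phi> i ys" if "i < p" "ys \<in> words N M" for i ys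
  proof -
    have "inner_w N M (?c ys) (\<phi> i) = app_op N M (sym_proj N M) (\<phi> i) ys"
      unfolding inner_w_def app_op_def
      using that by (intro sum.cong refl) (simp add: sym_proj_commute[of _ M ys] length_words)
    then show ?thesis
      using app_sym_proj_id[OF onf_sym[OF on that(1)] that(2)] by simp
  qed
  have entry: "\<rho> xs ys = (\<Sum>i<p. of_real (q i) * (\<phi> i xs * cnj (\<phi> i ys)))"
    if xs: "xs \<in> words N M" and ys: "ys \<in> words N M" for xs ys
  proof -
    have "\<rho> xs ys = mult_op N M (mult_op N M (sym_proj N M) \<rho>) (sym_proj N M) xs ys"
      using \<rho> xs ys by (simp add: density_op_def)
    also have "\<dots> = (\<Sum>z\<in>words N M. \<Sum>z'\<in>words N M. cnj (?c xs z') * (\<rho> z' z * ?c ys z))"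
      unfolding mult_op_def sum_distrib_right
      using xs by (intro sum.cong refl) (simp add: sym_proj_commute[of xs M] length_words)
    also have "\<dots> = inner_w N M (?c xs) (app_op N M \<rho> (?c ys))"
      unfolding inner_w_def app_op_def sum_distrib_left by (rule sum.swap)
    also have "\<dots> = (\<Sum>i<p. of_real (q i) * (inner_w N M (?c xs) (\<phi> i) * inner_w N M (\<phi> i) (?c ys)))"
      by (rule spectral_form[OF herm \<phi> ev col_sym[OF xs] col_sym[OF ys]])
    also have "\<dots> = (\<Sum>i<p. of_real (q i) * (\<phi> i xs * cnj (\<phi> i ys)))"
    proof (intro sum.cong refl)
      fix i assume "i \<in> {..<p}"
      then show "of_real (q i) * (inner_w N M (?c xs) (\<phi> i) * inner_w N M (\<phi> i) (?c ys))
          = of_real (q i) * (\<phi> i xs * cnj (\<phi> i ys))"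
        using col_inner[of i xs] col_inner[of i ys] xs ys cnj_inner_w[of N M "?c ys" "\<phi> i"] by simp
    qed
    finally show ?thesis .
  qed
  have "1 = (\<Sum>xs\<in>words N M. \<Sum>i<p. of_real (q i) * (\<phi> i xs * cnj (\<phi> i xs)))"
    using \<rho> entry by (simp add: density_op_def trace_op_def)
  also have "\<dots> = (\<Sum>i<p. of_real (q i) * of_real (sqnorm_w N M (\<phi> i)))"
    by (subst sum.swap) (simp only: sqnorm_w_def of_real_sum complex_norm_square sum_distrib_left)
  also have "\<dots> = of_real (\<Sum>i<p. q i)"
    using onf_sqnorm[OF on] by simp
  finally have s: "(\<Sum>i<p. q i) = 1"
    by (metis of_real_eq_1_iff)
  show ?thesis
    by (intro exI[of _ p] exI[of _ \<phi>] exI[of _ q] conjI allI impI ballI \<phi> ev q s entry)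
qed

section \<open>The coherent spectrum, and its comparison with the spectrum of a general
  output\<close>

lemma coh_eval_le_1: "coh_eval M k r \<le> 1"
  by (simp add: coh_eval_def binomial_right_mono divide_le_eq_1)

lemma coh_eval_antimono: "r \<le> r' \<Longrightarrow> coh_eval M k r' \<le> coh_eval M k r"
  unfolding coh_eval_def by (intro divide_right_mono) (auto intro: binomial_right_mono)

lemma symdim_pos:
  assumes "N \<ge> 1"
  shows "symdim N n > 0"
proof -
  have "onf N 0 1 (\<lambda>_ xs. if xs = [] then 1 else 0)"
    by (auto simp: onf_def sym_space_iff inner_w_def)
  then have "1 \<le> symdim N 0"
    by (rule onf_le_symdim)
  then show ?thesis
    using symdim_mono[OF assms, of 0 n] by simp
qed

lemma level_0: "N \<ge> 1 \<Longrightarrow> level N 0 = 0"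
  unfolding level_def by (intro Least_eq_0 symdim_pos)

lemma inner_proj_op:
  assumes "\<And>xs ys. xs \<in> words N M \<Longrightarrow> ys \<in> words N M \<Longrightarrow> \<rho> xs ys = proj_op \<phi> xs ys"
  shows "inner_w N M x (app_op N M \<rho> y) = cnj (inner_w N M \<phi> x) * inner_w N M \<phi> y"
proof -
  have "inner_w N M x (app_op N M \<rho> y) = inner_w N M x (\<lambda>xs. inner_w N M \<phi> y * \<phi> xs)"
    by (intro inner_w_cong) (simp_all add: app_op_def assms proj_op_def inner_w_def sum_distrib_left sum_distrib_right mult_ac)
  then show ?thesis
    by (simp add: inner_w_scale_right cnj_inner_w)
qed

text \<open>The number basis of u diagonalizes the output. Only agreement on words is assumed of
  rho, since the equality case characterizes rho on words.\<close>

lemma trace_fun_coherent: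
  assumes u: "unit_vec N u"
    and \<rho>: "\<And>xs ys. xs \<in> words N M \<Longrightarrow> ys \<in> words N M \<Longrightarrow> \<rho> xs ys = proj_op (tensor_pow M u) xs ys"
  shows "trace_fun N (k + M) f (clone_hat N M k \<rho>)
    = (\<Sum>j<symdim N (k + M). f (clone_const N M k * coh_eval M k (level N j)))"
proof -
  obtain e where e: "onb N (k + M) (symdim N (k + M)) e"
    and ev: "\<And>j. j < symdim N (k + M) \<Longrightarrow> level N j \<le> k + M \<and> number_eigen N (k + M) u (e j) (level N j)"
    using number_onb[OF u] by blast
  have form: "inner_w N (k + M) w (app_op N (k + M) (clone_hat N M k \<rho>) v)
    = of_real (clone_const N M k) * inner_w N k (contr N M (tensor_pow M u) w) (contr N M (tensor_pow M u) v)"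
    if "w \<in> sym_space N (k + M)" "v \<in> sym_space N (k + M)" for w v
  proof -
    have "inner_w N M x (app_op N M \<rho> y) = cnj (inner_w N M (tensor_pow M u) x) * inner_w N M (tensor_pow M u) y" for x y
      by (rule inner_proj_op) (rule \<rho>)
    then show ?thesis
      by (simp add: inner_clone_hat[OF that] inner_w_def[of N k] contr_eq_inner)
  qed
  show ?thesis
  proof (rule trace_fun_eq[OF _ clone_hat_sym e])
    show "sym_hermitian N (k + M) (clone_hat N M k \<rho>)"
      unfolding sym_hermitian_def by (simp add: form cnj_inner_w)
    show "weak_eigen N (k + M) (clone_hat N M k \<rho>) (e j) (clone_const N M k * coh_eval M k (level N j))"
      if "j < symdim N (k + M)" for j
      unfolding weak_eigen_def
      using inner_contr_tensor_pow[OF u] ev[OF that] onf_sym[OF onb_onf[OF e] that]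
      by (simp add: form)
  qed
qed

lemma sorting_permutation:
  fixes a :: "nat \<Rightarrow> real"
  shows "\<exists>\<pi>. bij_betw \<pi> {..<m} {..<m} \<and> (\<forall>i j. i \<le> j \<longrightarrow> j < m \<longrightarrow> a (\<pi> j) \<le> a (\<pi> i))"
proof -
  let ?l = "sort_key (\<lambda>j. - a j) [0..<m]"
  have "bij_betw ((!) ?l) {..<length ?l} (set ?l)"
    by (rule bij_betw_nth) auto
  moreover have "a (?l ! j) \<le> a (?l ! i)" if "i \<le> j" "j < m" for i j
  proof -
    have "sorted (map (\<lambda>j. - a j) ?l)"
      by simp
    from sorted_nth_mono[OF this that(1)] that show ?thesis
      by simp
  qed
  ultimately show ?thesis
    by (intro exI[of _ "(!) ?l"]) (simp add: lessThan_atLeast0)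
qed

lemma onb_permute:
  assumes v: "onb N n m v" and \<pi>: "bij_betw \<pi> {..<m} {..<m}"
  shows "onb N n m (v \<circ> \<pi>)"
proof -
  have r: "\<pi> j < m" if "j < m" for j
    using bij_betwE[OF \<pi>] that by blast
  have "inj_on \<pi> {..<m}"
    using \<pi> by (simp add: bij_betw_def)
  then have "\<pi> i = \<pi> j \<longleftrightarrow> i = j" if "i < m" "j < m" for i j
    using that by (auto simp: inj_on_def)
  then have "onf N n m (v \<circ> \<pi>)"
    using onb_onf[OF v] r by (simp add: onf_def)
  moreover have "(\<Sum>j<m. inner_w N n ((v \<circ> \<pi>) j) x * (v \<circ> \<pi>) j xs) = (\<Sum>j<m. inner_w N n (v j) x * v j xs)" for x xs
    using sum.reindex_bij_betw[OF \<pi>, of "\<lambda>j. inner_w N n (v j) x * v j xs"] by simp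
  ultimately show ?thesis
    using v by (simp add: onb_def)
qed

text \<open>Each eigenvalue is the q-average of the pure-state expectations in one sorted
  eigenbasis, so the pure-state bounds and traces average to those for rho. The last two clauses
  keep that basis and formula available for the equality case.\<close>

lemma density_clone_spectrum:
  assumes N: "N \<ge> 1" and M: "M \<ge> 1" and \<rho>: "density_op N M \<rho>"
    and eig: "onb N M p \<phi>" "\<forall>i<p. weak_eigen N M \<rho> (\<phi> i) (q i)"
      "\<forall>i<p. q i \<ge> 0" "(\<Sum>i<p. q i) = 1"
  shows "\<exists>a v.
    (\<forall>f. trace_fun N (k + M) f (clone_hat N M k \<rho>) = (\<Sum>j<symdim N (k + M). f (a j))) \<and>
    (\<forall>j<symdim N (k + M). a j \<in> {0..1} \<and> (\<forall>i\<le>j. a j \<le> a i)) \<and>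
    (\<forall>r\<le>symdim N (k + M). (\<Sum>j<r. a j) \<le> (\<Sum>j<r. clone_const N M k * coh_eval M k (level N j))) \<and>
    (\<Sum>j<symdim N (k + M). a j) = (\<Sum>j<symdim N (k + M). clone_const N M k * coh_eval M k (level N j)) \<and>
    onb N (k + M) (symdim N (k + M)) v \<and>
    (\<forall>j<symdim N (k + M). a j = clone_const N M k * (\<Sum>i<p. q i * sqnorm_w N k (contr N M (\<phi> i) (v j))))"
proof -
  note p = eig(1) eig(2)[rule_format] eig(3)[rule_format] eig(4)
  let ?n = "k + M" and ?c = "clone_const N M k"
  let ?A = "clone_hat N M k \<rho>"
  note on = onb_onf[OF p(1)]
  note herm = density_hermitian[OF \<rho>]
  have hA: "sym_hermitian N ?n ?A"
    by (rule clone_hat_hermitian[OF herm])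
  obtain m v0 a0 where v0: "onb N ?n m v0" and a0: "\<And>j. j < m \<Longrightarrow> weak_eigen N ?n ?A (v0 j) (a0 j)"
    using spectral_onb[OF hA] by blast
  have m: "m = symdim N ?n"
    by (rule onb_symdim[OF v0])
  obtain \<pi> where \<pi>: "bij_betw \<pi> {..<m} {..<m}" and sorted: "\<And>i j. i \<le> j \<Longrightarrow> j < m \<Longrightarrow> a0 (\<pi> j) \<le> a0 (\<pi> i)"
    using sorting_permutation[of m a0] by blast
  define v where "v = v0 \<circ> \<pi>"
  define a where "a j = a0 (\<pi> j)" for j
  have v: "onb N ?n m v"
    unfolding v_def by (rule onb_permute[OF v0 \<pi>])
  have ev: "weak_eigen N ?n ?A (v j) (a j)" if "j < m" for j
    using a0 bij_betwE[OF \<pi>] that by (simp add: v_def a_def)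
  have tr: "trace_fun N ?n f ?A = (\<Sum>j<m. f (a j))" for f
    by (rule trace_fun_eq[OF hA clone_hat_sym v ev])
  have form: "a j = ?c * (\<Sum>i<p. q i * sqnorm_w N k (contr N M (\<phi> i) (v j)))" if j: "j < m" for j
  proof -
    have vj: "v j \<in> sym_space N ?n"
      by (rule onf_sym[OF onb_onf[OF v] j])
    have "of_real (a j) = inner_w N ?n (v j) (app_op N ?n ?A (v j))"
      using ev[OF j] vj onf_inner[OF onb_onf[OF v] j j] by (simp add: weak_eigen_def)
    also have "\<dots> = of_real ?c * (\<Sum>x\<in>words N k. \<Sum>i<p. of_real (q i) *
        (cnj (contr N M (\<phi> i) (v j) x) * contr N M (\<phi> i) (v j) x))"
      unfolding inner_clone_hat[OF vj vj]
      using spectral_form[OF herm p(1,2) sym_space_append_left[OF vj] sym_space_append_left[OF vj]]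
      by (simp add: contr_eq_inner cnj_inner_w)
    also have "\<dots> = of_real ?c * (\<Sum>i<p. of_real (q i) * inner_w N k (contr N M (\<phi> i) (v j)) (contr N M (\<phi> i) (v j)))"
      by (subst sum.swap) (simp add: inner_w_def sum_distrib_left)
    also have "\<dots> = of_real (?c * (\<Sum>i<p. q i * sqnorm_w N k (contr N M (\<phi> i) (v j))))"
      by (simp add: inner_w_self)
    finally show ?thesis
      using of_real_eq_iff by blast
  qed
  have sums: "(\<Sum>j\<in>J. a j) = (\<Sum>i<p. ?c * q i * (\<Sum>j\<in>J. sqnorm_w N k (contr N M (\<phi> i) (v j))))"
    if "J \<subseteq> {..<m}" for J
  proof -
    have "(\<Sum>j\<in>J. a j) = (\<Sum>j\<in>J. \<Sum>i<p. ?c * q i * sqnorm_w N k (contr N M (\<phi> i) (v j)))"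
      using that by (intro sum.cong refl) (simp add: form subset_iff sum_distrib_left mult.assoc)
    then show ?thesis
      by (subst (asm) sum.swap) (simp only: sum_distrib_left)
  qed
  have total: "(\<Sum>i<p. ?c * q i * (sqnorm_w N M (\<phi> i) * x)) = ?c * x" for x
  proof -
    have "(\<Sum>i<p. ?c * q i * (sqnorm_w N M (\<phi> i) * x)) = ?c * (\<Sum>i<p. q i) * x"
      using onf_sqnorm[OF on] by (simp add: sum_distrib_left sum_distrib_right mult.assoc)
    then show ?thesis
      by (simp add: p(4))
  qed
  have c: "?c > 0"
    by (rule clone_const_pos)
  have maj: "(\<Sum>j<r. a j) \<le> (\<Sum>j<r. ?c * coh_eval M k (level N j))" if r: "r \<le> m" for r
  proof -
    have "(\<Sum>j<r. a j) = (\<Sum>i<p. ?c * q i * (\<Sum>j<r. sqnorm_w N k (contr N M (\<phi> i) (v j))))"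
      using r by (intro sums) auto
    also have "\<dots> \<le> (\<Sum>i<p. ?c * q i * (sqnorm_w N M (\<phi> i) * (\<Sum>j<r. coh_eval M k (level N j))))"
      using c p(3) onf_sym[OF on] onf_mono[OF onb_onf[OF v] r]
      by (intro sum_mono mult_left_mono pure_state_majorization N M) auto
    finally show ?thesis
      by (simp only: total) (simp only: sum_distrib_left)
  qed
  have "(\<Sum>j<m. a j) = (\<Sum>i<p. ?c * q i * (\<Sum>j<m. sqnorm_w N k (contr N M (\<phi> i) (v j))))"
    by (intro sums) auto
  also have "\<dots> = (\<Sum>i<p. ?c * q i * (sqnorm_w N M (\<phi> i) * (\<Sum>j<m. coh_eval M k (level N j))))"
    using onf_sym[OF on] by (intro sum.cong refl arg_cong2[where f = "(*)"] pure_state_trace N M v) auto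
  finally have eq: "(\<Sum>j<m. a j) = (\<Sum>j<m. ?c * coh_eval M k (level N j))"
    by (simp only: total) (simp only: sum_distrib_left)
  have anti: "a j \<le> a i" if "i \<le> j" "j < m" for i j
    using sorted[OF that] by (simp add: a_def)
  \<comment> \<open>The upper bound is the majorization inequality for one term: the largest
    eigenvalue is at most \<open>clone_const\<close>.\<close>
  have Icc: "a j \<in> {0..1}" if j: "j < m" for j
  proof -
    have "a j \<ge> 0"
      unfolding form[OF j] using c p(3) by (intro mult_nonneg_nonneg sum_nonneg) auto
    moreover have "a j \<le> a 0"
      using anti[of 0 j] j by simp
    moreover have "a 0 \<le> ?c * coh_eval M k (level N 0)"
      using maj[of 1] j by simp
    moreover have "\<dots> \<le> 1 * 1"
      using c by (intro mult_mono clone_const_le_1 N coh_eval_le_1) (auto simp: coh_eval_nonneg)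
    ultimately show ?thesis
      by simp
  qed
  show ?thesis
    unfolding m[symmetric]
    by (intro exI[of _ a] exI[of _ v] conjI allI impI tr Icc anti maj eq v form)
qed

section \<open>Equality and conclusion\<close>

lemma sqnorm_slices:
  "sqnorm_w N (k + M) v = (\<Sum>a\<in>words N k. sqnorm_w N M (\<lambda>b. v (a @ b)))"
  by (simp add: sqnorm_w_def sum_words_append)

lemma sum_sqnorm_contr:
  assumes \<phi>: "onb N M p \<phi>" and v: "v \<in> sym_space N (k + M)"
  shows "(\<Sum>i<p. sqnorm_w N k (contr N M (\<phi> i) v)) = sqnorm_w N (k + M) v"
proof -
  have "(\<Sum>i<p. sqnorm_w N k (contr N M (\<phi> i) v))
      = (\<Sum>a\<in>words N k. \<Sum>i<p. (cmod (inner_w N M (\<phi> i) (\<lambda>b. v (a @ b))))\<^sup>2)"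
    unfolding sqnorm_w_def[of N k] contr_eq_inner by (rule sum.swap)
  also have "\<dots> = (\<Sum>a\<in>words N k. sqnorm_w N M (\<lambda>b. v (a @ b)))"
    by (intro sum.cong refl parseval[OF \<phi>] sym_space_append_left[OF v])
  finally show ?thesis
    by (simp add: sqnorm_slices)
qed

text \<open>Every index with positive weight must have s i = 1, and the total 1 of s leaves room for
  only one such index.\<close>

lemma weighted_average_eq_1:
  fixes q s :: "nat \<Rightarrow> real"
  assumes q: "\<And>i. i < p \<Longrightarrow> q i \<ge> 0" "(\<Sum>i<p. q i) = 1"
    and s: "\<And>i. i < p \<Longrightarrow> s i \<ge> 0" "(\<Sum>i<p. s i) = 1"
    and qs: "(\<Sum>i<p. q i * s i) = 1"
  obtains i where "i < p" "q i = 1" "s i = 1" "\<And>j. j < p \<Longrightarrow> j \<noteq> i \<Longrightarrow> q j = 0"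
proof -
  have le: "s i \<le> 1" if "i < p" for i
    using member_le_sum[of i "{..<p}" s] s that by auto
  have "(\<Sum>i<p. q i * (1 - s i)) = 0"
    using qs q(2) by (simp add: right_diff_distrib sum_subtractf)
  then have z: "q i * (1 - s i) = 0" if "i < p" for i
    using that q(1) le by (subst (asm) sum_nonneg_eq_0_iff) auto
  have "\<exists>i<p. q i \<noteq> 0"
  proof (rule ccontr)
    assume "\<not> (\<exists>i<p. q i \<noteq> 0)"
    then have "(\<Sum>i<p. q i) = 0"
      by simp
    with q(2) show False
      by simp
  qed
  then obtain i where i: "i < p" "q i \<noteq> 0"
    by blast
  have si: "s i = 1"
    using z[OF i(1)] i(2) by simp
  have "(\<Sum>j\<in>{..<p} - {i}. s j) = 0"
    using s(2) si sum.remove[of "{..<p}" i s] i(1) by simp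
  then have s0: "s j = 0" if "j < p" "j \<noteq> i" for j
    using that s(1) by (subst (asm) sum_nonneg_eq_0_iff) auto
  have q0: "q j = 0" if "j < p" "j \<noteq> i" for j
    using z[OF that(1)] s0[OF that] by simp
  have "(\<Sum>j<p. q j) = q i"
    using q0 i(1) by (subst sum.remove[of _ i]) auto
  with q(2) have "q i = 1"
    by simp
  then show ?thesis
    using that i(1) si q0 by blast
qed

text \<open>The hypothesis says that Bessel's inequality, summed over the slices of v, is an
  equality; then each slice has zero residual and is a multiple of \<open>\<phi>\<close>.\<close>

lemma contr_full_norm_product:
  assumes v: "v \<in> sym_space N (k + M)" and \<phi>: "\<phi> \<in> sym_space N M" "sqnorm_w N M \<phi> = 1"
    and full: "sqnorm_w N k (contr N M \<phi> v) = sqnorm_w N (k + M) v"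
    and a: "a \<in> words N k" and b: "b \<in> words N M"
  shows "v (a @ b) = contr N M \<phi> v a * \<phi> b"
proof -
  have on: "onf N M 1 (\<lambda>_. \<phi>)"
    using \<phi> by (simp add: onf_def inner_w_self)
  let ?r = "\<lambda>a. resid N M 1 (\<lambda>_. \<phi>) (\<lambda>b. v (a @ b))"
  have "sqnorm_w N M (?r a) = sqnorm_w N M (\<lambda>b. v (a @ b)) - (cmod (contr N M \<phi> v a))\<^sup>2" for a
    using sqnorm_resid[OF on, of "\<lambda>b. v (a @ b)"] by (simp add: contr_eq_inner)
  then have "(\<Sum>a\<in>words N k. sqnorm_w N M (?r a)) = 0"
    using full by (simp add: sum_subtractf sqnorm_slices sqnorm_w_def[of N k])
  then have "sqnorm_w N M (?r a) = 0"
    using a by (simp add: sum_nonneg_eq_0_iff)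
  then have "?r a b = 0"
    using b by (simp add: sqnorm_w_eq_0_iff)
  then show ?thesis
    by (simp add: resid_def contr_eq_inner)
qed

lemma sqnorm_tensor_pow: "sqnorm_w N M (tensor_pow M u) = (\<Sum>x<N. (cmod (u x))\<^sup>2) ^ M"
proof (induction M)
  case 0
  then show ?case
    by (simp add: sqnorm_w_def tensor_pow_def)
next
  case (Suc M)
  have "tensor_pow (Suc M) u (x # b) = u x * tensor_pow M u b" for x b
    by (simp add: tensor_pow_def prod.lessThan_Suc_shift del: prod.lessThan_Suc)
  then have "sqnorm_w N (Suc M) (tensor_pow (Suc M) u) = (\<Sum>x<N. (cmod (u x))\<^sup>2 * sqnorm_w N M (tensor_pow M u))"
    by (simp add: sqnorm_w_def sum_words_Suc norm_mult power_mult_distrib sum_distrib_left)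
  then show ?case
    by (simp add: Suc.IH sum_distrib_right)
qed

text \<open>A symmetric vector that is a product across a bipartition can have a letter exchanged between the
  two parts, so changing one letter of \<open>\<phi>\<close> multiplies it by a factor depending on that letter only.\<close>
lemma symmetric_product_coherent:
  assumes v: "v \<in> sym_space N (k + M)" and k: "k > 0" and M: "M \<ge> 1"
    and \<phi>: "\<phi> \<in> sym_space N M" "sqnorm_w N M \<phi> = 1"
    and prod: "\<And>a b. a \<in> words N k \<Longrightarrow> b \<in> words N M \<Longrightarrow> v (a @ b) = \<eta> a * \<phi> b"
    and a0: "a0 \<in> words N k" "\<eta> a0 \<noteq> 0"
  shows "\<exists>w. unit_vec N w \<and> (\<forall>xs\<in>words N M. \<forall>ys\<in>words N M. \<phi> xs * cnj (\<phi> ys) = proj_op (tensor_pow M w) xs ys)"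
proof -
  obtain k' where k': "k = Suc k'"
    using k gr0_implies_Suc by blast
  obtain M' where M': "M = Suc M'"
    using M Suc_le_D by auto
  obtain x a' where x: "a0 = x # a'" "x < N" "a' \<in> words N k'"
    using a0(1) unfolding k' words_Suc by auto
  define \<omega> where "\<omega> y = \<eta> (y # a') / \<eta> a0" for y
  have step: "\<phi> (y # b) = \<omega> y * \<phi> (x # b)" if y: "y < N" and b: "b \<in> words N M'" for y b
  proof -
    have "\<eta> a0 * \<phi> (y # b) = v ((x # a') @ (y # b))"
      using x y b prod[of a0 "y # b"] by (simp add: k' M')
    also have "\<dots> = v ((y # a') @ (x # b))"
      by (rule sym_space_mset[OF v]) simp
    also have "\<dots> = \<eta> (y # a') * \<phi> (x # b)"
      using x y b by (intro prod) (simp_all add: k' M')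
    finally show ?thesis
      using a0(2) by (simp add: \<omega>_def field_simps)
  qed
  define t where "t = \<phi> (replicate M x)"
  have ind: "\<phi> (b @ replicate (M - j) x) = tensor_pow j \<omega> b * t" if "j \<le> M" "b \<in> words N j" for j b
    using that
  proof (induction j arbitrary: b)
    case 0
    then show ?case
      by (simp add: t_def tensor_pow_def)
  next
    case (Suc j)
    then obtain y c where b: "b = y # c" "y < N" "c \<in> words N j"
      unfolding words_Suc by auto
    have "c @ replicate (M - Suc j) x \<in> words N M'"
      using b(3) x(2) Suc.prems(1) by (auto simp: words_def M')
    then have "\<phi> (b @ replicate (M - Suc j) x) = \<omega> y * \<phi> (x # c @ replicate (M - Suc j) x)"
      using step[OF b(2)] b(1) by simp
    also have "\<phi> (x # c @ replicate (M - Suc j) x) = \<phi> (c @ replicate (M - j) x)"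
    proof (rule sym_space_mset[OF \<phi>(1)])
      have "M - j = Suc (M - Suc j)"
        using Suc.prems(1) by simp
      then show "mset (x # c @ replicate (M - Suc j) x) = mset (c @ replicate (M - j) x)"
        by simp
    qed
    also have "\<dots> = tensor_pow j \<omega> c * t"
      using Suc.prems(1) b(3) by (intro Suc.IH) auto
    also have "\<omega> y * (tensor_pow j \<omega> c * t) = tensor_pow (Suc j) \<omega> b * t"
      by (simp add: b(1) tensor_pow_def prod.lessThan_Suc_shift del: prod.lessThan_Suc)
    finally show ?case .
  qed
  have \<phi>_eq: "\<phi> b = t * tensor_pow M \<omega> b" if "b \<in> words N M" for b
    using ind[of M b] that by simp
  \<comment> \<open>The modulus of t is spread evenly over the M factors; its phase is dropped,
    since it cancels in the projection.\<close>
  define s where "s = root M (cmod t)"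
  define w where "w = (\<lambda>y. of_real s * \<omega> y)"
  have s: "s ^ M = cmod t" "s \<ge> 0"
    using M by (simp_all add: s_def real_root_pow_pos2)
  have tw: "tensor_pow M w b = of_real (cmod t) * tensor_pow M \<omega> b" for b
    by (simp add: w_def tensor_pow_def prod.distrib flip: s(1))
  have "sqnorm_w N M (tensor_pow M w) = sqnorm_w N M \<phi>"
    by (simp add: sqnorm_w_def tw \<phi>_eq norm_mult)
  then have "(\<Sum>y<N. (cmod (w y))\<^sup>2) ^ M = 1"
    by (simp add: sqnorm_tensor_pow \<phi>(2))
  then have "(\<Sum>y<N. (cmod (w y))\<^sup>2) = 1"
    using M power_eq_imp_eq_base[of "\<Sum>y<N. (cmod (w y))\<^sup>2" M 1] by (simp add: sum_nonneg)
  then have "unit_vec N w"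
    by (simp add: unit_vec_def)
  moreover have "\<phi> xs * cnj (\<phi> ys) = proj_op (tensor_pow M w) xs ys"
    if "xs \<in> words N M" "ys \<in> words N M" for xs ys
  proof -
    have "\<phi> xs * cnj (\<phi> ys) = t * cnj t * (tensor_pow M \<omega> xs * cnj (tensor_pow M \<omega> ys))"
      using that by (simp add: \<phi>_eq)
    also have "\<dots> = of_real (cmod t) * of_real (cmod t) * (tensor_pow M \<omega> xs * cnj (tensor_pow M \<omega> ys))"
      by (simp add: complex_norm_square[symmetric] power2_eq_square)
    finally show ?thesis
      by (simp add: proj_op_def tw)
  qed
  ultimately show ?thesis
    by blast
qed

text \<open>The weights q and the squared norms of the contractions of v are both probability
  vectors, so an average of 1 concentrates both on one index i. Hence rho is the projection onto
  \<open>\<phi> i\<close>, and v is a product with \<open>\<phi> i\<close> as a factor.\<close>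

lemma max_eigenvalue_coherent:
  assumes k: "k > 0" and M: "M \<ge> 1"
    and \<phi>: "onb N M p \<phi>" and q: "\<And>i. i < p \<Longrightarrow> q i \<ge> 0" "(\<Sum>i<p. q i) = 1"
    and \<rho>: "\<And>xs ys. xs \<in> words N M \<Longrightarrow> ys \<in> words N M \<Longrightarrow> \<rho> xs ys = (\<Sum>i<p. of_real (q i) * (\<phi> i xs * cnj (\<phi> i ys)))"
    and v: "v \<in> sym_space N (k + M)" "sqnorm_w N (k + M) v = 1"
    and max: "(\<Sum>i<p. q i * sqnorm_w N k (contr N M (\<phi> i) v)) = 1"
  shows "\<exists>w. unit_vec N w \<and> (\<forall>xs\<in>words N M. \<forall>ys\<in>words N M. \<rho> xs ys = proj_op (tensor_pow M w) xs ys)"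
proof -
  note on = onb_onf[OF \<phi>]
  obtain i where i: "i < p" "q i = 1" "sqnorm_w N k (contr N M (\<phi> i) v) = 1"
    "\<And>j. j < p \<Longrightarrow> j \<noteq> i \<Longrightarrow> q j = 0"
    using weighted_average_eq_1[of p q "\<lambda>i. sqnorm_w N k (contr N M (\<phi> i) v)"]
      q sum_sqnorm_contr[OF \<phi> v(1)] v(2) max by auto
  let ?\<eta> = "contr N M (\<phi> i) v"
  have prod: "v (a @ b) = ?\<eta> a * \<phi> i b" if "a \<in> words N k" "b \<in> words N M" for a b
    using i(3) v(2) that
    by (intro contr_full_norm_product[OF v(1) onf_sym[OF on i(1)] onf_sqnorm[OF on i(1)]]) auto
  obtain a0 where a0: "a0 \<in> words N k" "?\<eta> a0 \<noteq> 0"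
    using i(3) sqnorm_w_eq_0_iff[of N k ?\<eta>] by auto
  have "\<exists>w. unit_vec N w \<and> (\<forall>xs\<in>words N M. \<forall>ys\<in>words N M. \<phi> i xs * cnj (\<phi> i ys) = proj_op (tensor_pow M w) xs ys)"
    by (rule symmetric_product_coherent[OF v(1) k M onf_sym[OF on i(1)] onf_sqnorm[OF on i(1)] prod a0])
  moreover have "\<rho> xs ys = \<phi> i xs * cnj (\<phi> i ys)" if "xs \<in> words N M" "ys \<in> words N M" for xs ys
    unfolding \<rho>[OF that] using i by (subst sum.remove[of _ i]) auto
  ultimately show ?thesis
    by simp
qed

theorem theorem2:
  fixes N M k :: nat and f :: "real \<Rightarrow> real"
  assumes "N \<ge> 2" and "M \<ge> 1" and "concave_on {0..1} f"
  shows "(\<forall>\<rho> u. density_op N M \<rho> \<and> unit_vec N u \<longrightarrow>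
            trace_fun N (M+k) f (clone_hat N M k \<rho>)
              \<ge> trace_fun N (M+k) f (clone_hat N M k (proj_op (tensor_pow M u))))
       \<and> (M \<ge> 2 \<and> k > 0 \<and> strictly_concave_on {0..1} f \<longrightarrow>
          (\<forall>\<rho> u. density_op N M \<rho> \<and> unit_vec N u \<longrightarrow>
            (trace_fun N (M+k) f (clone_hat N M k \<rho>)
               = trace_fun N (M+k) f (clone_hat N M k (proj_op (tensor_pow M u)))
             \<longleftrightarrow> (\<exists>w. unit_vec N w \<and>
                    (\<forall>xs\<in>words N M. \<forall>ys\<in>words N M. \<rho> xs ys = proj_op (tensor_pow M w) xs ys)))))"
proof -
  have N: "N \<ge> 1"
    using assms(1) by simp
  let ?d = "symdim N (k + M)"
  let ?c = "clone_const N M k"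
  let ?b = "\<lambda>j. ?c * coh_eval M k (level N j)"
  \<comment> \<open>The right-hand side does not mention u: all coherent inputs give the same value,
    which settles the converse of the equality case.\<close>
  have coh: "trace_fun N (M + k) f (clone_hat N M k \<rho>) = (\<Sum>j<?d. f (?b j))"
    if "unit_vec N u" "\<And>xs ys. xs \<in> words N M \<Longrightarrow> ys \<in> words N M \<Longrightarrow> \<rho> xs ys = proj_op (tensor_pow M u) xs ys"
    for u \<rho>
    using trace_fun_coherent[of N u M \<rho> k f] that by (simp add: add.commute)
  have b_anti: "?b j \<le> ?b i" if "i \<le> j" "j < ?d" for i j
    using clone_const_pos[of N M k] that
    by (intro mult_left_mono coh_eval_antimono level_mono[of i j N "k + M"]) auto
  have b_Icc: "?b j \<in> {0..1}" for j
    using clone_const_pos[of N M k] coh_eval_nonneg[of M k "level N j"]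
      mult_mono[OF clone_const_le_1[OF N, of M k] coh_eval_le_1[of M k "level N j"]] by simp
  have ineq: "(\<Sum>j<?d. f (?b j)) \<le> trace_fun N (M + k) f (clone_hat N M k \<rho>) \<and>
     (k > 0 \<and> strictly_concave_on {0..1} f \<and> trace_fun N (M + k) f (clone_hat N M k \<rho>) = (\<Sum>j<?d. f (?b j)) \<longrightarrow>
       (\<exists>w. unit_vec N w \<and> (\<forall>xs\<in>words N M. \<forall>ys\<in>words N M. \<rho> xs ys = proj_op (tensor_pow M w) xs ys)))"
    if \<rho>: "density_op N M \<rho>" for \<rho>
  proof -
    obtain p \<phi> q where \<phi>: "onb N M p \<phi>" and ev: "\<forall>i<p. weak_eigen N M \<rho> (\<phi> i) (q i)"
      and q0: "\<forall>i<p. q i \<ge> (0::real)" and q1: "(\<Sum>i<p. q i) = 1"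
      and "\<forall>xs\<in>words N M. \<forall>ys\<in>words N M. \<rho> xs ys = (\<Sum>i<p. of_real (q i) * (\<phi> i xs * cnj (\<phi> i ys)))"
      using density_decomp[OF \<rho>] by (elim exE conjE)
    then have entry: "\<And>xs ys. xs \<in> words N M \<Longrightarrow> ys \<in> words N M \<Longrightarrow>
        \<rho> xs ys = (\<Sum>i<p. of_real (q i) * (\<phi> i xs * cnj (\<phi> i ys)))"
      by blast
    obtain a v where "\<forall>f. trace_fun N (k + M) f (clone_hat N M k \<rho>) = (\<Sum>j<?d. f (a j))"
      and "\<forall>j<?d. a j \<in> {0..1} \<and> (\<forall>i\<le>j. a j \<le> a i)"
      and "\<forall>r\<le>?d. (\<Sum>j<r. a j) \<le> (\<Sum>j<r. ?b j)"
      and eq: "(\<Sum>j<?d. a j) = (\<Sum>j<?d. ?b j)"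
      and v: "onb N (k + M) ?d v"
      and "\<forall>j<?d. a j = ?c * (\<Sum>i<p. q i * sqnorm_w N k (contr N M (\<phi> i) (v j)))"
      using density_clone_spectrum[OF N assms(2) \<rho> \<phi> ev q0 q1, of k] by (elim exE conjE)
    then have tr: "trace_fun N (k + M) f (clone_hat N M k \<rho>) = (\<Sum>j<?d. f (a j))"
      and anti: "\<And>i j. i \<le> j \<Longrightarrow> j < ?d \<Longrightarrow> a j \<le> a i"
      and Icc: "\<And>j. j < ?d \<Longrightarrow> a j \<in> {0..1}"
      and maj: "\<And>r. r \<le> ?d \<Longrightarrow> (\<Sum>j<r. a j) \<le> (\<Sum>j<r. ?b j)"
      and form: "\<And>j. j < ?d \<Longrightarrow> a j = ?c * (\<Sum>i<p. q i * sqnorm_w N k (contr N M (\<phi> i) (v j)))"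
      by blast+
    have le: "(\<Sum>j<?d. f (?b j)) \<le> (\<Sum>j<?d. f (a j))"
      using Icc b_Icc anti b_anti by (intro karamata[OF assms(3) _ _ maj eq]) auto
    have "\<exists>w. unit_vec N w \<and> (\<forall>xs\<in>words N M. \<forall>ys\<in>words N M. \<rho> xs ys = proj_op (tensor_pow M w) xs ys)"
      if k: "k > 0" and sc: "strictly_concave_on {0..1} f" and eqf: "(\<Sum>j<?d. f (a j)) = (\<Sum>j<?d. f (?b j))"
    proof -
      have d: "0 < ?d"
        by (rule symdim_pos[OF N])
      \<comment> \<open>Index 0 has level 0, so the coherent value there is
        \<open>clone_const\<close>; dividing by it leaves an average equal to 1.\<close>
      have "a 0 = ?b 0"
        using Icc b_Icc anti b_anti d by (intro karamata_strict[OF assms(3) sc _ _ maj eq eqf]) auto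
      also have "\<dots> = ?c"
        by (simp add: level_0[OF N] coh_eval_def)
      finally have top: "(\<Sum>i<p. q i * sqnorm_w N k (contr N M (\<phi> i) (v 0))) = 1"
        using form[OF d] clone_const_pos[of N M k] by simp
      show ?thesis
        by (rule max_eigenvalue_coherent[OF k assms(2) \<phi> q0[rule_format] q1 entry
              onf_sym[OF onb_onf[OF v] d] onf_sqnorm[OF onb_onf[OF v] d] top])
    qed
    with le show ?thesis
      using tr by (simp add: add.commute)
  qed
  show ?thesis
  proof (intro conjI allI impI iffI)
    show "trace_fun N (M + k) f (clone_hat N M k (proj_op (tensor_pow M u)))
        \<le> trace_fun N (M + k) f (clone_hat N M k \<rho>)"
      if "density_op N M \<rho> \<and> unit_vec N u" for \<rho> u
      using ineq[of \<rho>] coh[of u "proj_op (tensor_pow M u)"] that by simp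
    fix \<rho> u assume sc: "2 \<le> M \<and> 0 < k \<and> strictly_concave_on {0..1} f"
      and \<rho>: "density_op N M \<rho> \<and> unit_vec N u"
    have cu: "trace_fun N (M + k) f (clone_hat N M k (proj_op (tensor_pow M u))) = (\<Sum>j<?d. f (?b j))"
      using \<rho> by (intro coh) auto
    show "\<exists>w. unit_vec N w \<and> (\<forall>xs\<in>words N M. \<forall>ys\<in>words N M. \<rho> xs ys = proj_op (tensor_pow M w) xs ys)"
      if "trace_fun N (M + k) f (clone_hat N M k \<rho>) = trace_fun N (M + k) f (clone_hat N M k (proj_op (tensor_pow M u)))"
      using ineq[of \<rho>] sc \<rho> that cu by simp
    show "trace_fun N (M + k) f (clone_hat N M k \<rho>) = trace_fun N (M + k) f (clone_hat N M k (proj_op (tensor_pow M u)))"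
      if "\<exists>w. unit_vec N w \<and> (\<forall>xs\<in>words N M. \<forall>ys\<in>words N M. \<rho> xs ys = proj_op (tensor_pow M w) xs ys)"
      using that coh cu by (metis (no_types, lifting))
  qed
qed

end
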